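(* Let $\mathcal{I}$ be a set equipped with a non-principal ultrafilter, let $\{\mathbf{k}_i\}_{i\in\mathcal{I}}$ be a family of fields, let $R_i=\mathbf{k}_i[x_1,x_2,\dots]$ be the polynomial ring in countably many variables with the standard grading, and let $\mathbf{S}$ be the graded ultraproduct of the $R_i$. Then $\mathbf{S}$ is a polynomial ring.
   Context: Graded means graded by the non-negative integers; the standard grading has every $x_j$ in degree $1$. The graded ultraproduct $\mathbf{S}=\bigoplus_{d\ge 0}\mathbf{S}_d$ is the graded ring whose degree $d$ piece $\mathbf{S}_d$ is the ultraproduct of the degree $d$ pieces $(R_i)_d$ with respect to the given ultrafilter; in particular $\mathbf{S}_0$ is the field that is the ultraproduct of the $\mathbf{k}_i$. A graded ring $R$ with $R_0$ a field is a polynomial ring if there is a (possibly infinite) set of homogeneous elements of positive degree that is algebraically independent over $R_0$ and generates $R$ as an $R_0$-algebra. *)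

theory Defs
  imports "HOL-Algebra.Algebra"
begin

text \<open>
  An ultrafilter is given as a filter \<open>U\<close>; its members are the sets \<open>A\<close> such that
  \<open>eventually (\<lambda>i. i \<in> A) U\<close>.
\<close>

definition ultrafilter :: "'i filter \<Rightarrow> bool" where
  "ultrafilter U \<longleftrightarrow>
     U \<noteq> bot \<and> (\<forall>P. eventually P U \<or> eventually (\<lambda>i. \<not> P i) U)"

definition nonprincipal_ultrafilter :: "'i filter \<Rightarrow> bool" where
  "nonprincipal_ultrafilter U \<longleftrightarrow> ultrafilter U \<and> (\<forall>i. U \<noteq> principal {i})"

text \<open>
  The elements, the addition and the constants are those of
  \<open>HOL-Algebra.Indexed_Polynomials\<close>, where a polynomial maps each monomial, a multiset
  of variables, to its coefficient. That theory only multiplies by a single variable.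
\<close>

definition indexed_mult ::
    "('a, 'm) ring_scheme \<Rightarrow> ('v multiset \<Rightarrow> 'a) \<Rightarrow> ('v multiset \<Rightarrow> 'a) \<Rightarrow> ('v multiset \<Rightarrow> 'a)"
  where "indexed_mult K p q =
    (\<lambda>m. \<Oplus>\<^bsub>K\<^esub>a\<in>{a. a \<subseteq># m}. p a \<otimes>\<^bsub>K\<^esub> q (m - a))"

definition indexed_poly_ring ::
    "('a, 'm) ring_scheme \<Rightarrow> 'v set \<Rightarrow> ('v multiset \<Rightarrow> 'a) ring"
  where "indexed_poly_ring K V =
    \<lparr> carrier = ring.indexed_pset K V (carrier K),
      monoid.mult = indexed_mult K,
      one = ring.indexed_const K \<one>\<^bsub>K\<^esub>,
      ring.zero = ring.indexed_const K \<zero>\<^bsub>K\<^esub>,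
      ring.add = ring.indexed_padd K \<rparr>"

definition std_homogeneous ::
    "('a, 'm) ring_scheme \<Rightarrow> 'v set \<Rightarrow> nat \<Rightarrow> ('v multiset \<Rightarrow> 'a) set"
  where "std_homogeneous K V d =
    {p \<in> carrier (indexed_poly_ring K V). \<forall>m. p m \<noteq> \<zero>\<^bsub>K\<^esub> \<longrightarrow> size m = d}"

lemma (in ring) indexed_pset_iff:
  assumes K: "subring K R"
  shows "p \<in> indexed_pset I K \<longleftrightarrow>
    (\<forall>m. p m \<in> K) \<and> finite {m. p m \<noteq> \<zero>} \<and> (\<forall>m. p m \<noteq> \<zero> \<longrightarrow> set_mset m \<subseteq> I)"
proof
  assume "p \<in> indexed_pset I K"
  then show "(\<forall>m. p m \<in> K) \<and> finite {m. p m \<noteq> \<zero>} \<and> (\<forall>m. p m \<noteq> \<zero> \<longrightarrow> set_mset m \<subseteq> I)"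
  proof induction
    case (indexed_const k)
    have "finite {m. local.indexed_const k m \<noteq> \<zero>}"
      by (rule finite_subset[of _ "{{#}}"]) (auto simp: indexed_const_def)
    then show ?case
      using indexed_const subringE(2)[OF K] by (auto simp: indexed_const_def)
  next
    case (indexed_padd P Q)
    have "finite {m. (P \<Oplus> Q) m \<noteq> \<zero>}"
      by (rule finite_subset[of _ "{m. P m \<noteq> \<zero>} \<union> {m. Q m \<noteq> \<zero>}"])
        (use indexed_padd in \<open>auto simp: indexed_padd_def\<close>)
    moreover have "(P \<Oplus> Q) m \<in> K" for m
      using indexed_padd subringE(7)[OF K] by (simp add: indexed_padd_def)
    moreover have "set_mset m \<subseteq> I" if "(P \<Oplus> Q) m \<noteq> \<zero>" for m
    proof -
      have "P m \<noteq> \<zero> \<or> Q m \<noteq> \<zero>"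
        using that by (auto simp: indexed_padd_def)
      then show ?thesis using indexed_padd.IH by blast
    qed
    ultimately show ?case by blast
  next
    case (indexed_pmult P i)
    have *: "m \<in> add_mset i ` {m. P m \<noteq> \<zero>}" if "(P \<Otimes> i) m \<noteq> \<zero>" for m
    proof
      show "m = add_mset i (m - {#i#})" "m - {#i#} \<in> {m. P m \<noteq> \<zero>}"
        using that by (auto simp: indexed_pmult_def split: if_splits)
    qed
    have "finite {m. (P \<Otimes> i) m \<noteq> \<zero>}"
      by (rule finite_subset[of _ "add_mset i ` {m. P m \<noteq> \<zero>}"])
        (use indexed_pmult * in auto)
    moreover have "(P \<Otimes> i) m \<in> K" for m
      using indexed_pmult subringE(2)[OF K] by (simp add: indexed_pmult_def)
    moreover have "set_mset m \<subseteq> I" if "(P \<Otimes> i) m \<noteq> \<zero>" for m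
      using *[OF that] indexed_pmult by (fastforce simp: subset_iff)
    ultimately show ?case by blast
  qed
next
  have monom: "(\<lambda>n. if n = m then c else \<zero>) \<in> indexed_pset I K"
    if "set_mset m \<subseteq> I" "c \<in> K" for m c
    using that
  proof (induction m)
    case empty
    then show ?case using indexed_pset.indexed_const[of c K I]
      by (simp add: indexed_const_def)
  next
    case (add i m)
    then have "(\<lambda>n. if n = m then c else \<zero>) \<Otimes> i \<in> indexed_pset I K"
      by (intro indexed_pset.indexed_pmult) auto
    moreover have "(\<lambda>n. if n = m then c else \<zero>) \<Otimes> i = (\<lambda>n. if n = add_mset i m then c else \<zero>)"
      by (auto simp: indexed_pmult_def fun_eq_iff)
    ultimately show ?case by simp
  qed
  assume "(\<forall>m. p m \<in> K) \<and> finite {m. p m \<noteq> \<zero>} \<and> (\<forall>m. p m \<noteq> \<zero> \<longrightarrow> set_mset m \<subseteq> I)"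
  moreover have "(\<forall>m. p m \<in> K) \<Longrightarrow> (\<forall>m. p m \<noteq> \<zero> \<longrightarrow> set_mset m \<subseteq> I) \<Longrightarrow>
      {m. p m \<noteq> \<zero>} \<subseteq> S \<Longrightarrow> p \<in> indexed_pset I K" if "finite S" for S
    using that
  proof (induction S arbitrary: p rule: finite_induct)
    case empty
    then have "p = indexed_const \<zero>"
      by (auto simp: indexed_const_def fun_eq_iff)
    then show ?case
      using indexed_pset.indexed_const[of \<zero> K I] subringE(2)[OF K] by simp
  next
    case (insert m S)
    show ?case
    proof (cases "p m = \<zero>")
      case True
      then show ?thesis using insert by blast
    next
      case False
      have K_carr: "K \<subseteq> carrier R" using subringE(1)[OF K] .
      have "p(m := \<zero>) \<in> indexed_pset I K"
        by (rule insert.IH) (use insert.prems subringE(2)[OF K] in \<open>auto split: if_splits\<close>)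
      moreover have "(\<lambda>n. if n = m then p m else \<zero>) \<in> indexed_pset I K"
        using monom insert.prems False by blast
      ultimately have "p(m := \<zero>) \<Oplus> (\<lambda>n. if n = m then p m else \<zero>) \<in> indexed_pset I K"
        by (rule indexed_pset.indexed_padd)
      moreover have "p(m := \<zero>) \<Oplus> (\<lambda>n. if n = m then p m else \<zero>) = p"
        using K_carr insert.prems(1) by (auto simp: indexed_padd_def fun_eq_iff subset_iff)
      ultimately show ?thesis by simp
    qed
  qed
  ultimately show "p \<in> indexed_pset I K" by blast
qed

text \<open>
  A grading of \<open>R\<close> is the family \<open>G\<close> of its homogeneous pieces, of which \<open>R\<close> is the
  internal direct sum. All rings here are commutative.
\<close>

definition graded_ring :: "('b, 'm) ring_scheme \<Rightarrow> (nat \<Rightarrow> 'b set) \<Rightarrow> bool" where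
  "graded_ring R G \<longleftrightarrow>
     cring R \<and>
     (\<forall>d. additive_subgroup (G d) R) \<and>
     \<one>\<^bsub>R\<^esub> \<in> G 0 \<and>
     (\<forall>d e. \<forall>x\<in>G d. \<forall>y\<in>G e. x \<otimes>\<^bsub>R\<^esub> y \<in> G (d + e)) \<and>
     (\<forall>x\<in>carrier R. \<exists>!c. (\<forall>d. c d \<in> G d) \<and> finite {d. c d \<noteq> \<zero>\<^bsub>R\<^esub>} \<and>
        x = (\<Oplus>\<^bsub>R\<^esub>d\<in>{d. c d \<noteq> \<zero>\<^bsub>R\<^esub>}. c d))"

text \<open>The value of a polynomial whose variables are elements of \<open>R\<close> at these elements.\<close>

definition eval_poly :: "('b, 'm) ring_scheme \<Rightarrow> ('b multiset \<Rightarrow> 'b) \<Rightarrow> 'b" where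
  "eval_poly R p =
     (\<Oplus>\<^bsub>R\<^esub>m\<in>{m. p m \<noteq> \<zero>\<^bsub>R\<^esub>}.
        p m \<otimes>\<^bsub>R\<^esub> (\<Otimes>\<^bsub>R\<^esub>x\<in>set_mset m. x [^]\<^bsub>R\<^esub> count m x))"

definition algebraically_independent ::
    "('b, 'm) ring_scheme \<Rightarrow> 'b set \<Rightarrow> 'b set \<Rightarrow> bool"
  where "algebraically_independent R K B \<longleftrightarrow>
    B \<subseteq> carrier R \<and>
    (\<forall>p\<in>ring.indexed_pset R B K.
       eval_poly R p = \<zero>\<^bsub>R\<^esub> \<longrightarrow> p = ring.indexed_const R \<zero>\<^bsub>R\<^esub>)"

text \<open>
  The \<open>K\<close>-subalgebra generated by \<open>B\<close> is the subring generated by \<open>K \<union> B\<close>.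
\<close>

definition graded_polynomial_ring :: "('b, 'm) ring_scheme \<Rightarrow> (nat \<Rightarrow> 'b set) \<Rightarrow> bool" where
  "graded_polynomial_ring R G \<longleftrightarrow>
     graded_ring R G \<and> subfield (G 0) R \<and>
     (\<exists>B. B \<subseteq> (\<Union>d\<in>{0<..}. G d) \<and>
          algebraically_independent R (G 0) B \<and>
          generate_ring R (G 0 \<union> B) = carrier R)"

definition ultra_rel :: "'i filter \<Rightarrow> ('i \<Rightarrow> 'b set) \<Rightarrow> (('i \<Rightarrow> 'b) \<times> ('i \<Rightarrow> 'b)) set" where
  "ultra_rel U A =
     {(f, g). f \<in> Pi UNIV A \<and> g \<in> Pi UNIV A \<and> eventually (\<lambda>i. f i = g i) U}"

definition ultraproduct :: "'i filter \<Rightarrow> ('i \<Rightarrow> 'b set) \<Rightarrow> ('i \<Rightarrow> 'b) set set" where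
  "ultraproduct U A = Pi UNIV A // ultra_rel U A"

text \<open>
  An element of the direct sum of the ultraproducts of the graded pieces is a finitely
  supported function \<open>x\<close> whose value \<open>x d\<close> is an equivalence class of families
  \<open>f\<close> with \<open>f i \<in> G i d\<close>. The operations are computed on representatives: the product
  has in degree \<open>d\<close> the class of
  \<open>\<lambda>i. \<Sum>j\<le>d. f j i * g (d - j) i\<close>, where \<open>f j\<close> and \<open>g j\<close> represent \<open>x j\<close>
  and \<open>y j\<close>.
\<close>

definition graded_ultraproduct ::
    "'i filter \<Rightarrow> ('i \<Rightarrow> ('b, 'm) ring_scheme) \<Rightarrow> ('i \<Rightarrow> nat \<Rightarrow> 'b set) \<Rightarrow>
     (nat \<Rightarrow> ('i \<Rightarrow> 'b) set) ring"
  where "graded_ultraproduct U R G =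
    (let A = (\<lambda>d i. G i d);
         zero_class = (\<lambda>d. ultra_rel U (A d) `` {\<lambda>i. \<zero>\<^bsub>R i\<^esub>})
     in
    \<lparr> carrier = {x. (\<forall>d. x d \<in> ultraproduct U (A d)) \<and> finite {d. x d \<noteq> zero_class d}},
      monoid.mult = (\<lambda>x y d. {h \<in> Pi UNIV (A d). \<exists>f g.
         (\<forall>j\<le>d. f j \<in> x j \<and> g j \<in> y j) \<and>
         eventually (\<lambda>i. h i = (\<Oplus>\<^bsub>R i\<^esub>j\<in>{..d}. f j i \<otimes>\<^bsub>R i\<^esub> g (d - j) i)) U}),
      one = (\<lambda>d. if d = 0 then ultra_rel U (A 0) `` {\<lambda>i. \<one>\<^bsub>R i\<^esub>} else zero_class d),
      ring.zero = zero_class,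
      ring.add = (\<lambda>x y d. {h \<in> Pi UNIV (A d). \<exists>f\<in>x d. \<exists>g\<in>y d.
         eventually (\<lambda>i. h i = f i \<oplus>\<^bsub>R i\<^esub> g i) U}) \<rparr>)"

definition graded_ultraproduct_piece ::
    "'i filter \<Rightarrow> ('i \<Rightarrow> ('b, 'm) ring_scheme) \<Rightarrow> ('i \<Rightarrow> nat \<Rightarrow> 'b set) \<Rightarrow>
     nat \<Rightarrow> (nat \<Rightarrow> ('i \<Rightarrow> 'b) set) set"
  where "graded_ultraproduct_piece U R G d =
    {x \<in> carrier (graded_ultraproduct U R G).
       \<forall>e. e \<noteq> d \<longrightarrow> x e = \<zero>\<^bsub>graded_ultraproduct U R G\<^esub> e}"

end

theory Submission
  imports Defs
begin

text \<open>
  Throughout, \<open>R\<close> is a graded ring whose piece \<open>K\<close> of degree \<open>0\<close> is a field; \<open>p\<close> is the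
  characteristic of \<open>K\<close>.

  The ultraproduct is a polynomial ring because it has many endomorphisms that change a homogeneous
  element only by terms of lower degree. On a ring of polynomials, substituting \<open>x\<^sub>j + 1\<close> for \<open>x\<^sub>j\<close> changes a form of degree
  \<open>d\<close> by terms of degree less than \<open>d\<close>, and a form of positive degree that is fixed by these
  substitutions for all \<open>j\<close> is zero (\<open>lowering_shift\<close>). Choosing an index \<open>j\<close> in each factor
  separately, one obtains endomorphisms of the ultraproduct with the same two properties
  (\<open>lowering_S\<close>). The rest of the argument concerns a graded ring \<open>R\<close> with a family of such
  endomorphisms \<open>\<tau>\<close>, and shows that it is a polynomial ring
  (\<open>graded_polynomial_ring_if_lowering\<close>).

  Go through the homogeneous elements of positive degree in the order of their degrees, and along a
  well-ordering within each degree. Call \<open>e\<close> a generator if it is not in the ring \<open>A\<close> that is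
  generated by all elements of smaller degree, the earlier ones of the same degree, and all
  \<open>p\<close>-th powers if \<open>p > 0\<close>. These elements generate \<open>R\<close> over \<open>K\<close> (\<open>gens_generate\<close>). For each
  generator \<open>e\<close>, the powers \<open>e ^ j\<close>, with \<open>j < p\<close> if \<open>p > 0\<close>, are linearly independent over
  \<open>A\<close> (\<open>powers_independent\<close>): applying \<open>\<tau>\<close> to a relation of least degree and comparing
  coefficients shows that its leading coefficient \<open>c\<close> is fixed by every \<open>\<tau>\<close>, hence lies in \<open>K\<close>,
  and that \<open>c' + D * c * e\<close> is fixed, where \<open>D\<close> is the degree of the relation in \<open>e\<close> and \<open>c'\<close> its
  second coefficient. Then \<open>c' + D * c * e = 0\<close>, so that \<open>e\<close> belongs to \<open>A\<close>, a contradiction.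
  Eliminating one generator after the other, one finds that the monomials in the generators, with
  exponents below \<open>p\<close> if \<open>p > 0\<close>, are linearly independent over the ring generated by \<open>K\<close> and
  the \<open>p\<close>-th powers (\<open>restricted_monomials_independent\<close>). In characteristic zero nothing
  remains to be done.

  In characteristic \<open>p\<close>, sorting the monomials of a polynomial relation by their exponents modulo
  \<open>p\<close> therefore leaves relations \<open>\<Sum>i. c\<^sub>i * y\<^sub>i ^ p = 0\<close> with \<open>c\<^sub>i\<close> in \<open>K\<close> and smaller monomials
  \<open>y\<^sub>i\<close>. Elements of \<open>K\<close> that are linearly independent over the \<open>p\<close>-th powers of \<open>K\<close> remain so
  over the \<open>p\<close>-th powers of \<open>R\<close>, again by means of the endomorphisms
  (\<open>frob_independent_extend\<close>). Expressing the \<open>c\<^sub>i\<close> in terms of such elements, one can extract a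
  \<open>p\<close>-th root and arrives at a relation between smaller monomials (\<open>frob_relation_descent\<close>),
  so that induction finishes the proof (\<open>monomials_independent\<close>).
\<close>

section \<open>Sums, the binomial theorem and the Frobenius map\<close>

lemma (in comm_monoid) finprod_swap:
  assumes "finite A" "finite B" "\<And>a b. a \<in> A \<Longrightarrow> b \<in> B \<Longrightarrow> f a b \<in> carrier G"
  shows "(\<Otimes>a\<in>A. \<Otimes>b\<in>B. f a b) = (\<Otimes>b\<in>B. \<Otimes>a\<in>A. f a b)"
  using assms(1,3)
proof (induction A)
  case empty
  then show ?case by simp
next
  case (insert x A)
  have "(\<Otimes>a\<in>insert x A. \<Otimes>b\<in>B. f a b) = (\<Otimes>b\<in>B. f x b) \<otimes> (\<Otimes>a\<in>A. \<Otimes>b\<in>B. f a b)"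
    using insert by (intro finprod_insert) auto
  also have "\<dots> = (\<Otimes>b\<in>B. f x b) \<otimes> (\<Otimes>b\<in>B. \<Otimes>a\<in>A. f a b)"
    using insert by simp
  also have "\<dots> = (\<Otimes>b\<in>B. f x b \<otimes> (\<Otimes>a\<in>A. f a b))"
    using insert by (intro finprod_multf[symmetric]) auto
  also have "\<dots> = (\<Otimes>b\<in>B. \<Otimes>a\<in>insert x A. f a b)"
    using insert by (intro finprod_cong' refl finprod_insert[symmetric]) auto
  finally show ?case .
qed

lemmas (in abelian_monoid) finsum_swap = add.finprod_swap

lemma (in cring) binomial_ring:
  assumes x: "x \<in> carrier R" and y: "y \<in> carrier R"
  shows "(x \<oplus> y) [^] n = (\<Oplus>k\<in>{..n}. add_pow R (n choose k) (x [^] (n - k) \<otimes> y [^] k))"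
proof (induction n)
  case 0
  then show ?case by simp
next
  case (Suc n)
  let ?f = "\<lambda>k. add_pow R (n choose k) (x [^] (n - k) \<otimes> y [^] k)"
  let ?g = "\<lambda>k. add_pow R (n choose k) (x [^] (Suc n - k) \<otimes> y [^] k)"
  let ?h = "\<lambda>k. if k = 0 then \<zero> else add_pow R (n choose (k - 1)) (x [^] (Suc n - k) \<otimes> y [^] k)"
  have "(x \<oplus> y) [^] Suc n = (\<Oplus>k\<in>{..n}. ?f k) \<otimes> x \<oplus> (\<Oplus>k\<in>{..n}. ?f k) \<otimes> y"
    using x y by (simp add: Suc r_distr)
  moreover have "(\<Oplus>k\<in>{..n}. ?f k) \<otimes> x = (\<Oplus>k\<in>{..Suc n}. ?g k)"
  proof -
    have "(\<Oplus>k\<in>{..n}. ?f k) \<otimes> x = (\<Oplus>k\<in>{..n}. ?f k \<otimes> x)"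
      using x y by (intro finsum_ldistr) auto
    also have "\<dots> = (\<Oplus>k\<in>{..n}. ?g k)"
    proof (intro finsum_cong' refl)
      fix k assume "k \<in> {..n}"
      then have "x [^] (Suc n - k) = x [^] (n - k) \<otimes> x" by (simp add: Suc_diff_le)
      moreover have "?f k \<otimes> x = add_pow R (n choose k) (x [^] (n - k) \<otimes> y [^] k \<otimes> x)"
        using x y by (intro add_pow_ldistr) auto
      ultimately show "?f k \<otimes> x = ?g k"
        using x y by (simp add: m_ac)
    qed (use x y in auto)
    also have "\<dots> = (\<Oplus>k\<in>{..Suc n}. ?g k)"
      using x y by (simp add: finsum_Suc Pi_iff binomial_eq_0)
    finally show ?thesis .
  qed
  moreover have "(\<Oplus>k\<in>{..n}. ?f k) \<otimes> y = (\<Oplus>k\<in>{..Suc n}. ?h k)"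
  proof -
    have "(\<Oplus>k\<in>{..n}. ?f k) \<otimes> y = (\<Oplus>k\<in>{..n}. ?f k \<otimes> y)"
      using x y by (intro finsum_ldistr) auto
    also have "\<dots> = (\<Oplus>k\<in>{..n}. ?h (Suc k))"
    proof (intro finsum_cong' refl)
      fix k assume "k \<in> {..n}"
      have "?f k \<otimes> y = add_pow R (n choose k) (x [^] (n - k) \<otimes> y [^] k \<otimes> y)"
        using x y by (intro add_pow_ldistr) auto
      then show "?f k \<otimes> y = ?h (Suc k)"
        using x y by (simp add: m_assoc)
    qed (use x y in auto)
    also have "\<dots> = (\<Oplus>k\<in>{..Suc n}. ?h k)"
      using x y by (subst finsum_Suc2) auto
    finally show ?thesis .
  qed
  moreover have "(\<Oplus>k\<in>{..Suc n}. ?g k) \<oplus> (\<Oplus>k\<in>{..Suc n}. ?h k) = (\<Oplus>k\<in>{..Suc n}. ?g k \<oplus> ?h k)"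
    using x y by (intro finsum_addf[symmetric]) auto
  moreover have "(\<Oplus>k\<in>{..Suc n}. ?g k \<oplus> ?h k) =
      (\<Oplus>k\<in>{..Suc n}. add_pow R (Suc n choose k) (x [^] (Suc n - k) \<otimes> y [^] k))"
  proof (intro finsum_cong' refl)
    fix k assume k: "k \<in> {..Suc n}"
    show "?g k \<oplus> ?h k = add_pow R (Suc n choose k) (x [^] (Suc n - k) \<otimes> y [^] k)"
    proof (cases k)
      case 0
      then show ?thesis using x y by simp
    next
      case (Suc j)
      then show ?thesis using x y by (simp add: add.nat_pow_mult add.commute)
    qed
  qed (use x y in auto)
  ultimately show ?case by simp
qed

lemma (in cring) add_pow_eq_zero:
  assumes "add_pow R (p::nat) \<one> = \<zero>" "p dvd n" "x \<in> carrier R"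
  shows "add_pow R n x = \<zero>"
proof -
  obtain q where q: "n = p * q" using assms(2) by blast
  have "add_pow R p (\<one> \<otimes> x) = (add_pow R p \<one>) \<otimes> x"
    using assms(3) by (intro add_pow_ldistr[symmetric]) auto
  then have "add_pow R p x = \<zero>" using assms by simp
  then show ?thesis
    using assms(3) by (simp add: q add.nat_pow_pow[symmetric])
qed

text \<open>
  The Frobenius map is additive because a prime \<open>p\<close> divides the binomial coefficients
  \<open>p choose k\<close> with \<open>0 < k < p\<close>.
\<close>
lemma (in cring) frobenius_add:
  assumes p: "Factorial_Ring.prime p" "add_pow R (p::nat) \<one> = \<zero>" and x: "x \<in> carrier R" and y: "y \<in> carrier R"
  shows "(x \<oplus> y) [^] p = x [^] p \<oplus> y [^] p"
proof -
  let ?f = "\<lambda>k. add_pow R (p choose k) (x [^] (p - k) \<otimes> y [^] k)"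
  have p0: "p \<noteq> 0" using p(1) by auto
  have "(x \<oplus> y) [^] p = (\<Oplus>k\<in>{..p}. ?f k)"
    using x y by (rule binomial_ring)
  also have "\<dots> = (\<Oplus>k\<in>{0,p}. ?f k)"
  proof (rule add.finprod_mono_neutral_cong_right)
    show "?f k = \<zero>" if "k \<in> {..p} - {0,p}" for k
    proof -
      have "p dvd (p choose k)"
      proof (rule dvd_choose_prime)
        show "k < p" "k \<noteq> 0" using that by simp_all
      qed (fact p0 p(1))+
      then show ?thesis using x y by (intro add_pow_eq_zero[OF p(2)]) auto
    qed
  qed (use x y in auto)
  also have "\<dots> = x [^] p \<oplus> y [^] p"
    using x y p0 by (subst finsum_insert) auto
  finally show ?thesis .
qed

lemma (in cring) frobenius_finsum:
  assumes p: "Factorial_Ring.prime p" "add_pow R (p::nat) \<one> = \<zero>" and "finite A" "f \<in> A \<rightarrow> carrier R"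
  shows "(\<Oplus>a\<in>A. f a) [^] p = (\<Oplus>a\<in>A. f a [^] p)"
  using assms(3,4)
proof (induction A)
  case empty
  have "p \<noteq> 0" using p(1) by auto
  then show ?case by (simp add: nat_pow_zero)
next
  case (insert a A)
  then show ?case by (simp add: frobenius_add[OF p] Pi_iff)
qed

lemma (in cring) frobenius_minus:
  assumes p: "Factorial_Ring.prime p" "add_pow R (p::nat) \<one> = \<zero>" and x: "x \<in> carrier R" and y: "y \<in> carrier R"
  shows "(x \<ominus> y) [^] p = x [^] p \<ominus> y [^] p"
proof -
  have "x [^] p = ((x \<ominus> y) \<oplus> y) [^] p"
    using x y by (simp add: minus_eq a_assoc l_neg)
  also have "\<dots> = (x \<ominus> y) [^] p \<oplus> y [^] p"
    using x y by (intro frobenius_add[OF p]) auto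
  finally show ?thesis
    using x y by (simp add: minus_eq a_assoc r_neg)
qed

section \<open>Homogeneous components\<close>

locale graded = cring R for R (structure) +
  fixes G :: "nat \<Rightarrow> 'a set"
  assumes graded: "graded_ring R G"
begin

definition is_decomp :: "'a \<Rightarrow> (nat \<Rightarrow> 'a) \<Rightarrow> bool" where
  "is_decomp x c \<longleftrightarrow> (\<forall>d. c d \<in> G d) \<and> finite {d. c d \<noteq> \<zero>} \<and> x = (\<Oplus>d\<in>{d. c d \<noteq> \<zero>}. c d)"

definition hcomp :: "nat \<Rightarrow> 'a \<Rightarrow> 'a" where
  "hcomp d x = (THE c. is_decomp x c) d"

lemma G_subgroup: "additive_subgroup (G d) R"
  and one_G: "\<one> \<in> G 0"
  and G_mult: "x \<in> G d \<Longrightarrow> y \<in> G e \<Longrightarrow> x \<otimes> y \<in> G (d + e)"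
  and ex1_decomp: "x \<in> carrier R \<Longrightarrow> \<exists>!c. is_decomp x c"
  using graded unfolding graded_ring_def is_decomp_def by blast+

lemma G_carrier: "x \<in> G d \<Longrightarrow> x \<in> carrier R"
  using additive_subgroup.a_subset[OF G_subgroup] by blast

lemma zero_G: "\<zero> \<in> G d"
  by (rule additive_subgroup.zero_closed[OF G_subgroup])

lemma G_add: "x \<in> G d \<Longrightarrow> y \<in> G d \<Longrightarrow> x \<oplus> y \<in> G d"
  by (rule additive_subgroup.a_closed[OF G_subgroup])

lemma G_neg: "x \<in> G d \<Longrightarrow> \<ominus> x \<in> G d"
  using additive_subgroup.a_inv_closed[OF G_subgroup] .

lemma G_pow: "x \<in> G d \<Longrightarrow> x [^] (n::nat) \<in> G (n * d)"
  by (induction n) (auto simp: one_G add.commute dest: G_mult)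

lemma decomp_hcomp: "x \<in> carrier R \<Longrightarrow> is_decomp x (\<lambda>d. hcomp d x)"
  using theI'[OF ex1_decomp[of x]] unfolding hcomp_def by simp

lemma hcomp_unique: "x \<in> carrier R \<Longrightarrow> is_decomp x c \<Longrightarrow> hcomp d x = c d"
  using ex1_decomp[of x] decomp_hcomp[of x] by blast

lemma hcomp_G: "x \<in> carrier R \<Longrightarrow> hcomp d x \<in> G d"
  using decomp_hcomp unfolding is_decomp_def by blast

lemma hcomp_closed: "x \<in> carrier R \<Longrightarrow> hcomp d x \<in> carrier R"
  by (rule G_carrier[OF hcomp_G])

lemma finite_hcomp: "x \<in> carrier R \<Longrightarrow> finite {d. hcomp d x \<noteq> \<zero>}"
  using decomp_hcomp unfolding is_decomp_def by blast

lemma sum_hcomp: "x \<in> carrier R \<Longrightarrow> x = (\<Oplus>d\<in>{d. hcomp d x \<noteq> \<zero>}. hcomp d x)"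
  using decomp_hcomp unfolding is_decomp_def by blast

lemma sum_hcomp_superset:
  assumes "x \<in> carrier R" "finite D" "\<And>d. hcomp d x \<noteq> \<zero> \<Longrightarrow> d \<in> D"
  shows "x = (\<Oplus>d\<in>D. hcomp d x)"
proof -
  have "(\<Oplus>d\<in>{d. hcomp d x \<noteq> \<zero>}. hcomp d x) = (\<Oplus>d\<in>D. hcomp d x)"
    using assms by (intro add.finprod_mono_neutral_cong) (auto simp: hcomp_closed intro: finite_subset[OF _ assms(2)])
  then show ?thesis using sum_hcomp[OF assms(1)] by simp
qed

lemma hcomp_uniqueI:
  assumes "finite D" "\<And>d. c d \<in> G d" "\<And>d. d \<notin> D \<Longrightarrow> c d = \<zero>"
  shows "hcomp d (\<Oplus>d\<in>D. c d) = c d"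
proof (rule hcomp_unique)
  have "(\<Oplus>d\<in>{d. c d \<noteq> \<zero>}. c d) = (\<Oplus>d\<in>D. c d)"
    using assms by (intro add.finprod_mono_neutral_cong) (auto intro: finite_subset[OF _ assms(1)] G_carrier)
  then show "is_decomp (\<Oplus>d\<in>D. c d) c"
    using assms unfolding is_decomp_def by (auto intro: finite_subset[OF _ assms(1)])
qed (use G_carrier[OF assms(2)] in auto)

lemma hcomp_hom: "x \<in> G d \<Longrightarrow> hcomp e x = (if e = d then x else \<zero>)"
proof -
  assume x: "x \<in> G d"
  have "hcomp e (\<Oplus>a\<in>{d}. if a = d then x else \<zero>) = (if e = d then x else \<zero>)"
    using x by (intro hcomp_uniqueI) (auto simp: zero_G)
  then show ?thesis using G_carrier[OF x] by (simp del: if_image_distrib)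
qed

lemma hcomp_zero: "hcomp d \<zero> = \<zero>"
  using hcomp_hom[OF zero_G[of 0], of d] by simp

lemma hcomp_add:
  assumes "x \<in> carrier R" "y \<in> carrier R"
  shows "hcomp d (x \<oplus> y) = hcomp d x \<oplus> hcomp d y"
proof -
  define D where "D = {d. hcomp d x \<noteq> \<zero>} \<union> {d. hcomp d y \<noteq> \<zero>}"
  have D: "finite D" using finite_hcomp assms by (auto simp: D_def)
  have x: "x = (\<Oplus>d\<in>D. hcomp d x)" and y: "y = (\<Oplus>d\<in>D. hcomp d y)"
    by (rule sum_hcomp_superset; use assms D in \<open>auto simp: D_def\<close>)+
  have "(\<Oplus>d\<in>D. hcomp d x \<oplus> hcomp d y) = (\<Oplus>d\<in>D. hcomp d x) \<oplus> (\<Oplus>d\<in>D. hcomp d y)"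
    using assms by (intro finsum_addf) (auto simp: hcomp_closed)
  then have "x \<oplus> y = (\<Oplus>d\<in>D. hcomp d x \<oplus> hcomp d y)"
    using x y by simp
  moreover have "hcomp d (\<Oplus>d\<in>D. hcomp d x \<oplus> hcomp d y) = hcomp d x \<oplus> hcomp d y"
    using D assms by (intro hcomp_uniqueI) (auto simp: G_add hcomp_G D_def)
  ultimately show ?thesis by simp
qed

lemma hcomp_neg:
  assumes "x \<in> carrier R"
  shows "hcomp d (\<ominus> x) = \<ominus> hcomp d x"
proof -
  have "hcomp d (\<ominus> x) \<oplus> hcomp d x = hcomp d (\<ominus> x \<oplus> x)"
    using assms by (simp add: hcomp_add)
  also have "\<dots> = \<zero>" using assms by (simp add: l_neg hcomp_zero)
  finally show ?thesis
    using assms minus_equality hcomp_closed by (metis a_inv_closed)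
qed

lemma hcomp_finsum:
  "finite A \<Longrightarrow> f \<in> A \<rightarrow> carrier R \<Longrightarrow> hcomp d (\<Oplus>a\<in>A. f a) = (\<Oplus>a\<in>A. hcomp d (f a))"
  by (induction A rule: finite_induct) (auto simp: hcomp_zero hcomp_add hcomp_closed Pi_iff)

lemma eq_zero_if_hcomp: "x \<in> carrier R \<Longrightarrow> (\<And>d. hcomp d x = \<zero>) \<Longrightarrow> x = \<zero>"
  using sum_hcomp[of x] by simp

lemma graded_induct [consumes 1, case_names homogeneous add]:
  assumes "x \<in> carrier R" and "\<And>d x. x \<in> G d \<Longrightarrow> P x"
    and "\<And>x y. x \<in> carrier R \<Longrightarrow> y \<in> carrier R \<Longrightarrow> P x \<Longrightarrow> P y \<Longrightarrow> P (x \<oplus> y)"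
  shows "P x"
proof -
  have "P (\<Oplus>d\<in>D. hcomp d x)" if "finite D" for D
    using that
  proof (induction D rule: finite_induct)
    case empty
    then show ?case using assms(2)[OF zero_G] by simp
  next
    case (insert d D)
    then show ?case using assms(1) by (auto intro!: assms(3) assms(2)[OF hcomp_G] simp: hcomp_closed)
  qed
  then show ?thesis using sum_hcomp[OF assms(1)] finite_hcomp[OF assms(1)] by metis
qed

lemma hcomp_mult:
  assumes "x \<in> carrier R" "y \<in> carrier R"
  shows "hcomp d (x \<otimes> y) = (\<Oplus>j\<in>{..d}. hcomp j x \<otimes> hcomp (d - j) y)"
  using assms
proof (induction x arbitrary: y rule: graded_induct)
  case (homogeneous a x)
  note x = G_carrier[OF homogeneous(1)]
  from homogeneous(2) show ?case
  proof (induction y rule: graded_induct)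
    case (homogeneous b y)
    note y = G_carrier[OF this]
    have "(\<Oplus>j\<in>{..d}. hcomp j x \<otimes> hcomp (d - j) y) = (\<Oplus>j\<in>{..d}. if a = j then (if d = a + b then x \<otimes> y else \<zero>) else \<zero>)"
      using x y by (intro finsum_cong' refl) (auto simp: hcomp_hom[OF \<open>x \<in> G a\<close>] hcomp_hom[OF homogeneous])
    also have "\<dots> = (if d = a + b then x \<otimes> y else \<zero>)"
      using x y finsum_singleton[of a "{..d}" "\<lambda>_. if d = a + b then x \<otimes> y else \<zero>"]
      by (cases "a \<le> d") (auto intro!: add.finprod_one_eqI)
    finally show ?case by (simp add: hcomp_hom[OF G_mult[OF \<open>x \<in> G a\<close> homogeneous]])
  next
    case (add y z)
    then show ?case using x
      by (simp add: r_distr hcomp_add hcomp_closed finsum_addf Pi_iff)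
  qed
next
  case (add x z)
  then show ?case
    by (simp add: l_distr hcomp_add hcomp_closed finsum_addf Pi_iff)
qed

text \<open>
  The filtration by degree. The bound is strict, so that \<open>deg_less 0\<close> is zero and inductions
  on the degree of a possibly inhomogeneous element can start there.
\<close>
definition deg_less :: "nat \<Rightarrow> 'a set" where
  "deg_less n = {x \<in> carrier R. \<forall>d\<ge>n. hcomp d x = \<zero>}"

lemma deg_less_carrier: "x \<in> deg_less n \<Longrightarrow> x \<in> carrier R"
  by (simp add: deg_less_def)

lemma deg_less_0: "x \<in> deg_less 0 \<Longrightarrow> x = \<zero>"
  by (auto simp: deg_less_def intro: eq_zero_if_hcomp)

lemma zero_deg_less: "\<zero> \<in> deg_less n"
  by (simp add: deg_less_def hcomp_zero)

lemma deg_less_add: "x \<in> deg_less n \<Longrightarrow> y \<in> deg_less n \<Longrightarrow> x \<oplus> y \<in> deg_less n"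
  by (simp add: deg_less_def hcomp_add)

lemma deg_less_neg: "x \<in> deg_less n \<Longrightarrow> \<ominus> x \<in> deg_less n"
  by (simp add: deg_less_def hcomp_neg)

lemma deg_less_mono: "x \<in> deg_less n \<Longrightarrow> n \<le> k \<Longrightarrow> x \<in> deg_less k"
  by (auto simp: deg_less_def)

lemma deg_less_finsum: "finite A \<Longrightarrow> f \<in> A \<rightarrow> deg_less n \<Longrightarrow> (\<Oplus>a\<in>A. f a) \<in> deg_less n"
proof (induction A rule: finite_induct)
  case (insert a A)
  then have "(\<Oplus>a\<in>insert a A. f a) = f a \<oplus> (\<Oplus>a\<in>A. f a)"
    by (intro finsum_insert) (auto simp: Pi_iff deg_less_carrier)
  then show ?case using insert by (simp add: deg_less_add Pi_iff)
qed (simp add: zero_deg_less)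

lemma deg_less_add_pow: "x \<in> deg_less n \<Longrightarrow> add_pow R (k::nat) x \<in> deg_less n"
  by (induction k) (auto simp: zero_deg_less deg_less_add)

lemma deg_less_hom: "x \<in> G d \<Longrightarrow> d < n \<Longrightarrow> x \<in> deg_less n"
  by (auto simp: deg_less_def G_carrier hcomp_hom)

lemma deg_less_mult:
  assumes "x \<in> deg_less (Suc a)" "y \<in> deg_less (Suc b)"
  shows "x \<otimes> y \<in> deg_less (Suc (a + b))"
proof -
  have "hcomp d (x \<otimes> y) = \<zero>" if "d \<ge> Suc (a + b)" for d
  proof -
    have "hcomp j x \<otimes> hcomp (d - j) y = \<zero>" if "j \<le> d" for j
    proof (cases "j \<ge> Suc a")
      case True
      then show ?thesis using assms by (auto simp: deg_less_def hcomp_closed)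
    next
      case False
      then have "d - j \<ge> Suc b" using \<open>d \<ge> Suc (a + b)\<close> by linarith
      then show ?thesis using assms by (auto simp: deg_less_def hcomp_closed)
    qed
    then show ?thesis
      using assms by (subst hcomp_mult) (auto simp: deg_less_carrier intro!: add.finprod_one_eqI)
  qed
  then show ?thesis using assms by (auto simp: deg_less_def)
qed

lemma deg_less_pow: "x \<in> deg_less (Suc a) \<Longrightarrow> x [^] (k::nat) \<in> deg_less (Suc (k * a))"
proof (induction k)
  case 0
  then show ?case using deg_less_hom[OF one_G] by simp
next
  case (Suc k)
  then show ?case using deg_less_mult[of "x [^] k" "k * a" x a] by (simp add: add.commute)
qed

lemma ex_deg_less: "x \<in> carrier R \<Longrightarrow> \<exists>n. x \<in> deg_less n"
proof -
  assume x: "x \<in> carrier R"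
  obtain n where "\<forall>d\<in>{d. hcomp d x \<noteq> \<zero>}. d < n"
    using finite_hcomp[OF x] finite_nat_set_iff_bounded by blast
  then have "x \<in> deg_less n" using x by (auto simp: deg_less_def not_less)
  then show ?thesis ..
qed

lemma deg_less_sum: "x \<in> deg_less n \<Longrightarrow> x = (\<Oplus>d\<in>{..<n}. hcomp d x)"
  by (rule sum_hcomp_superset) (auto simp: deg_less_def not_less[symmetric])

lemma deg_less_reduce:
  assumes "x \<in> deg_less (Suc n)" shows "x \<ominus> hcomp n x \<in> deg_less n"
proof -
  have x: "x \<in> carrier R" using assms by (rule deg_less_carrier)
  have "hcomp d (x \<ominus> hcomp n x) = \<zero>" if "d \<ge> n" for d
  proof (cases "d = n")
    case True
    then show ?thesis using x by (simp add: hcomp_add hcomp_neg hcomp_closed hcomp_hom[OF hcomp_G[OF x]] r_neg a_minus_def)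
  next
    case False
    then have "hcomp d x = \<zero>" using that assms by (auto simp: deg_less_def)
    then show ?thesis using x False by (simp add: hcomp_add hcomp_neg hcomp_closed hcomp_hom[OF hcomp_G[OF x]] a_minus_def)
  qed
  then show ?thesis using x by (simp add: deg_less_def hcomp_closed)
qed

end

text \<open>
  A way to establish a grading from projections onto the pieces: additive projections that are
  the identity on their own piece and zero on the others determine the components of any
  decomposition, which gives uniqueness.
\<close>
lemma graded_ringI:
  fixes R (structure)
  assumes "cring R" and sub: "\<And>d. additive_subgroup (G d) R" and one: "\<one> \<in> G 0"
    and mult: "\<And>d e x y. x \<in> G d \<Longrightarrow> y \<in> G e \<Longrightarrow> x \<otimes> y \<in> G (d + e)"
    and add: "\<And>d x y. x \<in> carrier R \<Longrightarrow> y \<in> carrier R \<Longrightarrow> f d (x \<oplus> y) = f d x \<oplus> f d y"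
    and G: "\<And>d x. x \<in> carrier R \<Longrightarrow> f d x \<in> G d"
    and id: "\<And>d e x. x \<in> G d \<Longrightarrow> f e x = (if e = d then x else \<zero>)"
    and sum: "\<And>x. x \<in> carrier R \<Longrightarrow> \<exists>n. (\<forall>d\<ge>n. f d x = \<zero>) \<and> x = (\<Oplus>d\<in>{..<n}. f d x)"
  shows "graded_ring R G"
proof -
  interpret cring R by fact
  have GR: "x \<in> carrier R" if "x \<in> G d" for x d
    using additive_subgroup.a_subset[OF sub] that by blast
  have zero: "\<zero> \<in> G d" for d
    by (rule additive_subgroup.zero_closed[OF sub])
  have f0: "f d \<zero> = \<zero>" for d
    using id[OF zero[of d], of d] by simp
  have f_sum: "f d (\<Oplus>a\<in>A. g a) = (\<Oplus>a\<in>A. f d (g a))" if "finite A" "g \<in> A \<rightarrow> carrier R" for d A and g :: "nat \<Rightarrow> 'a"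
    using that by (induction A rule: finite_induct) (auto simp: f0 add GR[OF G] Pi_iff)
  have "\<exists>!c. (\<forall>d. c d \<in> G d) \<and> finite {d. c d \<noteq> \<zero>} \<and> x = (\<Oplus>d\<in>{d. c d \<noteq> \<zero>}. c d)"
    if x: "x \<in> carrier R" for x
  proof (rule ex1I[of _ "\<lambda>d. f d x"])
    obtain n where n: "\<forall>d\<ge>n. f d x = \<zero>" "x = (\<Oplus>d\<in>{..<n}. f d x)"
      using sum[OF x] by blast
    have fin: "{d. f d x \<noteq> \<zero>} \<subseteq> {..<n}" using n(1) by (auto simp: not_less[symmetric])
    have "(\<Oplus>d\<in>{..<n}. f d x) = (\<Oplus>d\<in>{d. f d x \<noteq> \<zero>}. f d x)"
      using fin x by (intro add.finprod_mono_neutral_cong) (auto intro: finite_subset simp: GR[OF G])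
    then show "(\<forall>d. f d x \<in> G d) \<and> finite {d. f d x \<noteq> \<zero>} \<and> x = (\<Oplus>d\<in>{d. f d x \<noteq> \<zero>}. f d x)"
      using G[OF x] n(2) finite_subset[OF fin] by auto
  next
    fix c assume c: "(\<forall>d. c d \<in> G d) \<and> finite {d. c d \<noteq> \<zero>} \<and> x = (\<Oplus>d\<in>{d. c d \<noteq> \<zero>}. c d)"
    let ?D = "{d. c d \<noteq> \<zero>}"
    show "c = (\<lambda>d. f d x)"
    proof
      fix e
      have cG: "c d \<in> G d" and cR: "c d \<in> carrier R" and fc: "f e (c d) = (if e = d then c d else \<zero>)" for d
        using c GR[of "c d" d] id[of "c d" d e] by simp_all
      have "f e x = (\<Oplus>d\<in>?D. f e (c d))"
        using c f_sum[of ?D c e] GR by auto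
      also have "\<dots> = (\<Oplus>d\<in>?D. if e = d then c e else \<zero>)"
        using c GR by (intro finsum_cong' refl) (auto simp: fc cR)
      also have "\<dots> = c e"
        using c cR finsum_singleton[of e ?D "\<lambda>_. c e"]
        by (cases "e \<in> ?D") (auto intro!: add.finprod_one_eqI)
      finally show "c e = f e x" by simp
    qed
  qed
  then show ?thesis
    unfolding graded_ring_def using \<open>cring R\<close> sub one mult by blast
qed

section \<open>Relations satisfied by the powers of one element\<close>

lemma (in ring) subring_finsum_closed:
  assumes "subring A R" "finite I" "f \<in> I \<rightarrow> A"
  shows "(\<Oplus>i\<in>I. f i) \<in> A"
  using assms(2,3)
proof (induction I)
  case empty
  then show ?case using subringE(2)[OF assms(1)] by simp
next
  case (insert i I)
  then have "(\<Oplus>i\<in>insert i I. f i) = f i \<oplus> (\<Oplus>i\<in>I. f i)"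
    using subringE(1)[OF assms(1)] by (intro finsum_insert) auto
  then show ?case using insert subringE(7)[OF assms(1)] by auto
qed

lemma (in ring) subring_pow_closed:
  assumes "subring A R" "x \<in> A" shows "x [^] (n::nat) \<in> A"
  using assms(2) by (induction n) (auto simp: subringE[OF assms(1)])

lemma (in ring) subring_minus_closed:
  assumes "subring A R" "x \<in> A" "y \<in> A" shows "x \<ominus> y \<in> A"
  using assms by (simp add: minus_eq subringE(5,7)[OF assms(1)])

lemma (in ring) subring_add_pow_closed:
  assumes "subring A R" "x \<in> A" shows "add_pow R (n::nat) x \<in> A"
  using assms(2) by (induction n) (auto simp: subringE[OF assms(1)])

lemma (in abelian_monoid) finsum_group:
  assumes "finite S" "finite T" "\<And>s. s \<in> S \<Longrightarrow> h s \<in> T" "f \<in> S \<rightarrow> carrier G"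
  shows "(\<Oplus>s\<in>S. f s) = (\<Oplus>t\<in>T. \<Oplus>s\<in>{s \<in> S. h s = t}. f s)"
proof -
  have "(\<Oplus>t\<in>T. \<Oplus>s\<in>{s \<in> S. h s = t}. f s) = (\<Oplus>t\<in>T. \<Oplus>s\<in>S. if h s = t then f s else \<zero>)"
    using assms by (intro finsum_cong' refl add.finprod_mono_neutral_cong_left) (auto simp: Pi_iff)
  also have "\<dots> = (\<Oplus>s\<in>S. \<Oplus>t\<in>T. if h s = t then f s else \<zero>)"
    using assms by (intro finsum_swap) auto
  also have "\<dots> = (\<Oplus>s\<in>S. f s)"
    using assms by (intro finsum_cong' refl finsum_singleton) (auto simp: Pi_iff)
  finally show ?thesis ..
qed

lemma (in graded) hcomp_mult_hom:
  assumes "x \<in> carrier R" "y \<in> G a"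
  shows "hcomp n (x \<otimes> y) = (if a \<le> n then hcomp (n - a) x \<otimes> y else \<zero>)"
proof -
  have y: "y \<in> carrier R" using assms(2) by (rule G_carrier)
  have "hcomp n (x \<otimes> y) = hcomp n (y \<otimes> x)"
    using assms y by (simp add: m_comm)
  also have "\<dots> = (\<Oplus>j\<in>{..n}. hcomp j y \<otimes> hcomp (n - j) x)"
    using assms y by (intro hcomp_mult)
  also have "\<dots> = (\<Oplus>j\<in>{..n}. if a = j then y \<otimes> hcomp (n - a) x else \<zero>)"
    using assms y by (intro finsum_cong' refl) (auto simp: hcomp_hom[OF assms(2)] hcomp_closed)
  also have "\<dots> = (if a \<le> n then y \<otimes> hcomp (n - a) x else \<zero>)"
    using assms y finsum_singleton[of a "{..n}" "\<lambda>_. y \<otimes> hcomp (n - a) x"]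
    by (cases "a \<le> n") (auto intro!: add.finprod_one_eqI simp: hcomp_closed)
  finally show ?thesis using assms y by (simp add: m_comm hcomp_closed)
qed

text \<open>
  The maps in \<open>\<Gamma>\<close> are ring endomorphisms that change a homogeneous element only by terms of
  lower degree. The model is the substitution \<open>x \<mapsto> x + 1\<close> for one variable of a polynomial
  ring: with the Hasse derivatives \<open>D\<^sub>n\<close> it sends \<open>f\<close> to \<open>\<Sum>n. D\<^sub>n f\<close>, so being fixed by
  it means, for homogeneous \<open>f\<close>, that all \<open>D\<^sub>n f\<close> with \<open>n > 0\<close> vanish. Hence \<open>detect\<close> says
  that there are enough Hasse derivatives; this is the right substitute for ordinary derivatives
  in characteristic \<open>p\<close>. The number \<open>p\<close> is the characteristic, and \<open>0\<close> in characteristic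
  zero.
\<close>
locale unipotent_graded = graded +
  fixes \<Gamma> :: "('a \<Rightarrow> 'a) set" and p :: nat
  assumes K: "subfield (G 0) R"
    and hom: "\<tau> \<in> \<Gamma> \<Longrightarrow> \<tau> \<in> ring_hom R R"
    and lower: "\<tau> \<in> \<Gamma> \<Longrightarrow> x \<in> G d \<Longrightarrow> \<tau> x \<ominus> x \<in> deg_less d"
    and detect: "x \<in> G d \<Longrightarrow> 0 < d \<Longrightarrow> (\<And>\<tau>. \<tau> \<in> \<Gamma> \<Longrightarrow> \<tau> x = x) \<Longrightarrow> x = \<zero>"
    and char: "p = 0 \<and> (\<forall>n::nat>0. add_pow R n \<one> \<noteq> \<zero>) \<or>
        Factorial_Ring.prime p \<and> add_pow R p \<one> = \<zero>"
begin

lemmas K_subring = subfieldE(1)[OF K]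
lemmas K_closed = subringE[OF K_subring]
lemmas K_inv = subfield_m_inv[OF K]

lemma hom_cring: "\<tau> \<in> \<Gamma> \<Longrightarrow> ring_hom_cring R R \<tau>"
  by (simp add: hom is_cring ring_hom_cring_axioms_def ring_hom_cring_def)

lemma hom_closed: "\<tau> \<in> \<Gamma> \<Longrightarrow> x \<in> carrier R \<Longrightarrow> \<tau> x \<in> carrier R"
  by (rule ring_hom_closed[OF hom])

lemma hom_pow: "\<tau> \<in> \<Gamma> \<Longrightarrow> x \<in> carrier R \<Longrightarrow> \<tau> (x [^] (n::nat)) = \<tau> x [^] n"
  by (rule ring_hom_cring.hom_pow[OF hom_cring])

lemma hom_finsum:
  "\<tau> \<in> \<Gamma> \<Longrightarrow> f \<in> A \<rightarrow> carrier R \<Longrightarrow> \<tau> (\<Oplus>a\<in>A. f a) = (\<Oplus>a\<in>A. \<tau> (f a))"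
  using ring_hom_cring.hom_finsum[OF hom_cring, of \<tau> f A] by (simp add: o_def)

lemma hom_K: "\<tau> \<in> \<Gamma> \<Longrightarrow> x \<in> G 0 \<Longrightarrow> \<tau> x = x"
  using deg_less_0[OF lower[of \<tau> x 0]] G_carrier[of x 0] hom_closed[of \<tau> x] by simp

lemma hom_split:
  assumes "\<tau> \<in> \<Gamma>" "x \<in> carrier R"
  shows "\<tau> x = (\<tau> x \<ominus> x) \<oplus> x"
  using assms hom_closed[OF assms] by (simp add: minus_eq a_assoc l_neg)

lemma hom_deg_less: "\<tau> \<in> \<Gamma> \<Longrightarrow> x \<in> G d \<Longrightarrow> \<tau> x \<in> deg_less (Suc d)"
  using hom_split[of \<tau> x] G_carrier[of x d] deg_less_add[OF deg_less_mono[OF lower[of \<tau> x d], of "Suc d"] deg_less_hom[of x d "Suc d"]]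
  by simp

text \<open>
  For a prime \<open>p\<close>, by Bezout: if \<open>p\<close> and \<open>j\<close> both vanished in \<open>K\<close>, then so would \<open>1\<close>.
\<close>
lemma unit_of_nat:
  assumes "0 < j" "p = 0 \<or> j < p"
  shows "add_pow R j \<one> \<in> G 0 - {\<zero>}"
proof -
  have "add_pow R j \<one> \<noteq> \<zero>"
  proof (cases "p = 0")
    case True
    then show ?thesis using char assms(1) by auto
  next
    case False
    with char have p: "Factorial_Ring.prime p" "add_pow R p \<one> = \<zero>" by auto
    show ?thesis
    proof
      assume j: "add_pow R j \<one> = \<zero>"
      have "coprime p j"
        using p(1) assms False by (metis prime_imp_coprime nat_dvd_not_less)
      then have "coprime j p" by (simp add: coprime_commute)
      then obtain x y where xy: "j * x = p * y + 1"
        using bezout_nat[of j p] assms(1) by auto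
      have "add_pow R (j * x) \<one> = \<zero>" "add_pow R (p * y) \<one> = \<zero>"
        using j p(2) by (simp_all add: add_pow_eq_zero)
      then have "\<one> = \<zero>" using xy by simp
      then show False using subfieldE(6)[OF K] by simp
    qed
  qed
  then show ?thesis using subring_add_pow_closed[OF K_subring K_closed(3)] by simp
qed

text \<open>
  The heart of the argument, in the inductive form in which it is used below. Suppose that
  \<open>\<Sum>j\<le>D. h j * e ^ j = 0\<close> is homogeneous of degree \<open>n\<close>, with coefficients in a subring \<open>A\<close>
  that does not contain \<open>e\<close>, and put \<open>u = \<tau> e - e\<close>, an element of \<open>A\<close>. Applying \<open>\<tau>\<close> and
  expanding the powers of \<open>e + u\<close> gives a second relation with coefficients in \<open>A\<close>. It has the
  same leading terms, so the difference of the two has smaller degree and is trivial by the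
  induction hypothesis \<open>IH\<close>: the coefficients of both relations agree. For the coefficient of
  \<open>e ^ D\<close> this says that \<open>h D\<close> is fixed by every \<open>\<tau>\<close>, so that it is a constant. For the
  coefficient of \<open>e ^ (D - 1)\<close> it says that \<open>h (D - 1) + D * h D * e\<close> is fixed, and this element
  has positive degree, so that it is zero. As \<open>D\<close> is invertible, \<open>e\<close> lies in \<open>A\<close> unless
  \<open>h D = 0\<close>.
\<close>
lemma top_coefficient_zero:
  assumes A: "subring A R" "\<And>\<tau> x. \<tau> \<in> \<Gamma> \<Longrightarrow> x \<in> A \<Longrightarrow> \<tau> x \<in> A" "G 0 \<subseteq> A"
    and e: "e \<in> G m" "0 < m" "e \<notin> A" "\<And>\<tau>. \<tau> \<in> \<Gamma> \<Longrightarrow> \<tau> e \<ominus> e \<in> A"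
    and D: "p = 0 \<or> D < p"
    and h: "\<And>j. j \<le> D \<Longrightarrow> h j \<in> A" "\<And>j. j \<le> D \<Longrightarrow> h j \<in> G (n - j * m)" "\<And>j. j \<le> D \<Longrightarrow> n < j * m \<Longrightarrow> h j = \<zero>"
    and sum: "(\<Oplus>j\<in>{..D}. h j \<otimes> e [^] j) = \<zero>"
    and IH: "\<And>c. (\<And>j. j \<le> D \<Longrightarrow> c j \<in> A) \<Longrightarrow> (\<And>j. j \<le> D \<Longrightarrow> c j \<in> deg_less (n - j * m)) \<Longrightarrow>
        (\<Oplus>j\<in>{..D}. c j \<otimes> e [^] j) = \<zero> \<Longrightarrow> (\<And>j. j \<le> D \<Longrightarrow> c j = \<zero>)"
  shows "h D = \<zero>"
proof (rule ccontr)
  assume hD0: "h D \<noteq> \<zero>"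
  have eR: "e \<in> carrier R" using e(1) by (rule G_carrier)
  have hR: "h j \<in> carrier R" if "j \<le> D" for j using h(2) that by (auto intro: G_carrier)
  \<comment> \<open>The left-hand side is the coefficient of \<open>e ^ l\<close> after \<open>\<tau>\<close> has been applied and expanded.\<close>
  have key: "\<tau> (h l) \<oplus> (\<Oplus>j\<in>{l<..D}. add_pow R (j choose l) (\<tau> (h j) \<otimes> (\<tau> e \<ominus> e) [^] (j - l))) = h l"
    if \<tau>: "\<tau> \<in> \<Gamma>" and l: "l \<le> D" for \<tau> l
  proof -
    define u where "u = \<tau> e \<ominus> e"
    have uA: "u \<in> A" using e(4)[OF \<tau>] by (simp add: u_def)
    have uF: "u \<in> deg_less m" using lower[OF \<tau> e(1)] by (simp add: u_def)
    have uR: "u \<in> carrier R" using uF by (rule deg_less_carrier)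
    have \<tau>e: "\<tau> e = u \<oplus> e" using hom_split[OF \<tau> eR] by (simp add: u_def)
    define t where "t j = \<tau> (h j)" for j
    have tR: "t j \<in> carrier R" if "j \<le> D" for j using hom_closed[OF \<tau> hR[OF that]] by (simp add: t_def)
    have tA: "t j \<in> A" if "j \<le> D" for j using A(2)[OF \<tau> h(1)[OF that]] by (simp add: t_def)
    \<comment> \<open>Terms with \<open>j < l\<close> vanish with the binomial coefficient; summing over a rectangle allows the exchange of sums.\<close>
    define b where "b l = (\<Oplus>j\<in>{..D}. add_pow R (j choose l) (t j \<otimes> u [^] (j - l)))" for l
    have bR: "b l \<in> carrier R" for l using tR uR by (auto simp: b_def)
    have b_split: "b l = t l \<oplus> (\<Oplus>j\<in>{l<..D}. add_pow R (j choose l) (t j \<otimes> u [^] (j - l)))"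
      if l: "l \<le> D" for l
    proof -
      have "b l = (\<Oplus>j\<in>insert l {l<..D}. add_pow R (j choose l) (t j \<otimes> u [^] (j - l)))"
        unfolding b_def using tR uR l
        by (intro add.finprod_mono_neutral_cong_right) (auto simp: binomial_eq_0)
      then show ?thesis using tR uR l by (subst (asm) finsum_insert) auto
    qed
    have "\<zero> = \<tau> (\<Oplus>j\<in>{..D}. h j \<otimes> e [^] j)"
      using sum ring_hom_cring.hom_zero[OF hom_cring[OF \<tau>]] by simp
    also have "\<dots> = (\<Oplus>j\<in>{..D}. t j \<otimes> \<tau> e [^] j)"
      using hR eR \<tau> by (simp add: hom_finsum Pi_iff t_def)
        (intro finsum_cong' refl; auto simp: ring_hom_mult[OF hom] hom_pow hom_closed)
    also have "\<dots> = (\<Oplus>j\<in>{..D}. \<Oplus>l\<in>{..D}. add_pow R (j choose l) (t j \<otimes> u [^] (j - l)) \<otimes> e [^] l)"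
    proof (intro finsum_cong' refl)
      fix j assume j: "j \<in> {..D}"
      have "\<tau> e [^] j = (\<Oplus>l\<in>{..j}. add_pow R (j choose l) (u [^] (j - l) \<otimes> e [^] l))"
        unfolding \<tau>e using uR eR by (rule binomial_ring)
      also have "\<dots> = (\<Oplus>l\<in>{..D}. add_pow R (j choose l) (u [^] (j - l) \<otimes> e [^] l))"
        using j uR eR by (intro add.finprod_mono_neutral_cong_left) (auto simp: binomial_eq_0)
      finally have "t j \<otimes> \<tau> e [^] j = (\<Oplus>l\<in>{..D}. t j \<otimes> add_pow R (j choose l) (u [^] (j - l) \<otimes> e [^] l))"
        using j uR eR tR by (simp add: finsum_rdistr Pi_iff)
      also have "\<dots> = (\<Oplus>l\<in>{..D}. add_pow R (j choose l) (t j \<otimes> u [^] (j - l)) \<otimes> e [^] l)"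
      proof (intro finsum_cong' refl)
        fix l
        have tj: "t j \<in> carrier R" using tR j by simp
        have "t j \<otimes> add_pow R (j choose l) (u [^] (j - l) \<otimes> e [^] l) =
            add_pow R (j choose l) (t j \<otimes> (u [^] (j - l) \<otimes> e [^] l))"
          using tj uR eR by (intro add_pow_rdistr) auto
        also have "\<dots> = add_pow R (j choose l) ((t j \<otimes> u [^] (j - l)) \<otimes> e [^] l)"
          using tj uR eR by (simp add: m_assoc)
        also have "\<dots> = add_pow R (j choose l) (t j \<otimes> u [^] (j - l)) \<otimes> e [^] l"
          using tj uR eR by (intro add_pow_ldistr[symmetric]) auto
        finally show "t j \<otimes> add_pow R (j choose l) (u [^] (j - l) \<otimes> e [^] l) =
            add_pow R (j choose l) (t j \<otimes> u [^] (j - l)) \<otimes> e [^] l" .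
      qed (use tR j uR eR in auto)
      finally show "t j \<otimes> \<tau> e [^] j =
          (\<Oplus>l\<in>{..D}. add_pow R (j choose l) (t j \<otimes> u [^] (j - l)) \<otimes> e [^] l)" .
    qed (use tR uR eR in auto)
    also have "\<dots> = (\<Oplus>l\<in>{..D}. \<Oplus>j\<in>{..D}. add_pow R (j choose l) (t j \<otimes> u [^] (j - l)) \<otimes> e [^] l)"
      using tR uR eR by (intro finsum_swap) auto
    also have "\<dots> = (\<Oplus>l\<in>{..D}. b l \<otimes> e [^] l)"
      unfolding b_def using tR uR eR by (intro finsum_cong' refl finsum_ldistr[symmetric]) auto
    finally have b_sum: "(\<Oplus>l\<in>{..D}. b l \<otimes> e [^] l) = \<zero>" ..
    have "(\<Oplus>l\<in>{..D}. (b l \<ominus> h l) \<otimes> e [^] l) \<oplus> (\<Oplus>l\<in>{..D}. h l \<otimes> e [^] l) =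
        (\<Oplus>l\<in>{..D}. (b l \<ominus> h l) \<otimes> e [^] l \<oplus> h l \<otimes> e [^] l)"
      using bR hR eR by (intro finsum_addf[symmetric]) auto
    also have "\<dots> = (\<Oplus>l\<in>{..D}. b l \<otimes> e [^] l)"
    proof (intro finsum_cong' refl)
      fix l assume "l \<in> {..D}"
      then show "(b l \<ominus> h l) \<otimes> e [^] l \<oplus> h l \<otimes> e [^] l = b l \<otimes> e [^] l"
        using bR[of l] hR[of l] eR by (simp add: l_distr[symmetric] minus_eq a_assoc l_neg)
    qed (use bR eR in auto)
    finally have diff_sum: "(\<Oplus>l\<in>{..D}. (b l \<ominus> h l) \<otimes> e [^] l) = \<zero>"
      using sum b_sum bR hR eR by (simp add: Pi_iff)
    have "b l \<ominus> h l = \<zero>"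
    proof (rule IH[OF _ _ diff_sum l])
      fix l assume l: "l \<le> D"
      show "b l \<ominus> h l \<in> A"
        unfolding b_def using tA uA h(1)[OF l]
        by (intro subring_minus_closed[OF A(1)] subring_finsum_closed[OF A(1)] Pi_I
            subring_add_pow_closed[OF A(1)] subringE(6)[OF A(1)] subring_pow_closed[OF A(1)]) auto
      \<comment> \<open>One factor \<open>e\<close> of degree \<open>m\<close> is replaced by \<open>u\<close> of degree below \<open>m\<close>, and that at least once as \<open>j > l\<close>.\<close>
      have tF: "add_pow R (j choose l) (t j \<otimes> u [^] (j - l)) \<in> deg_less (n - l * m)" if "j \<in> {l<..D}" for j
      proof (cases "n < j * m")
        case True
        then have "h j = \<zero>" using h(3) that by auto
        then have "t j = \<zero>" using ring_hom_cring.hom_zero[OF hom_cring[OF \<tau>]] by (simp add: t_def)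
        then show ?thesis using uR by (simp add: zero_deg_less)
      next
        case False
        have "t j \<in> deg_less (Suc (n - j * m))" using hom_deg_less[OF \<tau> h(2)] that by (auto simp: t_def)
        moreover have "u [^] (j - l) \<in> deg_less (Suc ((j - l) * (m - 1)))"
          using uF e(2) by (intro deg_less_pow) auto
        ultimately have "t j \<otimes> u [^] (j - l) \<in> deg_less (Suc (n - j * m + (j - l) * (m - 1)))"
          by (rule deg_less_mult)
        moreover have "Suc (n - j * m + (j - l) * (m - 1)) \<le> n - l * m"
        proof -
          have "(j - l) * (m - 1) + (j - l) = (j - l) * m"
            using e(2) by (cases m) (simp_all add: add.commute)
          moreover have "(j - l) * m = j * m - l * m" by (simp add: diff_mult_distrib)
          moreover have "j - l > 0" using that by auto
          moreover have "l * m \<le> j * m" using that by auto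
          ultimately show ?thesis using False by linarith
        qed
        ultimately show ?thesis by (intro deg_less_add_pow) (rule deg_less_mono)
      qed
      have "b l \<ominus> h l = (t l \<ominus> h l) \<oplus> (\<Oplus>j\<in>{l<..D}. add_pow R (j choose l) (t j \<otimes> u [^] (j - l)))"
      proof -
        have "(\<Oplus>j\<in>{l<..D}. add_pow R (j choose l) (t j \<otimes> u [^] (j - l))) \<in> carrier R"
          using tR uR by auto
        then show ?thesis using l tR[of l] hR[of l] by (simp add: b_split minus_eq a_ac)
      qed
      moreover have "t l \<ominus> h l \<in> deg_less (n - l * m)"
        using lower[OF \<tau> h(2)[OF l]] by (simp add: t_def)
      ultimately show "b l \<ominus> h l \<in> deg_less (n - l * m)"
        using tF by (auto intro!: deg_less_add deg_less_finsum)
    qed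
    then have "b l = h l"
      using bR[of l] hR[OF l] by simp
    then show ?thesis using b_split[OF l] by (simp add: t_def u_def)
  qed
  have fix_top: "\<tau> (h D) = h D" if "\<tau> \<in> \<Gamma>" for \<tau>
    using key[OF that order_refl] hom_closed[OF that hR[OF order_refl]] by simp
  \<comment> \<open>A fixed homogeneous element is zero unless its degree is \<open>0\<close>.\<close>
  have n: "n = D * m"
  proof (rule ccontr)
    assume "n \<noteq> D * m"
    then have "n < D * m \<or> 0 < n - D * m" by linarith
    then show False using h(3)[of D] detect[of "h D" "n - D * m"] h(2)[of D] fix_top hD0 by auto
  qed
  have hDK: "h D \<in> G 0" using h(2)[of D] n by simp
  show False
  proof (cases D)
    case 0
    then show False using sum hD0 hR[of 0] by simp
  next
    case (Suc d)
    define k where "k = add_pow R D \<one> \<otimes> h D"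
    have DU: "add_pow R D \<one> \<in> G 0 - {\<zero>}" using unit_of_nat[of D] D Suc by auto
    have kK: "k \<in> G 0 - {\<zero>}"
      using DU hDK hD0 subfieldE(5)[OF K, of "add_pow R D \<one>" "h D"] K_closed(6) by (auto simp: k_def)
    have kR: "k \<in> carrier R" using kK by (auto intro: G_carrier)
    have k_mult: "add_pow R D (h D \<otimes> x) = k \<otimes> x" if "x \<in> carrier R" for x
    proof -
      have "k \<otimes> x = add_pow R D \<one> \<otimes> (h D \<otimes> x)"
        using that hR[of D] by (simp add: k_def m_assoc)
      also have "\<dots> = add_pow R D (\<one> \<otimes> (h D \<otimes> x))"
        using that hR[of D] by (intro add_pow_ldistr) auto
      finally show ?thesis using that hR[of D] by simp
    qed
    \<comment> \<open>The element \<open>h (D - 1) + D * h D * e\<close>, with \<open>D = Suc d\<close>.\<close>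
    define w where "w = h d \<oplus> k \<otimes> e"
    have "n - d * m = m" using n Suc by simp
    then have hd: "h d \<in> G m" "h d \<in> carrier R" "h d \<in> A" using h(1,2)[of d] hR[of d] Suc by auto
    have wG: "w \<in> G m"
      using G_mult[of k 0 e m] kK e(1) hd by (auto simp: w_def intro: G_add)
    have "w = \<zero>"
    proof (rule detect[OF wG e(2)])
      fix \<tau> assume \<tau>: "\<tau> \<in> \<Gamma>"
      have uR: "\<tau> e \<ominus> e \<in> carrier R" using hom_closed[OF \<tau> eR] eR by simp
      have td: "\<tau> (h d) \<in> carrier R" using hom_closed[OF \<tau> hd(2)] .
      have "{d<..D} = {D}" "D choose d = D" "D - d = 1" using Suc by auto
      moreover have "(\<Oplus>j\<in>{D}. add_pow R (j choose d) (\<tau> (h j) \<otimes> (\<tau> e \<ominus> e) [^] (j - d))) =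
          add_pow R (D choose d) (\<tau> (h D) \<otimes> (\<tau> e \<ominus> e) [^] (D - d))"
        using finsum_insert[of "{}" D "\<lambda>j. add_pow R (j choose d) (\<tau> (h j) \<otimes> (\<tau> e \<ominus> e) [^] (j - d))"]
          hR[of D] fix_top[OF \<tau>] uR by simp
      moreover have "d \<le> D" using Suc by simp
      ultimately have eq: "\<tau> (h d) \<oplus> k \<otimes> (\<tau> e \<ominus> e) = h d"
        using key[OF \<tau>, of d] uR fix_top[OF \<tau>] k_mult[OF uR] by simp
      have "\<tau> w = \<tau> (h d) \<oplus> \<tau> k \<otimes> \<tau> e"
        using \<tau> hd kR eR by (simp add: w_def ring_hom_add[OF hom] ring_hom_mult[OF hom])
      also have "\<tau> k = k" using hom_K[OF \<tau>] kK by auto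
      also have "k \<otimes> \<tau> e = k \<otimes> (\<tau> e \<ominus> e) \<oplus> k \<otimes> e"
        using hom_split[OF \<tau> eR] uR eR kR by (metis r_distr)
      also have "\<tau> (h d) \<oplus> (k \<otimes> (\<tau> e \<ominus> e) \<oplus> k \<otimes> e) = w"
        using eq uR eR kR td by (simp add: w_def a_assoc[symmetric])
      finally show "\<tau> w = w" .
    qed
    then have "k \<otimes> e = \<ominus> h d"
      using hd kR eR by (metis m_closed minus_equality a_comm w_def)
    then have "inv k \<otimes> (k \<otimes> e) = inv k \<otimes> (\<ominus> h d)" by simp
    moreover have ik: "inv k \<in> carrier R" "inv k \<otimes> k = \<one>" "inv k \<in> A"
      using K_inv[OF kK] A(3) by (auto intro: G_carrier)
    ultimately have "e = inv k \<otimes> (\<ominus> h d)"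
      using kR eR by (simp add: m_assoc[symmetric])
    then show False
      using e(3) ik(3) hd(3) subringE(5,6)[OF A(1)] by auto
  qed
qed

end

section \<open>A system of generators\<close>

text \<open>
  Homogeneous elements are ordered by degree and, within one degree, by an arbitrary
  well-ordering. The generators are then chosen greedily along this order.
\<close>
definition some_wo :: "('a \<times> 'a) set" where
  "some_wo = (SOME W. well_order_on UNIV W)"

definition lt_wo :: "'a \<Rightarrow> 'a \<Rightarrow> bool" where
  "lt_wo x y \<longleftrightarrow> (x, y) \<in> some_wo - Id"

lemma some_wo: "well_order_on (UNIV :: 'a set) some_wo"
  unfolding some_wo_def by (rule someI_ex) (rule well_order_on)

lemma wf_lt_wo: "wf {(x, y). lt_wo x (y :: 'a)}"
proof -
  have "{(x, y). lt_wo x (y :: 'a)} = some_wo - Id"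
    by (auto simp: lt_wo_def)
  moreover have "wf ((some_wo :: ('a \<times> 'a) set) - Id)"
    using some_wo[where 'a='a] unfolding well_order_on_def by (rule conjunct2)
  ultimately show ?thesis by (simp only:)
qed

lemma lt_wo_linear:
  fixes x y :: 'a
  assumes "x \<noteq> y"
  shows "lt_wo x y \<or> lt_wo y x"
proof -
  have "total_on (UNIV :: 'a set) some_wo"
    using some_wo[where 'a='a] unfolding well_order_on_def linear_order_on_def by (elim conjE)
  then show ?thesis using assms unfolding total_on_def lt_wo_def by blast
qed

lemma lt_wo_trans:
  fixes x y z :: 'a
  assumes "lt_wo x y" "lt_wo y z"
  shows "lt_wo x z"
proof -
  have *: "trans (some_wo :: ('a \<times> 'a) set) \<and> antisym (some_wo :: ('a \<times> 'a) set)"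
    using some_wo[where 'a='a]
    unfolding well_order_on_def linear_order_on_def partial_order_on_def preorder_on_def
    by (elim conjE) (intro conjI; assumption)
  have "(x, z) \<in> some_wo"
    using assms by (auto simp: lt_wo_def intro: transD[OF conjunct1[OF *]])
  moreover have "x \<noteq> z"
    using assms antisymD[OF conjunct2[OF *], of x y] by (auto simp: lt_wo_def)
  ultimately show ?thesis by (simp add: lt_wo_def)
qed

lemma (in graded) generate_ring_hcomp:
  assumes "H \<subseteq> carrier R" "\<And>h d. h \<in> H \<Longrightarrow> hcomp d h \<in> generate_ring R H"
    and "x \<in> generate_ring R H"
  shows "hcomp d x \<in> generate_ring R H"
proof -
  note sub = generate_ring_is_subring[OF assms(1)]
  show ?thesis
    using assms(3)
  proof (induction arbitrary: d)
    case one
    show ?case by (simp add: hcomp_hom[OF one_G] generate_ring.one subringE(2)[OF sub])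
  next
    case (incl h)
    then show ?case by (rule assms(2))
  next
    case (a_inv h)
    then show ?case
      using generate_ring_in_carrier[OF assms(1)] by (simp add: hcomp_neg generate_ring.a_inv)
  next
    case (eng_add x y)
    then show ?case
      using generate_ring_in_carrier[OF assms(1)] by (simp add: hcomp_add generate_ring.eng_add)
  next
    case (eng_mult x y)
    then show ?case
      using generate_ring_in_carrier[OF assms(1)]
      by (auto simp: hcomp_mult intro!: subring_finsum_closed[OF sub] generate_ring.eng_mult)
  qed
qed

context unipotent_graded
begin

text \<open>
  Induction on a bound for the degree of the relation. Its homogeneous part of top degree is
  again a relation, as \<open>A\<close> is closed under taking components; the coefficients of that part vanish
  one after the other from the top, by \<open>top_coefficient_zero\<close>.
\<close>
lemma powers_independent:
  assumes A: "subring A R" "\<And>x d. x \<in> A \<Longrightarrow> hcomp d x \<in> A"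
      "\<And>\<tau> x. \<tau> \<in> \<Gamma> \<Longrightarrow> x \<in> A \<Longrightarrow> \<tau> x \<in> A" "G 0 \<subseteq> A"
    and e: "e \<in> G m" "0 < m" "e \<notin> A" "\<And>\<tau>. \<tau> \<in> \<Gamma> \<Longrightarrow> \<tau> e \<ominus> e \<in> A"
    and D: "p = 0 \<or> D < p"
    and c: "\<And>j. j \<le> D \<Longrightarrow> c j \<in> A" and sum: "(\<Oplus>j\<in>{..D}. c j \<otimes> e [^] j) = \<zero>"
    and j: "j \<le> D"
  shows "c j = \<zero>"
proof -
  have eR: "e \<in> carrier R" using e(1) by (rule G_carrier)
  have AR: "x \<in> carrier R" if "x \<in> A" for x using subringE(1)[OF A(1)] that by blast
  have graded_case: "c j = \<zero>"
    if "p = 0 \<or> D < p" "\<And>j. j \<le> D \<Longrightarrow> c j \<in> A" "\<And>j. j \<le> D \<Longrightarrow> c j \<in> deg_less (n - j * m)"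
      "(\<Oplus>j\<in>{..D}. c j \<otimes> e [^] j) = \<zero>" "j \<le> D" for n D c j
    using that
  proof (induction n arbitrary: D c j)
    case 0
    then show ?case using deg_less_0[of "c j"] by simp
  next
    case (Suc n)
    note IH_n = Suc.IH
    have hom_case: "h j = \<zero>"
      if "p = 0 \<or> D < p" "\<And>j. j \<le> D \<Longrightarrow> h j \<in> A" "\<And>j. j \<le> D \<Longrightarrow> h j \<in> G (n - j * m)"
        "\<And>j. j \<le> D \<Longrightarrow> n < j * m \<Longrightarrow> h j = \<zero>" "(\<Oplus>j\<in>{..D}. h j \<otimes> e [^] j) = \<zero>" "j \<le> D" for D h j
      using that
    proof (induction D arbitrary: j)
      case 0
      then show ?case using AR[of "h 0"] by simp
    next
      case (Suc D)
      have top: "h (Suc D) = \<zero>"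
      proof (rule top_coefficient_zero[of A e m "Suc D" h n])
        show "c j = \<zero>"
          if "\<And>j. j \<le> Suc D \<Longrightarrow> c j \<in> A" "\<And>j. j \<le> Suc D \<Longrightarrow> c j \<in> deg_less (n - j * m)"
            "(\<Oplus>j\<in>{..Suc D}. c j \<otimes> e [^] j) = \<zero>" "j \<le> Suc D" for c j
          using Suc.prems(1) that by (rule IH_n)
      qed (fact A(1) A(3) A(4) e Suc.prems(1-5))+
      have "(\<Oplus>j\<in>{..D}. h j \<otimes> e [^] j) \<in> carrier R"
        using AR[OF Suc.prems(2)] eR by auto
      then have "(\<Oplus>j\<in>{..D}. h j \<otimes> e [^] j) = \<zero>"
        using Suc.prems(5) AR[OF Suc.prems(2)] eR top by (simp add: finsum_Suc Pi_iff)
      then have lower: "h j = \<zero>" if "j \<le> D" for j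
        using Suc.IH[of j] Suc.prems(1-4) that by auto
      show ?case using top lower Suc.prems(6) by (cases "j = Suc D") auto
    qed
    \<comment> \<open>The part of degree \<open>n\<close>; the case distinction keeps truncated subtraction from producing terms of degree above \<open>n\<close>.\<close>
    define h where "h j = (if j * m \<le> n then hcomp (n - j * m) (c j) else \<zero>)" for j
    have cR: "c j \<in> carrier R" if "j \<le> D" for j using AR[OF Suc.prems(2)[OF that]] .
    have "(\<Oplus>j\<in>{..D}. h j \<otimes> e [^] j) = (\<Oplus>j\<in>{..D}. hcomp n (c j \<otimes> e [^] j))"
      using cR eR by (intro finsum_cong' refl) (auto simp: h_def hcomp_mult_hom[OF _ G_pow[OF e(1)]] hcomp_closed)
    also have "\<dots> = hcomp n (\<Oplus>j\<in>{..D}. c j \<otimes> e [^] j)"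
      using cR eR by (intro hcomp_finsum[symmetric]) auto
    also have "\<dots> = \<zero>" using Suc.prems(4) by (simp add: hcomp_zero)
    finally have h_sum: "(\<Oplus>j\<in>{..D}. h j \<otimes> e [^] j) = \<zero>" .
    have h0: "h j = \<zero>" if "j \<le> D" for j
    proof (rule hom_case[OF Suc.prems(1) _ _ _ h_sum that])
      show "h j \<in> A" if "j \<le> D" for j
        using A(2)[OF Suc.prems(2)[OF that]] subringE(2)[OF A(1)] by (simp add: h_def)
      show "h j \<in> G (n - j * m)" if "j \<le> D" for j
        using hcomp_G[OF cR[OF that]] by (simp add: h_def zero_G)
      show "h j = \<zero>" if "n < j * m" for j
        using that by (simp add: h_def)
    qed
    have cF: "c j \<in> deg_less (n - j * m)" if j: "j \<le> D" for j
    proof (cases "j * m \<le> n")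
      case True
      then have "c j \<in> deg_less (Suc (n - j * m))" using Suc.prems(3)[OF j] by (simp add: Suc_diff_le)
      moreover have "hcomp (n - j * m) (c j) = \<zero>" using h0[OF j] True by (simp add: h_def)
      ultimately show ?thesis using deg_less_reduce[of "c j" "n - j * m"] cR[OF j] by (simp add: minus_eq)
    next
      case False
      then have "Suc n - j * m = n - j * m" by simp
      then show ?thesis using Suc.prems(3)[OF j] by simp
    qed
    show ?case
      by (rule IH_n[OF Suc.prems(1,2) cF Suc.prems(4,5)])
  qed
  have "\<exists>f. \<forall>j\<in>{..D}. c j \<in> deg_less (f j)"
    using ex_deg_less[OF AR[OF c]] by (intro bchoice) auto
  then obtain f where f: "\<And>j. j \<le> D \<Longrightarrow> c j \<in> deg_less (f j)" by auto
  define N where "N = Max (f ` {..D}) + D * m"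
  have "c j \<in> deg_less (N - j * m)" if "j \<le> D" for j
  proof (rule deg_less_mono[OF f[OF that]])
    have "f j \<le> Max (f ` {..D})" using that by (intro Max_ge) auto
    moreover have "j * m \<le> D * m" using that by simp
    ultimately show "f j \<le> N - j * m" unfolding N_def by linarith
  qed
  then show ?thesis using graded_case[OF D c _ sum j, of N] by blast
qed

text \<open>
  The \<open>p\<close>-th powers; there are none in characteristic zero, where \<open>p = 0\<close>. They are among the
  elements that precede every generator: linear independence is available only for powers with
  exponents below \<open>p\<close>, so \<open>e ^ p\<close> has to count as a coefficient.
\<close>
definition frob :: "'a set" where
  "frob = {x [^] p |x. x \<in> carrier R \<and> 0 < p}"

text \<open>
  What precedes a homogeneous element \<open>e\<close> of degree \<open>m\<close>. An element becomes a generator exactly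
  if the ring generated by what precedes it does not contain it, which makes
  \<open>powers_independent\<close> applicable to every generator, with this ring for \<open>A\<close>.
\<close>
definition lower_ring_gens :: "nat \<Rightarrow> 'a \<Rightarrow> 'a set" where
  "lower_ring_gens m e = (\<Union>d<m. G d) \<union> frob \<union> {y \<in> G m. lt_wo y e}"

definition lower_ring :: "nat \<Rightarrow> 'a \<Rightarrow> 'a set" where
  "lower_ring m e = generate_ring R (lower_ring_gens m e)"

definition gens :: "'a set" where
  "gens = {e. \<exists>m>0. e \<in> G m \<and> e \<notin> lower_ring m e}"

lemma frobE:
  assumes "x \<in> frob"
  obtains y where "y \<in> carrier R" "x = y [^] p" "Factorial_Ring.prime p" "add_pow R p \<one> = \<zero>"
  using assms char unfolding frob_def by auto

lemma lower_ring_gens_carrier: "lower_ring_gens m e \<subseteq> carrier R"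
  by (auto simp: lower_ring_gens_def frob_def intro: G_carrier)

lemma lower_ring_subring: "subring (lower_ring m e) R"
  unfolding lower_ring_def by (rule generate_ring_is_subring[OF lower_ring_gens_carrier])

lemma lower_ring_incl: "x \<in> lower_ring_gens m e \<Longrightarrow> x \<in> lower_ring m e"
  unfolding lower_ring_def by (rule generate_ring.incl)

lemma G_lower_ring: "x \<in> G d \<Longrightarrow> d < m \<Longrightarrow> x \<in> lower_ring m e"
  by (rule lower_ring_incl) (auto simp: lower_ring_gens_def)

lemma deg_less_lower_ring:
  assumes "x \<in> deg_less m" shows "x \<in> lower_ring m e"
proof -
  have "hcomp d x \<in> lower_ring m e" if "d < m" for d
    using hcomp_G[OF deg_less_carrier[OF assms]] that by (rule G_lower_ring)
  then have "(\<Oplus>d\<in>{..<m}. hcomp d x) \<in> lower_ring m e"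
    by (intro subring_finsum_closed[OF lower_ring_subring]) auto
  then show ?thesis using deg_less_sum[OF assms] by simp
qed

lemma K_lower_ring: "0 < m \<Longrightarrow> G 0 \<subseteq> lower_ring m e"
  by (auto intro: G_lower_ring)

text \<open>
  By additivity of the Frobenius map, \<open>y ^ p\<close> is the sum of the \<open>p\<close>-th powers of the components
  of \<open>y\<close>, and these are homogeneous.
\<close>
lemma hcomp_frob:
  assumes p: "Factorial_Ring.prime p" "add_pow R p \<one> = \<zero>" and y: "y \<in> carrier R"
  shows "hcomp d (y [^] p) = (if p dvd d then hcomp (d div p) y [^] p else \<zero>)"
proof -
  let ?J = "{j. hcomp j y \<noteq> \<zero>}"
  have p0: "p > 0" using p(1) prime_gt_0_nat by blast
  have fin: "finite ?J" using finite_hcomp[OF y] .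
  have cR: "hcomp j y [^] p \<in> carrier R" for j using hcomp_closed[OF y] by simp
  have "y [^] p = (\<Oplus>j\<in>?J. hcomp j y) [^] p" using sum_hcomp[OF y] by simp
  also have "\<dots> = (\<Oplus>j\<in>?J. hcomp j y [^] p)"
    using hcomp_closed[OF y] by (intro frobenius_finsum[OF p fin]) auto
  finally have "hcomp d (y [^] p) = hcomp d (\<Oplus>j\<in>?J. hcomp j y [^] p)" by simp
  also have "\<dots> = (\<Oplus>j\<in>?J. hcomp d (hcomp j y [^] p))"
    using cR by (intro hcomp_finsum fin) auto
  also have "\<dots> = (\<Oplus>j\<in>?J. if d = p * j then hcomp j y [^] p else \<zero>)"
    using cR by (intro finsum_cong' refl) (auto simp: hcomp_hom[OF G_pow[OF hcomp_G[OF y]]])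
  also have "\<dots> = (if p dvd d then hcomp (d div p) y [^] p else \<zero>)"
  proof (cases "p dvd d \<and> d div p \<in> ?J")
    case True
    then have "(\<Oplus>j\<in>?J. if d = p * j then hcomp j y [^] p else \<zero>) = (\<Oplus>j\<in>?J. if d div p = j then hcomp j y [^] p else \<zero>)"
      using cR p0 by (intro finsum_cong' refl) auto
    also have "\<dots> = hcomp (d div p) y [^] p"
      using True cR fin by (intro finsum_singleton) auto
    finally show ?thesis using True by simp
  next
    case False
    then have "(\<Oplus>j\<in>?J. if d = p * j then hcomp j y [^] p else \<zero>) = \<zero>"
      using p0 by (intro add.finprod_one_eqI) auto
    moreover have "(if p dvd d then hcomp (d div p) y [^] p else \<zero>) = \<zero>"
      using False p0 by (auto simp: nat_pow_zero)
    ultimately show ?thesis by simp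
  qed
  finally show ?thesis .
qed

lemma lower_ring_hcomp:
  assumes "x \<in> lower_ring m e" shows "hcomp d x \<in> lower_ring m e"
  using assms unfolding lower_ring_def
proof (rule generate_ring_hcomp[OF lower_ring_gens_carrier, rotated])
  fix h d assume "h \<in> lower_ring_gens m e"
  then consider j where "h \<in> G j" | "h \<in> frob"
    by (auto simp: lower_ring_gens_def)
  then show "hcomp d h \<in> generate_ring R (lower_ring_gens m e)"
  proof cases
    case (1 j)
    then show ?thesis
      using \<open>h \<in> lower_ring_gens m e\<close> subringE(2)[OF lower_ring_subring[unfolded lower_ring_def]]
      by (simp add: hcomp_hom generate_ring.incl)
  next
    case 2
    then obtain y where y: "y \<in> carrier R" "h = y [^] p" "Factorial_Ring.prime p" "add_pow R p \<one> = \<zero>"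
      by (rule frobE)
    have "hcomp (d div p) y [^] p \<in> frob"
      using hcomp_closed[OF y(1)] y(3) prime_gt_0_nat unfolding frob_def by blast
    then have "hcomp (d div p) y [^] p \<in> generate_ring R (lower_ring_gens m e)"
      by (intro generate_ring.incl) (simp add: lower_ring_gens_def)
    then show ?thesis
      using y subringE(2)[OF lower_ring_subring[unfolded lower_ring_def]] by (simp add: hcomp_frob)
  qed
qed

text \<open>
  All elements of degree below \<open>m\<close> belong to the ring, hence all corrections \<open>\<tau> h - h\<close> for
  homogeneous \<open>h\<close> of degree at most \<open>m\<close>; and \<open>\<tau>\<close> maps \<open>p\<close>-th powers to \<open>p\<close>-th powers.
\<close>
lemma lower_ring_hom:
  assumes \<tau>: "\<tau> \<in> \<Gamma>" and x: "x \<in> lower_ring m e" shows "\<tau> x \<in> lower_ring m e"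
proof -
  have carr: "y \<in> carrier R" if "y \<in> lower_ring m e" for y
    using subringE(1)[OF lower_ring_subring] that by blast
  note clo = subringE[OF lower_ring_subring[of m e]]
  from x[unfolded lower_ring_def] show ?thesis
  proof (induction)
    case one
    then show ?case using ring_hom_one[OF hom[OF \<tau>]] clo by simp
  next
    case (incl h)
    have hR: "h \<in> carrier R" using incl lower_ring_gens_carrier by blast
    consider d where "d \<le> m" "h \<in> G d" | "h \<in> frob"
      using incl by (auto simp: lower_ring_gens_def intro: less_imp_le)
    then show ?case
    proof cases
      case (1 d)
      have "\<tau> h \<ominus> h \<in> lower_ring m e"
        using deg_less_mono[OF lower[OF \<tau> 1(2)] 1(1)] by (rule deg_less_lower_ring)
      then show ?thesis
        using hom_split[OF \<tau> hR] lower_ring_incl[OF incl] clo(7) by metis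
    next
      case 2
      then obtain y where y: "y \<in> carrier R" "h = y [^] p" "Factorial_Ring.prime p"
        by (rule frobE)
      then have "\<tau> h = \<tau> y [^] p" "\<tau> y \<in> carrier R"
        using hom_pow[OF \<tau>] hom_closed[OF \<tau>] by auto
      then have "\<tau> h \<in> frob" using y(3) prime_gt_0_nat unfolding frob_def by blast
      then show ?thesis by (intro lower_ring_incl) (simp add: lower_ring_gens_def)
    qed
  next
    case (a_inv h)
    then show ?case
      using clo carr ring_hom_cring.hom_a_inv[OF hom_cring[OF \<tau>]] by (simp add: lower_ring_def[symmetric])
  next
    case (eng_add x y)
    then show ?case
      using clo carr ring_hom_add[OF hom[OF \<tau>]] by (simp add: lower_ring_def[symmetric])
  next
    case (eng_mult x y)
    then show ?case
      using clo carr ring_hom_mult[OF hom[OF \<tau>]] by (simp add: lower_ring_def[symmetric])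
  qed
qed

lemma gen_powers_independent:
  assumes "e \<in> G m" "0 < m" "e \<notin> lower_ring m e" "p = 0 \<or> D < p"
    and "\<And>j. j \<le> D \<Longrightarrow> c j \<in> lower_ring m e" "(\<Oplus>j\<in>{..D}. c j \<otimes> e [^] j) = \<zero>" "j \<le> D"
  shows "c j = \<zero>"
proof (rule powers_independent[of "lower_ring m e" e m D c])
  show "\<tau> e \<ominus> e \<in> lower_ring m e" if "\<tau> \<in> \<Gamma>" for \<tau>
    using lower[OF that assms(1)] by (rule deg_less_lower_ring)
qed (fact lower_ring_subring lower_ring_hcomp lower_ring_hom K_lower_ring[OF assms(2)] assms)+

text \<open>
  Well-founded induction along the order: an element that is not a generator is a polynomial in
  elements that precede it. The \<open>p\<close>-th powers are of arbitrary degree and would spoil the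
  induction, but only components of degree at most \<open>m\<close> matter for an element of degree \<open>m\<close>, and
  \<open>p\<close>-th powers of such degree are powers of elements of lower degree.
\<close>
lemma gens_generate: "generate_ring R (G 0 \<union> gens) = carrier R"
proof
  have sub: "G 0 \<union> gens \<subseteq> carrier R" by (auto simp: gens_def intro: G_carrier)
  let ?P = "generate_ring R (G 0 \<union> gens)"
  show "?P \<subseteq> carrier R" by (rule generate_ring_incl[OF sub])
  note P = generate_ring_is_subring[OF sub]
  have hom_case: "y \<in> ?P" if "y \<in> G m" for y m
    using that
  proof (induction m arbitrary: y rule: less_induct)
    case (less m)
    note IH_deg = less.IH
    show ?case
    proof (cases "m = 0")
      case True
      then show ?thesis using less.prems by (auto intro: generate_ring.incl)
    next
      case False
      show ?thesis
        using wf_lt_wo less.prems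
      proof (induction y rule: wf_induct_rule)
        case (less y)
        note IH_lt = less.IH
        show ?case
        proof (cases "y \<in> lower_ring m y")
          case False
          then have "y \<in> gens" using less.prems \<open>m \<noteq> 0\<close> by (auto simp: gens_def)
          then show ?thesis by (auto intro: generate_ring.incl)
        next
          case True
          \<comment> \<open>Truncation at degree \<open>m\<close>: products of elements of \<open>L\<close> stay in \<open>L\<close>, since no component of degree above \<open>m\<close> enters.\<close>
          define L where "L = {z \<in> carrier R. \<forall>d\<le>m. hcomp d z \<in> ?P}"
          have "subring L R"
          proof (rule subringI)
            show "\<one> \<in> L"
              by (simp add: L_def hcomp_hom[OF one_G] subringE(2,3)[OF P])
            show "x \<otimes> z \<in> L" if "x \<in> L" "z \<in> L" for x z
              using that unfolding L_def
              by (auto simp: hcomp_mult intro!: subring_finsum_closed[OF P] subringE(6)[OF P])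
          qed (auto simp: L_def hcomp_neg hcomp_add subringE[OF P])
          moreover have "lower_ring_gens m y \<subseteq> L"
          proof
            fix h assume h: "h \<in> lower_ring_gens m y"
            then have hR: "h \<in> carrier R" using lower_ring_gens_carrier by blast
            consider d where "d < m" "h \<in> G d" | "h \<in> G m" "lt_wo h y" | "h \<in> frob"
              using h by (auto simp: lower_ring_gens_def)
            then show "h \<in> L"
            proof cases
              case (1 d)
              then show ?thesis using IH_deg[OF 1] hR by (simp add: L_def hcomp_hom subringE(2)[OF P])
            next
              case 2
              then have "h \<in> ?P" using IH_lt[of h] by simp
              then show ?thesis using hR by (simp add: L_def hcomp_hom[OF 2(1)] subringE(2)[OF P])
            next
              case 3
              then obtain x where x: "x \<in> carrier R" "h = x [^] p" "Factorial_Ring.prime p" "add_pow R p \<one> = \<zero>"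
                by (rule frobE)
              have "hcomp (d div p) x \<in> ?P" if "d \<le> m" for d
              proof -
                have "p \<ge> 2" using x(3) by (rule prime_ge_2_nat)
                then have "d div p < m"
                  using that False \<open>m \<noteq> 0\<close> by (cases "d = 0") (auto intro: less_le_trans[OF div_less_dividend])
                then show ?thesis using IH_deg hcomp_G[OF x(1)] by blast
              qed
              then show ?thesis
                using x hR by (simp add: L_def hcomp_frob subring_pow_closed[OF P] subringE(2)[OF P])
            qed
          qed
          ultimately have "lower_ring m y \<subseteq> L"
            unfolding lower_ring_def by (rule generate_ring_min_subring1[OF lower_ring_gens_carrier])
          then have "hcomp m y \<in> ?P" using True by (auto simp: L_def)
          then show ?thesis using less.prems by (simp add: hcomp_hom)
        qed
      qed
    qed
  qed
  show "carrier R \<subseteq> ?P"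
  proof
    fix x assume "x \<in> carrier R"
    then show "x \<in> ?P"
      by (induction rule: graded_induct) (auto intro: hom_case generate_ring.eng_add)
  qed
qed

end

section \<open>Monomials with small exponents\<close>

text \<open>
  With divisor \<open>p\<close>, these two functions write a monomial as a \<open>p\<close>-th power times a monomial
  with exponents below \<open>p\<close>.
\<close>
definition mset_div :: "'b multiset \<Rightarrow> nat \<Rightarrow> 'b multiset" where
  "mset_div M n = Abs_multiset (\<lambda>x. count M x div n)"

definition mset_mod :: "'b multiset \<Rightarrow> nat \<Rightarrow> 'b multiset" where
  "mset_mod M n = Abs_multiset (\<lambda>x. count M x mod n)"

lemma count_mset_div: "count (mset_div M n) x = count M x div n"
proof -
  have "finite {x. 0 < count M x div n}"
    by (rule finite_subset[of _ "set_mset M"]) (auto simp: not_in_iff intro: ccontr)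
  then show ?thesis by (simp add: mset_div_def)
qed

lemma count_mset_mod: "count (mset_mod M n) x = count M x mod n"
proof -
  have "finite {x. 0 < count M x mod n}"
    by (rule finite_subset[of _ "set_mset M"]) (auto simp: not_in_iff intro: ccontr)
  then show ?thesis by (simp add: mset_mod_def)
qed

lemma mset_mod_div: "M = mset_mod M n + repeat_mset n (mset_div M n)"
  by (rule multiset_eqI) (simp add: count_mset_div count_mset_mod)

lemma set_mset_mod: "set_mset (mset_mod M n) \<subseteq> set_mset M"
  by (auto simp: count_greater_zero_iff[symmetric] count_mset_mod simp del: count_greater_zero_iff intro: ccontr)

lemma set_mset_div: "set_mset (mset_div M n) \<subseteq> set_mset M"
  by (auto simp: count_greater_zero_iff[symmetric] count_mset_div simp del: count_greater_zero_iff intro: ccontr)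

lemma size_mset_div:
  assumes "2 \<le> n" "size M \<le> Suc N" shows "size (mset_div M n) \<le> N"
proof -
  have "size M = size (mset_mod M n) + n * size (mset_div M n)"
    by (subst mset_mod_div[of M n]) simp
  moreover have "2 * size (mset_div M n) \<le> n * size (mset_div M n)"
    using assms(1) by simp
  ultimately show ?thesis using assms(2) by linarith
qed

context cring
begin

definition mon :: "'a multiset \<Rightarrow> 'a" where
  "mon M = (\<Otimes>x\<in>set_mset M. x [^] count M x)"

lemma mon_superset:
  assumes "finite V" "set_mset M \<subseteq> V" "V \<subseteq> carrier R"
  shows "mon M = (\<Otimes>x\<in>V. x [^] count M x)"
  unfolding mon_def using assms
  by (intro finprod_mono_neutral_cong_left) (auto simp: not_in_iff)

lemma mon_closed: "set_mset M \<subseteq> carrier R \<Longrightarrow> mon M \<in> carrier R"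
  unfolding mon_def by (intro finprod_closed) auto

lemma mon_empty: "mon {#} = \<one>"
  by (simp add: mon_def)

lemma mon_add:
  assumes "set_mset M \<subseteq> carrier R" "set_mset N \<subseteq> carrier R"
  shows "mon (M + N) = mon M \<otimes> mon N"
proof -
  let ?V = "set_mset M \<union> set_mset N"
  have "mon (M + N) = (\<Otimes>x\<in>?V. x [^] count M x \<otimes> x [^] count N x)"
    using assms by (subst mon_superset[of ?V]) (auto intro!: finprod_cong' simp: nat_pow_mult)
  also have "\<dots> = (\<Otimes>x\<in>?V. x [^] count M x) \<otimes> (\<Otimes>x\<in>?V. x [^] count N x)"
    using assms by (intro finprod_multf) auto
  also have "\<dots> = mon M \<otimes> mon N"
    using assms by (simp add: mon_superset[of ?V])
  finally show ?thesis .
qed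

lemma mon_replicate: "x \<in> carrier R \<Longrightarrow> mon (replicate_mset n x) = x [^] n"
proof (induction n)
  case (Suc n)
  have "mon {#x#} = x"
    using Suc finprod_insert[of "{}" x "\<lambda>y. y [^] count {#x#} y"] by (simp add: mon_def)
  then show ?case
    using Suc mon_add[of "{#x#}" "replicate_mset n x"] by (auto simp: m_comm)
qed (simp add: mon_empty)

lemma mon_repeat: "set_mset M \<subseteq> carrier R \<Longrightarrow> mon (repeat_mset n M) = mon M [^] n"
proof (induction n)
  case (Suc n)
  have "set_mset (repeat_mset n M) \<subseteq> set_mset M" 
    by (auto simp: count_greater_zero_iff[symmetric] simp del: count_greater_zero_iff)
  then show ?case
    using Suc mon_add[of M "repeat_mset n M"] mon_closed[OF Suc.prems] by (auto simp: m_comm)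
qed (simp add: mon_empty)

lemma mon_subring:
  assumes A: "subring A R" and "set_mset M \<subseteq> A"
  shows "mon M \<in> A"
  using assms(2)
proof (induction M)
  case empty
  then show ?case using subringE(3)[OF A] by (simp add: mon_empty)
next
  case (add x M)
  then have "set_mset M \<subseteq> carrier R" "x \<in> carrier R" using subringE(1)[OF A] by auto
  then have "mon (add_mset x M) = x \<otimes> mon M"
    using mon_add[of "{#x#}" M] mon_replicate[of x 1] by simp
  then show ?case using add subringE(6)[OF A] by auto
qed

end

lemma ex_last:
  fixes dg :: "'b \<Rightarrow> nat"
  assumes "finite V" "V \<noteq> {}"
  shows "\<exists>e\<in>V. \<forall>y\<in>V - {e}. dg y < dg e \<or> dg y = dg e \<and> lt_wo y e"
  using assms
proof (induction V rule: finite_ne_induct)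
  case (insert y V)
  then obtain e where e: "e \<in> V" "\<And>z. z \<in> V - {e} \<Longrightarrow> dg z < dg e \<or> dg z = dg e \<and> lt_wo z e"
    by blast
  have "e \<noteq> y" using e insert by blast
  then consider "dg y < dg e \<or> dg y = dg e \<and> lt_wo y e" | "dg e < dg y \<or> dg e = dg y \<and> lt_wo e y"
    using lt_wo_linear[of e y] by linarith
  then show ?case
  proof cases
    case 1
    then have "\<forall>z\<in>insert y V - {e}. dg z < dg e \<or> dg z = dg e \<and> lt_wo z e" using e(2) by blast
    then show ?thesis using e(1) by blast
  next
    case 2
    have "dg z < dg y \<or> dg z = dg y \<and> lt_wo z y" if "z \<in> insert y V - {y}" for z
    proof (cases "z = e")
      case False
      then have "dg z < dg e \<or> dg z = dg e \<and> lt_wo z e" using e(2) that by blast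
      then show ?thesis using 2 lt_wo_trans[of z e y] by linarith
    qed (use 2 in simp)
    then show ?thesis by blast
  qed
qed simp

context unipotent_graded
begin

text \<open>
  Induction on the number of generators involved. The last of them in the order, \<open>e\<close>, has all
  others and the coefficients in the ring that precedes it. Collecting powers of \<open>e\<close> yields a
  relation to which \<open>powers_independent\<close> applies; its coefficients vanish and are relations
  between fewer generators. In characteristic zero this is already algebraic independence.
\<close>
lemma restricted_monomials_independent:
  assumes "finite V" "V \<subseteq> gens" "finite Ms"
    and "\<And>M. M \<in> Ms \<Longrightarrow> set_mset M \<subseteq> V"
    and "\<And>M x. M \<in> Ms \<Longrightarrow> 0 < p \<Longrightarrow> count M x < p"
    and "\<And>M. M \<in> Ms \<Longrightarrow> g M \<in> generate_ring R (G 0 \<union> frob)"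
    and "(\<Oplus>M\<in>Ms. g M \<otimes> mon M) = \<zero>" "M \<in> Ms"
  shows "g M = \<zero>"
  using assms
proof (induction "card V" arbitrary: V Ms g M)
  case 0
  then have V: "V = {}" by simp
  then have "Ms \<subseteq> {{#}}" using 0(5) by auto
  then have Ms: "Ms = {{#}}" "M = {#}" using 0(9) by auto
  have "G 0 \<union> frob \<subseteq> carrier R" by (auto simp: frob_def intro: G_carrier)
  then have "g {#} \<in> carrier R" using 0(7)[of "{#}"] Ms generate_ring_in_carrier by blast
  then show ?case using 0(8) Ms by (simp add: mon_empty finsum_insert)
next
  case (Suc n)
  have CR: "G 0 \<union> frob \<subseteq> carrier R" by (auto simp: frob_def intro: G_carrier)
  have gR: "g M \<in> carrier R" if "M \<in> Ms" for M
    using Suc(8)[OF that] generate_ring_in_carrier[OF CR] by blast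
  have VR: "V \<subseteq> carrier R" using Suc(4) by (auto simp: gens_def intro: G_carrier)
  have MR: "set_mset M \<subseteq> carrier R" if "M \<in> Ms" for M using Suc(6)[OF that] VR by blast
  have "\<forall>x\<in>V. \<exists>m>0. x \<in> G m \<and> x \<notin> lower_ring m x" using Suc(4) by (auto simp: gens_def)
  then obtain dg where dg: "\<And>x. x \<in> V \<Longrightarrow> 0 < dg x \<and> x \<in> G (dg x) \<and> x \<notin> lower_ring (dg x) x"
    by metis
  have "V \<noteq> {}" using Suc(2) by auto
  then obtain e where e: "e \<in> V"
    "\<And>y. y \<in> V - {e} \<Longrightarrow> dg y < dg e \<or> dg y = dg e \<and> lt_wo y e"
    using ex_last[OF Suc(3), of dg] by blast
  note e_props = dg[OF e(1)]
  have eR: "e \<in> carrier R" using VR e(1) by blast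
  let ?A = "lower_ring (dg e) e"
  note A = lower_ring_subring[of "dg e" e]
  have V_A: "y \<in> ?A" if "y \<in> V - {e}" for y
  proof -
    have y: "y \<in> G (dg y)" using dg that by blast
    show ?thesis
      using e(2)[OF that]
    proof
      assume "dg y < dg e"
      then show ?thesis by (rule G_lower_ring[OF y])
    next
      assume "dg y = dg e \<and> lt_wo y e"
      then show ?thesis using y by (intro lower_ring_incl) (simp add: lower_ring_gens_def)
    qed
  qed
  have "frob \<subseteq> ?A" by (auto intro!: lower_ring_incl simp: lower_ring_gens_def)
  then have C_A: "generate_ring R (G 0 \<union> frob) \<subseteq> ?A"
    using e_props K_lower_ring[of "dg e" e] by (intro generate_ring_min_subring1[OF CR A]) auto
  define drop where "drop M = M - replicate_mset (count M e) e" for M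
  have drop: "M = drop M + replicate_mset (count M e) e" for M
    by (rule multiset_eqI) (simp add: drop_def)
  have count_drop: "count (drop M) x = (if x = e then 0 else count M x)" for M x
    by (simp add: drop_def)
  have set_drop: "set_mset (drop M) = set_mset M - {e}" for M
    by (auto simp: count_greater_zero_iff[symmetric] count_drop simp del: count_greater_zero_iff split: if_splits)
  have mon_A: "mon (drop M) \<in> ?A" if "M \<in> Ms" for M
  proof -
    have "set_mset (drop M) \<subseteq> ?A" using Suc(6)[OF that] V_A by (auto simp: set_drop)
    then show ?thesis by (rule mon_subring[OF A])
  qed
  \<comment> \<open>A bound for the exponents of \<open>e\<close> that stays below \<open>p\<close> if \<open>p\<close> is positive.\<close>
  define D where "D = (if p = 0 then Max ((\<lambda>M. count M e) ` Ms) else p - 1)"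
  have D: "count M e \<le> D" if "M \<in> Ms" for M
  proof (cases "p = 0")
    case True
    then show ?thesis using that Suc(5) by (simp add: D_def)
  next
    case False
    then show ?thesis using Suc(7)[OF that, of e] by (simp add: D_def)
  qed
  define c where "c j = (\<Oplus>M\<in>{M \<in> Ms. count M e = j}. g M \<otimes> mon (drop M))" for j
  have drop_R: "mon (drop M) \<in> carrier R" if "M \<in> Ms" for M
    using mon_A[OF that] subringE(1)[OF A] by blast
  have "(\<Oplus>j\<in>{..D}. c j \<otimes> e [^] j) = (\<Oplus>j\<in>{..D}. \<Oplus>M\<in>{M \<in> Ms. count M e = j}. g M \<otimes> mon M)"
  proof (intro finsum_cong' refl)
    fix j
    have "c j \<otimes> e [^] j = (\<Oplus>M\<in>{M \<in> Ms. count M e = j}. g M \<otimes> mon (drop M) \<otimes> e [^] j)"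
      unfolding c_def using Suc(5) gR drop_R eR by (intro finsum_ldistr) auto
    also have "\<dots> = (\<Oplus>M\<in>{M \<in> Ms. count M e = j}. g M \<otimes> mon M)"
    proof (intro finsum_cong' refl)
      fix M assume M: "M \<in> {M \<in> Ms. count M e = j}"
      have "mon M = mon (drop M + replicate_mset (count M e) e)" using drop[of M] by simp
      also have "\<dots> = mon (drop M) \<otimes> e [^] j"
        using M MR[of M] eR by (subst mon_add) (auto simp: set_drop mon_replicate)
      finally show "g M \<otimes> mon (drop M) \<otimes> e [^] j = g M \<otimes> mon M"
        using M gR drop_R eR by (simp add: m_assoc)
    qed (use gR mon_closed[OF MR] in auto)
    finally show "c j \<otimes> e [^] j = (\<Oplus>M\<in>{M \<in> Ms. count M e = j}. g M \<otimes> mon M)" .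
  qed (use gR mon_closed[OF MR] in auto)
  also have "\<dots> = (\<Oplus>M\<in>Ms. g M \<otimes> mon M)"
    using Suc(5) D gR mon_closed[OF MR] by (intro finsum_group[symmetric]) auto
  finally have c_sum: "(\<Oplus>j\<in>{..D}. c j \<otimes> e [^] j) = \<zero>" using Suc(9) by simp
  have c0: "c j = \<zero>" if "j \<le> D" for j
  proof (rule gen_powers_independent[of e "dg e" D c])
    show "c j \<in> ?A" for j
      unfolding c_def using Suc(5,8) C_A mon_A
      by (intro subring_finsum_closed[OF A] Pi_I subringE(6)[OF A]) auto
    show "p = 0 \<or> D < p" by (auto simp: D_def)
  qed (use e_props c_sum that in auto)
  define j where "j = count M e"
  define Ns where "Ns = {M \<in> Ms. count M e = j}"
  have inj: "inj_on drop Ns"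
  proof (rule inj_onI)
    fix M N assume "M \<in> Ns" "N \<in> Ns" "drop M = drop N"
    then show "M = N" using drop[of M] drop[of N] by (simp add: Ns_def)
  qed
  have g_eq: "g (drop N + replicate_mset j e) = g N" if "N \<in> Ns" for N
    using that drop[of N] by (simp add: Ns_def)
  have "g (drop M + replicate_mset j e) = \<zero>"
  proof (rule Suc(1)[of "V - {e}" "drop ` Ns" "\<lambda>N. g (N + replicate_mset j e)" "drop M"])
    show "n = card (V - {e})" using Suc(2,3) e(1) by simp
    show "finite (V - {e})" "V - {e} \<subseteq> gens" "finite (drop ` Ns)" using Suc(3-5) by (auto simp: Ns_def)
    show "set_mset N \<subseteq> V - {e}" if "N \<in> drop ` Ns" for N
    proof -
      obtain M' where "M' \<in> Ms" "N = drop M'" using \<open>N \<in> drop ` Ns\<close> by (auto simp: Ns_def)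
      then show ?thesis using Suc(6)[of M'] by (auto simp: set_drop)
    qed
    show "count N x < p" if "N \<in> drop ` Ns" "0 < p" for N x
      using that Suc(7) by (auto simp: count_drop Ns_def)
    show "g (N + replicate_mset j e) \<in> generate_ring R (G 0 \<union> frob)" if "N \<in> drop ` Ns" for N
      using that Suc(8) g_eq by (auto simp: Ns_def)
    show "drop M \<in> drop ` Ns" using Suc(10) by (simp add: Ns_def j_def)
    have "(\<Oplus>N\<in>drop ` Ns. g (N + replicate_mset j e) \<otimes> mon N) =
        (\<Oplus>N\<in>Ns. g (drop N + replicate_mset j e) \<otimes> mon (drop N))"
      using g_eq gR drop_R by (intro finsum_reindex inj) (auto simp: Ns_def)
    also have "\<dots> = c j"
      unfolding c_def using g_eq gR drop_R by (intro finsum_cong') (auto simp: Ns_def)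
    also have "\<dots> = \<zero>" using c0 D[OF Suc(10)] by (simp add: j_def)
    finally show "(\<Oplus>N\<in>drop ` Ns. g (N + replicate_mset j e) \<otimes> mon N) = \<zero>" .
  qed
  then show ?case using g_eq[of M] Suc(10) by (simp add: Ns_def j_def)
qed

section \<open>Algebraic independence of the generators\<close>

text \<open>
  Linear independence of a family in \<open>K\<close> over the subfield of \<open>p\<close>-th powers of elements of
  \<open>K\<close>.
\<close>
definition frob_independent :: "('j \<Rightarrow> 'a) \<Rightarrow> 'j set \<Rightarrow> bool" where
  "frob_independent c J \<longleftrightarrow>
     (\<forall>x. (\<forall>j\<in>J. x j \<in> G 0) \<longrightarrow> (\<Oplus>j\<in>J. c j \<otimes> x j [^] p) = \<zero> \<longrightarrow> (\<forall>j\<in>J. x j = \<zero>))"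

text \<open>
  The endomorphisms lower the degree of relations. From a homogeneous relation
  \<open>\<Sum>j. c j * z j ^ p = 0\<close> of positive degree, applying \<open>\<tau>\<close> and subtracting gives
  \<open>\<Sum>j. c j * (\<tau> (z j) - z j) ^ p = 0\<close> of smaller degree, so by induction every \<open>z j\<close> is fixed
  and hence zero. In degree \<open>0\<close> the hypothesis on the family \<open>c\<close> applies directly.
\<close>
lemma frob_independent_extend:
  assumes p: "Factorial_Ring.prime p" "add_pow R p \<one> = \<zero>"
    and J: "finite J" "\<And>j. j \<in> J \<Longrightarrow> c j \<in> G 0" "frob_independent c J"
    and y: "\<And>j. j \<in> J \<Longrightarrow> y j \<in> carrier R"
    and sum: "(\<Oplus>j\<in>J. c j \<otimes> y j [^] p) = \<zero>" and j: "j \<in> J"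
  shows "y j = \<zero>"
proof -
  have p0: "p > 0" using p(1) prime_gt_0_nat by blast
  have cR: "c j \<in> carrier R" if "j \<in> J" for j using J(2)[OF that] by (rule G_carrier)
  have "y j = \<zero>" if "\<And>j. j \<in> J \<Longrightarrow> y j \<in> deg_less n" "(\<Oplus>j\<in>J. c j \<otimes> y j [^] p) = \<zero>" "j \<in> J" for n y j
    using that
  proof (induction n arbitrary: y j)
    case 0
    then show ?case using deg_less_0 by blast
  next
    case (Suc n)
    have yR: "y j \<in> carrier R" if "j \<in> J" for j using Suc(2)[OF that] by (rule deg_less_carrier)
    define z where "z j = hcomp n (y j)" for j
    have zG: "z j \<in> G n" if "j \<in> J" for j using hcomp_G[OF yR[OF that]] by (simp add: z_def)
    have zR: "z j \<in> carrier R" if "j \<in> J" for j using zG[OF that] by (rule G_carrier)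
    have "(\<Oplus>j\<in>J. c j \<otimes> z j [^] p) = (\<Oplus>j\<in>J. hcomp (n * p) (c j \<otimes> y j [^] p))"
    proof (intro finsum_cong' refl)
      fix j assume j: "j \<in> J"
      have "hcomp (n * p) (c j \<otimes> y j [^] p) = hcomp (n * p) (y j [^] p \<otimes> c j)"
        using cR[OF j] yR[OF j] by (simp add: m_comm)
      also have "\<dots> = z j [^] p \<otimes> c j"
        using yR[OF j] p0 by (simp add: hcomp_mult_hom[OF _ J(2)[OF j]] hcomp_frob[OF p] z_def)
      finally show "c j \<otimes> z j [^] p = hcomp (n * p) (c j \<otimes> y j [^] p)"
        using cR[OF j] zR[OF j] by (simp add: m_comm)
    qed (use cR yR hcomp_closed in auto)
    also have "\<dots> = \<zero>"
      using cR yR Suc(3) hcomp_finsum[OF J(1), of "\<lambda>j. c j \<otimes> y j [^] p" "n * p"] by (simp add: hcomp_zero Pi_iff)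
    finally have z_sum: "(\<Oplus>j\<in>J. c j \<otimes> z j [^] p) = \<zero>" .
    have z_fix: "\<tau> (z j) = z j" if \<tau>: "\<tau> \<in> \<Gamma>" and j: "j \<in> J" for \<tau> j
    proof -
      have tR: "\<tau> (z j) \<in> carrier R" if "j \<in> J" for j using hom_closed[OF \<tau> zR[OF that]] .
      have "(\<Oplus>j\<in>J. c j \<otimes> (\<tau> (z j) \<ominus> z j) [^] p) \<oplus> (\<Oplus>j\<in>J. c j \<otimes> z j [^] p) =
          (\<Oplus>j\<in>J. c j \<otimes> (\<tau> (z j) \<ominus> z j) [^] p \<oplus> c j \<otimes> z j [^] p)"
        using cR zR tR by (intro finsum_addf[symmetric]) auto
      also have "\<dots> = (\<Oplus>j\<in>J. \<tau> (c j \<otimes> z j [^] p))"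
      proof (intro finsum_cong' refl)
        fix j assume j: "j \<in> J"
        have "c j \<otimes> (\<tau> (z j) \<ominus> z j) [^] p \<oplus> c j \<otimes> z j [^] p = c j \<otimes> \<tau> (z j) [^] p"
        proof -
          have "(\<tau> (z j) \<ominus> z j) [^] p \<oplus> z j [^] p = \<tau> (z j) [^] p"
            using zR[OF j] tR[OF j] by (subst frobenius_minus[OF p]) (auto simp: minus_eq a_assoc l_neg)
          then show ?thesis
            using cR[OF j] zR[OF j] tR[OF j] r_distr[of "(\<tau> (z j) \<ominus> z j) [^] p" "z j [^] p" "c j"] by simp
        qed
        then show "c j \<otimes> (\<tau> (z j) \<ominus> z j) [^] p \<oplus> c j \<otimes> z j [^] p = \<tau> (c j \<otimes> z j [^] p)"
          using cR[OF j] zR[OF j] by (simp add: ring_hom_mult[OF hom[OF \<tau>]] hom_pow[OF \<tau>] hom_K[OF \<tau> J(2)[OF j]])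
      qed (use cR zR hom_closed[OF \<tau>] in auto)
      also have "\<dots> = \<tau> (\<Oplus>j\<in>J. c j \<otimes> z j [^] p)"
        using cR zR by (intro hom_finsum[symmetric] \<tau>) auto
      also have "\<dots> = \<zero>" using z_sum ring_hom_cring.hom_zero[OF hom_cring[OF \<tau>]] by simp
      finally have "(\<Oplus>j\<in>J. c j \<otimes> (\<tau> (z j) \<ominus> z j) [^] p) = \<zero>"
        using z_sum cR zR tR by (simp add: Pi_iff)
      then have "\<tau> (z j) \<ominus> z j = \<zero>"
        using Suc(1)[of "\<lambda>j. \<tau> (z j) \<ominus> z j" j] lower[OF \<tau> zG] j by simp
      then show ?thesis using tR[OF j] zR[OF j] by simp
    qed
    have z0: "z j = \<zero>" if "j \<in> J" for j
    proof (cases "n = 0")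
      case True
      then show ?thesis using J(3) zG z_sum that unfolding frob_independent_def by blast
    next
      case False
      then show ?thesis using detect[OF zG[OF that]] z_fix that by auto
    qed
    have "y j \<in> deg_less n" if "j \<in> J" for j
      using deg_less_reduce[OF Suc(2)[OF that]] z0[OF that] yR[OF that] by (simp add: z_def minus_eq)
    then show ?case using Suc(1)[of y j] Suc(3,4) by blast
  qed
  note * = this
  have "\<exists>f. \<forall>j\<in>J. y j \<in> deg_less (f j)" using ex_deg_less[OF y] by (intro bchoice) auto
  then obtain f where f: "\<And>j. j \<in> J \<Longrightarrow> y j \<in> deg_less (f j)" by blast
  have "y j \<in> deg_less (Max (f ` J))" if "j \<in> J" for j
    using deg_less_mono[OF f[OF that]] J(1) that by simp
  then show ?thesis using *[of y] sum j by blast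
qed

text \<open>
  Extraction of a \<open>p\<close>-th root from a relation whose coefficients need not be \<open>p\<close>-th powers.
  Write the coefficients in terms of a maximal subfamily that is independent over the \<open>p\<close>-th
  powers of \<open>K\<close>, say \<open>c i = \<Sum>j. c j * a i j ^ p\<close>. The relation becomes
  \<open>\<Sum>j. c j * (\<Sum>i. a i j * y i) ^ p = 0\<close>, and each inner sum vanishes by the preceding lemma.
\<close>
lemma frob_relation_descent:
  assumes p: "Factorial_Ring.prime p" "add_pow R p \<one> = \<zero>"
    and I: "finite I" "\<And>i. i \<in> I \<Longrightarrow> c i \<in> G 0" and y: "\<And>i. i \<in> I \<Longrightarrow> y i \<in> carrier R"
    and sum: "(\<Oplus>i\<in>I. c i \<otimes> y i [^] p) = \<zero>" and nz: "i0 \<in> I" "c i0 \<noteq> \<zero>"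
  shows "\<exists>a. (\<forall>i\<in>I. a i \<in> G 0) \<and> (\<exists>i\<in>I. a i \<noteq> \<zero>) \<and> (\<Oplus>i\<in>I. a i \<otimes> y i) = \<zero>"
proof -
  have p0: "p > 0" using p(1) prime_gt_0_nat by blast
  have KR: "x \<in> carrier R" if "x \<in> G 0" for x using that by (rule G_carrier)
  have cR: "c i \<in> carrier R" if "i \<in> I" for i using I(2)[OF that] by (rule KR)
  define S where "S = {J. J \<subseteq> I \<and> frob_independent c J}"
  have "finite S" using I(1) by (simp add: S_def)
  moreover have "S \<noteq> {}"
  proof -
    have "{} \<in> S" by (simp add: S_def frob_independent_def)
    then show ?thesis by blast
  qed
  ultimately have "\<exists>J\<in>S. \<forall>J'\<in>S. J \<subseteq> J' \<longrightarrow> J = J'" by (rule finite_has_maximal)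
  then obtain J where J: "J \<in> S" "\<And>J'. J' \<in> S \<Longrightarrow> J \<subseteq> J' \<Longrightarrow> J = J'"
    by blast
  have JI: "J \<subseteq> I" and ind: "frob_independent c J" using J(1) by (simp_all add: S_def)
  have finJ: "finite J" using I(1) JI by (rule finite_subset[rotated])
  have span: "\<exists>a. (\<forall>j\<in>J. a j \<in> G 0) \<and> c i = (\<Oplus>j\<in>J. c j \<otimes> a j [^] p) \<and> (\<forall>j\<in>J. i = j \<longrightarrow> a j = \<one>)"
    if i: "i \<in> I" for i
  proof (cases "i \<in> J")
    case True
    have "(\<Oplus>j\<in>J. c j \<otimes> (if i = j then \<one> else \<zero>) [^] p) = (\<Oplus>j\<in>J. if i = j then c j else \<zero>)"
      using cR JI p0 by (intro finsum_cong' refl) (auto simp: nat_pow_zero)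
    also have "\<dots> = c i"
      using True finJ cR JI by (intro finsum_singleton) auto
    finally show ?thesis
      by (intro exI[of _ "\<lambda>j. if i = j then \<one> else \<zero>"]) (auto simp: K_closed)
  next
    case False
    then have "\<not> frob_independent c (insert i J)"
      using J(2)[of "insert i J"] JI i by (auto simp: S_def)
    then obtain x where x: "\<And>j. j \<in> insert i J \<Longrightarrow> x j \<in> G 0"
        "(\<Oplus>j\<in>insert i J. c j \<otimes> x j [^] p) = \<zero>" "\<exists>j\<in>insert i J. x j \<noteq> \<zero>"
      unfolding frob_independent_def by blast
    have xR: "x j \<in> carrier R" if "j \<in> insert i J" for j using x(1)[OF that] by (rule KR)
    have sumR: "(\<Oplus>j\<in>J. c j \<otimes> x j [^] p) \<in> carrier R" using cR JI xR by (intro finsum_closed) auto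
    have rel: "c i \<otimes> x i [^] p \<oplus> (\<Oplus>j\<in>J. c j \<otimes> x j [^] p) = \<zero>"
      using x(2) finJ False cR JI i xR by (subst (asm) finsum_insert) auto
    have xi: "x i \<noteq> \<zero>"
    proof
      assume xi: "x i = \<zero>"
      then have "(\<Oplus>j\<in>J. c j \<otimes> x j [^] p) = \<zero>"
        using rel sumR cR[OF i] p0 by (simp add: nat_pow_zero)
      then have "\<forall>j\<in>J. x j = \<zero>" using ind x(1) unfolding frob_independent_def by blast
      then show False using x(3) xi by blast
    qed
    define v where "v = inv (x i)"
    have v: "v \<in> G 0" "x i \<otimes> v = \<one>" "v \<in> carrier R"
      using K_inv[of "x i"] x(1)[of i] xi KR by (auto simp: v_def)
    have neg_pow: "(\<ominus> z) [^] p = \<ominus> (z [^] p)" if "z \<in> carrier R" for z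
      using frobenius_minus[OF p zero_closed that] that p0 by (simp add: minus_eq nat_pow_zero)
    have "c i \<otimes> x i [^] p = \<ominus> (\<Oplus>j\<in>J. c j \<otimes> x j [^] p)"
      using rel sumR cR[OF i] xR[of i] by (intro sum_zero_eq_neg) auto
    then have "c i \<otimes> x i [^] p \<otimes> v [^] p = \<ominus> (\<Oplus>j\<in>J. c j \<otimes> x j [^] p) \<otimes> v [^] p" by simp
    moreover have "c i \<otimes> x i [^] p \<otimes> v [^] p = c i"
      using cR[OF i] xR[of i] v by (simp add: m_assoc nat_pow_distrib[symmetric])
    moreover have "\<ominus> (\<Oplus>j\<in>J. c j \<otimes> x j [^] p) \<otimes> v [^] p = (\<Oplus>j\<in>J. c j \<otimes> (\<ominus> (x j \<otimes> v)) [^] p)"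
    proof -
      have "\<ominus> (\<Oplus>j\<in>J. c j \<otimes> x j [^] p) \<otimes> v [^] p = (\<Oplus>j\<in>J. c j \<otimes> x j [^] p) \<otimes> (\<ominus> v) [^] p"
        using sumR v by (simp add: neg_pow l_minus r_minus)
      also have "\<dots> = (\<Oplus>j\<in>J. c j \<otimes> x j [^] p \<otimes> (\<ominus> v) [^] p)"
        using finJ cR JI xR v by (intro finsum_ldistr) auto
      also have "\<dots> = (\<Oplus>j\<in>J. c j \<otimes> (\<ominus> (x j \<otimes> v)) [^] p)"
      proof (intro finsum_cong' refl)
        fix j assume j: "j \<in> J"
        then have "\<ominus> (x j \<otimes> v) = x j \<otimes> (\<ominus> v)" using xR v by (simp add: r_minus)
        then show "c j \<otimes> x j [^] p \<otimes> (\<ominus> v) [^] p = c j \<otimes> (\<ominus> (x j \<otimes> v)) [^] p"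
          using j cR JI xR[of j] v by (auto simp: nat_pow_distrib m_assoc)
      qed (use cR JI xR v in auto)
      finally show ?thesis .
    qed
    ultimately have "c i = (\<Oplus>j\<in>J. c j \<otimes> (\<ominus> (x j \<otimes> v)) [^] p)" by simp
    moreover have "\<ominus> (x j \<otimes> v) \<in> G 0" if "j \<in> J" for j
      using x(1)[of j] that v(1) K_closed(5,6) by simp
    ultimately show ?thesis using False by (intro exI[of _ "\<lambda>j. \<ominus> (x j \<otimes> v)"]) auto
  qed
  define good where "good i a \<longleftrightarrow> (\<forall>j\<in>J. a j \<in> G 0) \<and> c i = (\<Oplus>j\<in>J. c j \<otimes> a j [^] p) \<and>
      (\<forall>j\<in>J. i = j \<longrightarrow> a j = \<one>)" for i a
  have "\<forall>i\<in>I. \<exists>a. good i a" using span unfolding good_def by (intro ballI)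
  then obtain a where good: "\<forall>i\<in>I. good i (a i)" by (rule bchoice[THEN exE])
  have a: "a i j \<in> G 0" if "i \<in> I" "j \<in> J" for i j
    using good that unfolding good_def by blast
  have a_sum: "c i = (\<Oplus>j\<in>J. c j \<otimes> a i j [^] p)" if "i \<in> I" for i
    using good that unfolding good_def by (elim ballE conjE) auto
  have a_one: "a j j = \<one>" if "j \<in> J" for j
    using good JI that unfolding good_def by blast
  have aR: "a i j \<in> carrier R" if "i \<in> I" "j \<in> J" for i j using a[OF that] by (rule KR)
  \<comment> \<open>The relation obtained from a member \<open>j0\<close> of \<open>J\<close> is nontrivial, because its coefficient at \<open>j0\<close> is \<open>1\<close>.\<close>
  have "J \<noteq> {}"
  proof
    assume "J = {}"
    then show False using a_sum[OF nz(1)] nz(2) by simp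
  qed
  then obtain j0 where j0: "j0 \<in> J" by blast
  have cJ: "c j \<in> carrier R" if "j \<in> J" for j using cR JI that by blast
  have "(\<Oplus>j\<in>J. c j \<otimes> (\<Oplus>i\<in>I. a i j \<otimes> y i) [^] p) = (\<Oplus>j\<in>J. \<Oplus>i\<in>I. c j \<otimes> a i j [^] p \<otimes> y i [^] p)"
  proof (intro finsum_cong' refl)
    fix j assume j: "j \<in> J"
    have "(\<Oplus>i\<in>I. a i j \<otimes> y i) [^] p = (\<Oplus>i\<in>I. (a i j \<otimes> y i) [^] p)"
      using j aR y by (intro frobenius_finsum[OF p I(1)]) auto
    then have "c j \<otimes> (\<Oplus>i\<in>I. a i j \<otimes> y i) [^] p = (\<Oplus>i\<in>I. c j \<otimes> (a i j \<otimes> y i) [^] p)"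
      using j cJ aR y I(1) by (simp add: finsum_rdistr Pi_iff)
    also have "\<dots> = (\<Oplus>i\<in>I. c j \<otimes> a i j [^] p \<otimes> y i [^] p)"
      using j cJ aR y by (intro finsum_cong' refl) (auto simp: nat_pow_distrib m_assoc)
    finally show "c j \<otimes> (\<Oplus>i\<in>I. a i j \<otimes> y i) [^] p = (\<Oplus>i\<in>I. c j \<otimes> a i j [^] p \<otimes> y i [^] p)" .
  qed (use cJ aR y in auto)
  also have "\<dots> = (\<Oplus>i\<in>I. \<Oplus>j\<in>J. c j \<otimes> a i j [^] p \<otimes> y i [^] p)"
    using cJ aR y by (intro finsum_swap finJ I(1)) auto
  also have "\<dots> = (\<Oplus>i\<in>I. c i \<otimes> y i [^] p)"
  proof (intro finsum_cong' refl)
    fix i assume i: "i \<in> I"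
    have "(\<Oplus>j\<in>J. c j \<otimes> a i j [^] p \<otimes> y i [^] p) = (\<Oplus>j\<in>J. c j \<otimes> a i j [^] p) \<otimes> y i [^] p"
      using i cJ aR y by (intro finsum_ldistr[symmetric] finJ) auto
    then show "(\<Oplus>j\<in>J. c j \<otimes> a i j [^] p \<otimes> y i [^] p) = c i \<otimes> y i [^] p"
      using a_sum[OF i] by simp
  qed (use cR y in auto)
  finally have rel: "(\<Oplus>j\<in>J. c j \<otimes> (\<Oplus>i\<in>I. a i j \<otimes> y i) [^] p) = \<zero>" using sum by simp
  have "(\<Oplus>i\<in>I. a i j0 \<otimes> y i) = \<zero>"
  proof (rule frob_independent_extend[OF p finJ _ ind _ rel j0])
    show "c j \<in> G 0" if "j \<in> J" for j using I(2) JI that by blast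
    show "(\<Oplus>i\<in>I. a i j \<otimes> y i) \<in> carrier R" if "j \<in> J" for j using aR y that by (intro finsum_closed) auto
  qed
  moreover have "a j0 j0 \<noteq> \<zero>" using a_one[OF j0] subfieldE(6)[OF K] by simp
  ultimately show ?thesis using a j0 JI by (intro exI[of _ "\<lambda>i. a i j0"]) blast
qed

text \<open>
  Induction on a bound for the size of the monomials. In characteristic \<open>p\<close>, sort the monomials by
  their exponents modulo \<open>p\<close>. Independence of the monomials with exponents below \<open>p\<close> over the
  \<open>p\<close>-th powers turns the relation into one relation between \<open>p\<close>-th powers of monomials for each
  residue class. Extracting a \<open>p\<close>-th root of it leads to a nontrivial relation between monomials
  of smaller size.
\<close>
lemma monomials_independent:
  assumes "finite Ms" "\<And>M. M \<in> Ms \<Longrightarrow> set_mset M \<subseteq> gens" "\<And>M. M \<in> Ms \<Longrightarrow> size M \<le> N"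
    and "\<And>M. M \<in> Ms \<Longrightarrow> c M \<in> G 0" "(\<Oplus>M\<in>Ms. c M \<otimes> mon M) = \<zero>" "M \<in> Ms"
  shows "c M = \<zero>"
  using assms
proof (induction N arbitrary: Ms c M)
  case 0
  have "M' = {#}" if "M' \<in> Ms" for M' using 0(3)[OF that] by simp
  then have Ms: "Ms = {{#}}" "M = {#}" using 0(6) by auto
  moreover have "c {#} \<in> carrier R" using 0(4)[of "{#}"] Ms by (auto intro: G_carrier)
  ultimately show ?case using 0(5) finsum_insert[of "{}" "{#}" "\<lambda>M. c M \<otimes> mon M"] by (simp add: mon_empty)
next
  case (Suc N)
  have gR: "gens \<subseteq> carrier R" by (auto simp: gens_def intro: G_carrier)
  have cR: "c M \<in> carrier R" if "M \<in> Ms" for M using Suc.prems(4)[OF that] by (rule G_carrier)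
  have MR: "set_mset M \<subseteq> carrier R" if "M \<in> Ms" for M using Suc.prems(2)[OF that] gR by blast
  define V where "V = (\<Union>M\<in>Ms. set_mset M)"
  have V: "finite V" "V \<subseteq> gens" "\<And>M. M \<in> Ms \<Longrightarrow> set_mset M \<subseteq> V"
    using Suc.prems(1,2) by (auto simp: V_def)
  have K_C: "x \<in> generate_ring R (G 0 \<union> frob)" if "x \<in> G 0" for x
    using that by (auto intro: generate_ring.incl)
  have C: "subring (generate_ring R (G 0 \<union> frob)) R"
    by (rule generate_ring_is_subring) (auto simp: frob_def intro: G_carrier)
  show ?case
  proof (cases "p = 0")
    case True
    show ?thesis
    proof (rule restricted_monomials_independent[of V Ms c M])
      show "c M \<in> generate_ring R (G 0 \<union> frob)" if "M \<in> Ms" for M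
        using K_C Suc.prems(4)[OF that] by blast
    qed (fact V Suc.prems(1,5,6) | use True in simp)+
  next
    case False
    with char have p: "Factorial_Ring.prime p" "add_pow R p \<one> = \<zero>" by auto
    have p2: "p \<ge> 2" using p(1) by (rule prime_ge_2_nat)
    let ?r = "\<lambda>M. mset_mod M p" and ?q = "\<lambda>M. mset_div M p"
    have rR: "set_mset (?r M) \<subseteq> carrier R" and qR: "set_mset (?q M) \<subseteq> carrier R" if "M \<in> Ms" for M
      using set_mset_mod[of M p] set_mset_div[of M p] MR[OF that] by blast+
    \<comment> \<open>The residue class of \<open>S\<close> and, below, the coefficient of \<open>mon S\<close> in the regrouped relation.\<close>
    define cls where "cls S = {M \<in> Ms. ?r M = S}" for S
    have finc: "finite (cls S)" for S using Suc.prems(1) by (simp add: cls_def)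
    define g where "g S = (\<Oplus>M\<in>cls S. c M \<otimes> mon (?q M) [^] p)" for S
    have qmR: "mon (?q M) \<in> carrier R" if "M \<in> Ms" for M using qR[OF that] by (rule mon_closed)
    have rmR: "mon (?r M) \<in> carrier R" if "M \<in> Ms" for M using rR[OF that] by (rule mon_closed)
    have mon_split: "mon M = mon (?q M) [^] p \<otimes> mon (?r M)" if "M \<in> Ms" for M
    proof -
      have "set_mset (repeat_mset p (?q M)) \<subseteq> set_mset (?q M)"
        by (auto simp: count_greater_zero_iff[symmetric] simp del: count_greater_zero_iff)
      then have "mon (?r M + repeat_mset p (?q M)) = mon (?r M) \<otimes> mon (?q M) [^] p"
        using rR[OF that] qR[OF that] by (subst mon_add) (auto simp: mon_repeat)
      then have "mon M = mon (?r M) \<otimes> mon (?q M) [^] p"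
        by (simp only: mset_mod_div[symmetric])
      then show ?thesis
        using qmR[OF that] rmR[OF that] by (simp add: m_comm)
    qed
    have "(\<Oplus>S\<in>?r ` Ms. g S \<otimes> mon S) = (\<Oplus>S\<in>?r ` Ms. \<Oplus>M\<in>{M \<in> Ms. ?r M = S}. c M \<otimes> mon M)"
    proof (intro finsum_cong' refl)
      fix S assume S: "S \<in> ?r ` Ms"
      have "g S \<otimes> mon S = (\<Oplus>M\<in>cls S. c M \<otimes> mon (?q M) [^] p \<otimes> mon S)"
        unfolding g_def using S cR qmR rmR by (intro finsum_ldistr finc) (auto simp: cls_def)
      also have "\<dots> = (\<Oplus>M\<in>cls S. c M \<otimes> mon M)"
      proof (intro finsum_cong' refl)
        fix M assume M: "M \<in> cls S"
        then have M: "M \<in> Ms" "?r M = S" by (auto simp: cls_def)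
        show "c M \<otimes> mon (?q M) [^] p \<otimes> mon S = c M \<otimes> mon M"
          using mon_split[OF M(1)] M(2) cR[OF M(1)] qmR[OF M(1)] rmR[OF M(1)] by (simp add: m_assoc)
      qed (use cR mon_closed[OF MR] in \<open>auto simp: cls_def\<close>)
      finally show "g S \<otimes> mon S = (\<Oplus>M\<in>{M \<in> Ms. ?r M = S}. c M \<otimes> mon M)" by (simp add: cls_def)
    qed (use cR mon_closed[OF MR] in auto)
    also have "\<dots> = (\<Oplus>M\<in>Ms. c M \<otimes> mon M)"
      using Suc.prems(1) cR mon_closed[OF MR] by (intro finsum_group[symmetric]) auto
    finally have g_sum: "(\<Oplus>S\<in>?r ` Ms. g S \<otimes> mon S) = \<zero>" using Suc.prems(5) by simp
    define S where "S = ?r M"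
    have gS: "g S = \<zero>"
    proof (rule restricted_monomials_independent[of V "?r ` Ms" g S])
      show "set_mset S \<subseteq> V" if "S \<in> ?r ` Ms" for S
        using that V(3) subset_trans[OF set_mset_mod V(3)] by auto
      show "count S x < p" if "S \<in> ?r ` Ms" "0 < p" for S x
        using that by (auto simp: count_mset_mod)
      show "g S \<in> generate_ring R (G 0 \<union> frob)" for S
        unfolding g_def
      proof (intro subring_finsum_closed[OF C] finc Pi_I)
        fix M assume "M \<in> cls S"
        then have M: "M \<in> Ms" by (simp add: cls_def)
        have "mon (?q M) [^] p \<in> frob" using qmR[OF M] p2 by (auto simp: frob_def)
        then show "c M \<otimes> mon (?q M) [^] p \<in> generate_ring R (G 0 \<union> frob)"
          using K_C[OF Suc.prems(4)[OF M]] by (intro subringE(6)[OF C]) (auto intro: generate_ring.incl)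
      qed
      show "finite (?r ` Ms)" "S \<in> ?r ` Ms" using Suc.prems(1,6) by (simp_all add: S_def)
    qed (fact V(1,2) g_sum)+
    show ?thesis
    proof (rule ccontr)
      assume nz: "c M \<noteq> \<zero>"
      have clsD: "L \<in> Ms" if "L \<in> cls S" for L using that by (simp add: cls_def)
      have "\<exists>a. (\<forall>L\<in>cls S. a L \<in> G 0) \<and> (\<exists>L\<in>cls S. a L \<noteq> \<zero>) \<and>
          (\<Oplus>L\<in>cls S. a L \<otimes> mon (?q L)) = \<zero>"
      proof (rule frob_relation_descent[OF p finc])
        show "c L \<in> G 0" if "L \<in> cls S" for L using Suc.prems(4)[OF clsD[OF that]] .
        show "mon (?q L) \<in> carrier R" if "L \<in> cls S" for L using qmR[OF clsD[OF that]] .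
        show "(\<Oplus>L\<in>cls S. c L \<otimes> mon (?q L) [^] p) = \<zero>" using gS by (simp add: g_def)
        show "M \<in> cls S" using Suc.prems(6) by (simp add: cls_def S_def)
      qed (fact nz)
      then obtain a where a: "\<forall>L\<in>cls S. a L \<in> G 0" "\<exists>L\<in>cls S. a L \<noteq> \<zero>"
          "(\<Oplus>L\<in>cls S. a L \<otimes> mon (?q L)) = \<zero>"
        by (elim exE conjE)
      have inj: "inj_on ?q (cls S)"
      proof (rule inj_onI)
        fix M M' assume "M \<in> cls S" "M' \<in> cls S" "?q M = ?q M'"
        then have "?r M + repeat_mset p (?q M) = ?r M' + repeat_mset p (?q M')"
          by (simp add: cls_def)
        then show "M = M'" by (simp only: mset_mod_div[symmetric])
      qed
      define b where "b L = a (inv_into (cls S) ?q L)" for L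
      have b: "b (?q M) = a M" if "M \<in> cls S" for M
        using inv_into_f_f[OF inj that] by (simp add: b_def)
      have aR: "a M \<in> carrier R" if "M \<in> cls S" for M using bspec[OF a(1) that] by (rule G_carrier)
      have "a M = \<zero>" if M: "M \<in> cls S" for M
      proof -
        have "b (?q M) = \<zero>"
        proof (rule Suc.IH[of "?q ` cls S" b "?q M"])
          show "set_mset L \<subseteq> gens" if "L \<in> ?q ` cls S" for L
          proof -
            obtain M' where "M' \<in> cls S" "L = ?q M'" using \<open>L \<in> ?q ` cls S\<close> by blast
            then show ?thesis using set_mset_div[of M' p] Suc.prems(2)[OF clsD, of M'] by simp
          qed
          show "size L \<le> N" if "L \<in> ?q ` cls S" for L
          proof -
            obtain M' where "M' \<in> cls S" "L = ?q M'" using \<open>L \<in> ?q ` cls S\<close> by blast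
            then show ?thesis using size_mset_div[OF p2 Suc.prems(3)[OF clsD, of M']] by simp
          qed
          show "b L \<in> G 0" if "L \<in> ?q ` cls S" for L
          proof -
            obtain M' where "M' \<in> cls S" "L = ?q M'" using \<open>L \<in> ?q ` cls S\<close> by blast
            then show ?thesis using b a(1) by simp
          qed
          have baR: "b (?q L) \<otimes> mon (?q L) \<in> carrier R" if "L \<in> cls S" for L
            using aR[OF that] qmR[OF clsD[OF that]] b[OF that] by simp
          have "(\<Oplus>L\<in>?q ` cls S. b L \<otimes> mon L) = (\<Oplus>L\<in>cls S. b (?q L) \<otimes> mon (?q L))"
            using baR by (intro finsum_reindex inj) auto
          also have "\<dots> = (\<Oplus>L\<in>cls S. a L \<otimes> mon (?q L))"
          proof (rule finsum_cong'[OF refl])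
            show "(\<lambda>L. a L \<otimes> mon (?q L)) \<in> cls S \<rightarrow> carrier R"
              using aR qmR[OF clsD] by blast
          qed (simp add: b)
          finally show "(\<Oplus>L\<in>?q ` cls S. b L \<otimes> mon L) = \<zero>" using a(3) by simp
          show "finite (?q ` cls S)" "?q M \<in> ?q ` cls S" using finc M by simp_all
        qed
        then show ?thesis using b M by simp
      qed
      then show False using a(2) by blast
    qed
  qed
qed

lemma graded_polynomial_ring: "graded_polynomial_ring R G"
proof -
  have gR: "gens \<subseteq> carrier R" by (auto simp: gens_def intro: G_carrier)
  have "algebraically_independent R (G 0) gens"
    unfolding algebraically_independent_def
  proof (intro conjI ballI impI gR)
    fix c assume c: "c \<in> indexed_pset gens (G 0)" and eval: "eval_poly R c = \<zero>"
    have c': "\<And>m. c m \<in> G 0" "finite {m. c m \<noteq> \<zero>}" "\<And>m. c m \<noteq> \<zero> \<Longrightarrow> set_mset m \<subseteq> gens"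
      using c unfolding indexed_pset_iff[OF K_subring] by auto
    have sum: "(\<Oplus>M\<in>{m. c m \<noteq> \<zero>}. c M \<otimes> mon M) = \<zero>"
      using eval by (simp add: eval_poly_def mon_def)
    have "c M = \<zero>" for M
    proof (rule ccontr)
      assume nz: "c M \<noteq> \<zero>"
      have "c M = \<zero>"
      proof (rule monomials_independent[of "{m. c m \<noteq> \<zero>}" "Max (size ` {m. c m \<noteq> \<zero>})" c])
        show "size L \<le> Max (size ` {m. c m \<noteq> \<zero>})" if "L \<in> {m. c m \<noteq> \<zero>}" for L
          using c'(2) that by (intro Max_ge) auto
      qed (use c'(1,3) in \<open>simp_all add: c'(2) sum nz\<close>)
      then show False using nz by simp
    qed
    then show "c = indexed_const \<zero>" by (auto simp: indexed_const_def)
  qed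
  moreover have "gens \<subseteq> (\<Union>d\<in>{0<..}. G d)" by (auto simp: gens_def)
  ultimately show ?thesis
    unfolding graded_polynomial_ring_def using graded K gens_generate by blast
qed

end

section \<open>The criterion\<close>

text \<open>
  The least positive multiple of \<open>1\<close> that vanishes belongs to a prime, since a proper
  factorization would produce zero divisors in the field \<open>K\<close>.
\<close>
lemma (in cring) ex_char:
  assumes "subfield K R"
  shows "\<exists>p::nat. p = 0 \<and> (\<forall>n::nat>0. add_pow R n \<one> \<noteq> \<zero>) \<or>
    Factorial_Ring.prime p \<and> add_pow R p \<one> = \<zero>"
proof (cases "\<exists>n::nat>0. add_pow R n \<one> = \<zero>")
  case False
  then show ?thesis by (intro exI[of _ 0] disjI1 conjI refl) blast
next
  case True
  define p where "p = (LEAST n::nat. 0 < n \<and> add_pow R n \<one> = \<zero>)"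
  have p: "0 < p" "add_pow R p \<one> = \<zero>"
    using LeastI_ex[OF True] by (auto simp: p_def)
  have least: "add_pow R n \<one> \<noteq> \<zero>" if "0 < n" "n < p" for n :: nat
    using that not_less_Least[of n "\<lambda>n. 0 < n \<and> add_pow R n \<one> = \<zero>"] by (auto simp: p_def)
  have K: "subring K R" using subfieldE(1)[OF assms] .
  have in_K: "add_pow R n \<one> \<in> K" for n :: nat
    using subring_add_pow_closed[OF K subringE(3)[OF K]] .
  have "p \<noteq> 1"
  proof
    assume "p = 1"
    then show False using p(2) subfieldE(6)[OF assms] by simp
  qed
  moreover have "a = 1 \<or> a = p" if "a dvd p" for a
  proof (rule ccontr)
    assume a: "\<not> (a = 1 \<or> a = p)"
    obtain b where b: "p = a * b" using \<open>a dvd p\<close> by blast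
    have "a \<noteq> 0" "b \<noteq> 0" using b p(1) by (intro notI; simp)+
    moreover have "b \<noteq> 1" using a b by (intro notI) simp
    ultimately have "1 < a" "1 < b" using a by simp_all
    then have ab: "0 < a" "0 < b" "a < p" "b < p" using b by simp_all
    have "add_pow R a \<one> \<otimes> add_pow R b \<one> = add_pow R a (\<one> \<otimes> add_pow R b \<one>)"
      by (rule add_pow_ldistr) auto
    also have "\<dots> = \<zero>" using p(2) b by (simp add: add.nat_pow_pow mult.commute)
    finally have "add_pow R a \<one> = \<zero> \<or> add_pow R b \<one> = \<zero>"
      using subfieldE(5)[OF assms in_K in_K] by blast
    then show False using least ab by blast
  qed
  ultimately have "Factorial_Ring.prime p"
    using p(1) by (auto simp: prime_nat_iff)
  then show ?thesis using p(2) by blast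
qed

text \<open>
  The hypotheses on \<open>\<Gamma>\<close> of the preceding sections, as a predicate: it has to be transferred from
  the members of a family of rings to their ultraproduct.
\<close>
definition lowering :: "('b, 'm) ring_scheme \<Rightarrow> (nat \<Rightarrow> 'b set) \<Rightarrow> ('b \<Rightarrow> 'b) set \<Rightarrow> bool" where
  "lowering R G \<Gamma> \<longleftrightarrow>
     (\<forall>\<tau>\<in>\<Gamma>. \<tau> \<in> ring_hom R R \<and> (\<forall>d. \<forall>x\<in>G d. \<tau> x \<ominus>\<^bsub>R\<^esub> x \<in> graded.deg_less R G d)) \<and>
     (\<forall>d>0. \<forall>x\<in>G d. (\<forall>\<tau>\<in>\<Gamma>. \<tau> x = x) \<longrightarrow> x = \<zero>\<^bsub>R\<^esub>)"

lemma lowering_hom: "lowering R G \<Gamma> \<Longrightarrow> \<tau> \<in> \<Gamma> \<Longrightarrow> \<tau> \<in> ring_hom R R"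
  unfolding lowering_def by (elim conjE ballE[of _ _ \<tau>]) simp_all

lemma lowering_lower:
  "lowering R G \<Gamma> \<Longrightarrow> \<tau> \<in> \<Gamma> \<Longrightarrow> x \<in> G d \<Longrightarrow> \<tau> x \<ominus>\<^bsub>R\<^esub> x \<in> graded.deg_less R G d"
  unfolding lowering_def by (elim conjE ballE[of _ _ \<tau>]) simp_all

lemma lowering_detect:
  "lowering R G \<Gamma> \<Longrightarrow> x \<in> G d \<Longrightarrow> 0 < d \<Longrightarrow> (\<And>\<tau>. \<tau> \<in> \<Gamma> \<Longrightarrow> \<tau> x = x) \<Longrightarrow> x = \<zero>\<^bsub>R\<^esub>"
  unfolding lowering_def by (drule conjunct2) simp

lemma graded_polynomial_ring_if_lowering:
  assumes "graded_ring R G" "subfield (G 0) R" "lowering R G \<Gamma>"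
  shows "graded_polynomial_ring R G"
proof -
  have R: "cring R" using assms(1) by (simp add: graded_ring_def)
  then have gr: "graded R G" using assms(1) by (simp add: graded_def graded_axioms_def)
  obtain p :: nat where p: "p = 0 \<and> (\<forall>n::nat>0. add_pow R n \<one>\<^bsub>R\<^esub> \<noteq> \<zero>\<^bsub>R\<^esub>) \<or>
    Factorial_Ring.prime p \<and> add_pow R p \<one>\<^bsub>R\<^esub> = \<zero>\<^bsub>R\<^esub>"
    using cring.ex_char[OF R assms(2)] by (elim exE)
  have "unipotent_graded R G \<Gamma> p"
  proof (intro unipotent_graded.intro unipotent_graded_axioms.intro)
    show "x = \<zero>\<^bsub>R\<^esub>" if "x \<in> G d" "0 < d" "\<And>\<tau>. \<tau> \<in> \<Gamma> \<Longrightarrow> \<tau> x = x" for x d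
      using assms(3) that by (rule lowering_detect)
  qed (fact gr assms(2) p lowering_hom[OF assms(3)] lowering_lower[OF assms(3)])+
  then show ?thesis by (rule unipotent_graded.graded_polynomial_ring)
qed

section \<open>Ultraproducts of graded rings\<close>

lemma (in cring) subfieldI_inverse:
  assumes sub: "subring K R" and one: "\<one> \<noteq> \<zero>"
    and inv: "\<And>x. x \<in> K \<Longrightarrow> x \<noteq> \<zero> \<Longrightarrow> \<exists>y\<in>K. x \<otimes> y = \<one>"
  shows "subfield K R"
proof (rule subfieldI)
  show "subcring K R" by (rule subcringI'[OF sub])
  have KR: "x \<in> carrier R" if "x \<in> K" for x using subringE(1)[OF sub] that by blast
  show "Units (R\<lparr>carrier := K\<rparr>) = K - {\<zero>}"
  proof
    show "Units (R\<lparr>carrier := K\<rparr>) \<subseteq> K - {\<zero>}"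
    proof
      fix x assume "x \<in> Units (R\<lparr>carrier := K\<rparr>)"
      then obtain y where "x \<in> K" "y \<in> K" "x \<otimes> y = \<one>" unfolding Units_def by auto
      then show "x \<in> K - {\<zero>}" using one KR by auto
    qed
    show "K - {\<zero>} \<subseteq> Units (R\<lparr>carrier := K\<rparr>)"
    proof
      fix x assume x: "x \<in> K - {\<zero>}"
      then obtain y where y: "y \<in> K" "x \<otimes> y = \<one>" using inv by blast
      then have "y \<otimes> x = \<one>" using x KR m_comm[of x y] by simp
      then show "x \<in> Units (R\<lparr>carrier := K\<rparr>)" using x y unfolding Units_def by auto
    qed
  qed
qed

locale graded_family =
  fixes U :: "'i filter" and R :: "'i \<Rightarrow> ('b, 'm) ring_scheme" and G :: "'i \<Rightarrow> nat \<Rightarrow> 'b set"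
  assumes ultra: "ultrafilter U" and graded_all: "\<And>i. graded_ring (R i) (G i)"
begin

lemma graded_i: "graded (R i) (G i)"
  using graded_all[of i] unfolding graded_def graded_axioms_def graded_ring_def by blast

sublocale A: graded "R i" "G i" for i
  by (rule graded_i)

abbreviation c where "c i \<equiv> graded.hcomp (R i) (G i)"
abbreviation L where "L i \<equiv> graded.deg_less (R i) (G i)"
abbreviation S where "S \<equiv> graded_ultraproduct U R G"
abbreviation P where "P \<equiv> graded_ultraproduct_piece U R G"

definition germ :: "nat \<Rightarrow> ('i \<Rightarrow> 'b) \<Rightarrow> ('i \<Rightarrow> 'b) set" where
  "germ d f = ultra_rel U (\<lambda>i. G i d) `` {f}"

definition bounded :: "('i \<Rightarrow> 'b) set" where
  "bounded = {f. \<exists>n. \<forall>i. f i \<in> L i n}"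

text \<open>
  The degreewise ultraproduct consists of sequences of classes, one for each degree, which is
  awkward for calculations. Passing to homogeneous components identifies it with the bounded
  families modulo equality on a set of the ultrafilter. Under \<open>\<Psi>\<close> the ring operations are those
  of the factors, index by index, and the ring axioms are inherited.
\<close>
definition \<Psi> :: "('i \<Rightarrow> 'b) \<Rightarrow> nat \<Rightarrow> ('i \<Rightarrow> 'b) set" where
  "\<Psi> f = (\<lambda>d. germ d (\<lambda>i. c i d (f i)))"

lemma ev_or: "eventually Q U \<or> eventually (\<lambda>i. \<not> Q i) U"
  using ultra unfolding ultrafilter_def by blast

lemma U_bot: "U \<noteq> bot"
  using ultra unfolding ultrafilter_def by blast

lemma mem_germ: "h \<in> germ d f \<longleftrightarrow> (\<forall>i. f i \<in> G i d) \<and> (\<forall>i. h i \<in> G i d) \<and> eventually (\<lambda>i. h i = f i) U"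
  by (auto simp: germ_def ultra_rel_def Pi_iff elim: eventually_mono)

lemma germ_G: "h \<in> germ d f \<Longrightarrow> \<forall>i. h i \<in> G i d"
  and germ_ev: "h \<in> germ d f \<Longrightarrow> eventually (\<lambda>i. h i = f i) U"
  by (auto simp: mem_germ)

lemma germ_eq: 
  assumes "\<And>i. f i \<in> G i d" "\<And>i. g i \<in> G i d"
  shows "germ d f = germ d g \<longleftrightarrow> eventually (\<lambda>i. f i = g i) U"
proof
  assume "germ d f = germ d g"
  moreover have "f \<in> germ d f" using assms by (simp add: mem_germ)
  ultimately show "eventually (\<lambda>i. f i = g i) U" by (simp add: mem_germ)
next
  assume ev: "eventually (\<lambda>i. f i = g i) U"
  have "eventually (\<lambda>i. h i = f i) U \<longleftrightarrow> eventually (\<lambda>i. h i = g i) U" for h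
    by (rule eventually_subst) (use ev in \<open>auto elim: eventually_mono\<close>)
  then show "germ d f = germ d g" using assms by (auto simp: mem_germ)
qed

lemma germ_in: "(\<And>i. f i \<in> G i d) \<Longrightarrow> germ d f \<in> ultraproduct U (\<lambda>i. G i d)"
  unfolding ultraproduct_def germ_def by (auto intro: quotientI)

lemma zero_germ: "ultra_rel U (\<lambda>i. G i d) `` {\<lambda>i. \<zero>\<^bsub>R i\<^esub>} = germ d (\<lambda>i. \<zero>\<^bsub>R i\<^esub>)"
  by (simp add: germ_def)

lemma S_zero: "\<zero>\<^bsub>S\<^esub> = (\<lambda>d. germ d (\<lambda>i. \<zero>\<^bsub>R i\<^esub>))"
  by (simp add: graded_ultraproduct_def zero_germ)

lemma S_carrier: "carrier S = {x. (\<forall>d. x d \<in> ultraproduct U (\<lambda>i. G i d)) \<and> finite {d. x d \<noteq> germ d (\<lambda>i. \<zero>\<^bsub>R i\<^esub>)}}"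
  by (simp add: graded_ultraproduct_def zero_germ)

lemma bounded_carrier: "f \<in> bounded \<Longrightarrow> f i \<in> carrier (R i)"
  unfolding bounded_def using A.deg_less_carrier by blast

lemma boundedI: "(\<And>i. f i \<in> L i n) \<Longrightarrow> f \<in> bounded"
  unfolding bounded_def by blast

lemma boundedE:
  assumes "f \<in> bounded" obtains n where "\<forall>i. f i \<in> L i n"
  using assms unfolding bounded_def by (elim CollectE exE)

lemma bounded_hom: "(\<And>i. f i \<in> G i d) \<Longrightarrow> f \<in> bounded"
  by (rule boundedI[of _ "Suc d"]) (auto intro: A.deg_less_hom)

lemma bounded_zero: "(\<lambda>i. \<zero>\<^bsub>R i\<^esub>) \<in> bounded"
  by (rule boundedI[of _ 0]) (rule A.zero_deg_less)

lemma bounded_one: "(\<lambda>i. \<one>\<^bsub>R i\<^esub>) \<in> bounded"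
  by (rule bounded_hom[of _ 0]) (rule A.one_G)

lemma bounded_obtain2:
  assumes "f \<in> bounded" "g \<in> bounded"
  obtains n where "\<And>i. f i \<in> L i (Suc n)" "\<And>i. g i \<in> L i (Suc n)"
proof -
  obtain n k where "\<And>i. f i \<in> L i n" "\<And>i. g i \<in> L i k"
    using assms unfolding bounded_def by blast
  then have "f i \<in> L i (Suc (n + k))" "g i \<in> L i (Suc (n + k))" for i
    using A.deg_less_mono[of "f i" i n "Suc (n + k)"] A.deg_less_mono[of "g i" i k "Suc (n + k)"] by simp_all
  then show ?thesis by (rule that)
qed

lemma bounded_add: "f \<in> bounded \<Longrightarrow> g \<in> bounded \<Longrightarrow> (\<lambda>i. f i \<oplus>\<^bsub>R i\<^esub> g i) \<in> bounded"
  by (erule bounded_obtain2[of f g], assumption, rule boundedI, rule A.deg_less_add)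

lemma bounded_neg: "f \<in> bounded \<Longrightarrow> (\<lambda>i. \<ominus>\<^bsub>R i\<^esub> f i) \<in> bounded"
  unfolding bounded_def using A.deg_less_neg by blast

lemma bounded_mult: "f \<in> bounded \<Longrightarrow> g \<in> bounded \<Longrightarrow> (\<lambda>i. f i \<otimes>\<^bsub>R i\<^esub> g i) \<in> bounded"
  by (erule bounded_obtain2[of f g], assumption, rule boundedI, rule A.deg_less_mult)

lemma bounded_hcomp: "f \<in> bounded \<Longrightarrow> (\<lambda>i. c i d (f i)) \<in> bounded"
  by (rule bounded_hom[of _ d]) (simp add: bounded_carrier A.hcomp_G)

lemma \<Psi>_eq_iff:
  assumes "f \<in> bounded" "g \<in> bounded"
  shows "\<Psi> f = \<Psi> g \<longleftrightarrow> eventually (\<lambda>i. f i = g i) U"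
proof
  assume eq: "\<Psi> f = \<Psi> g"
  obtain n where n: "\<And>i. f i \<in> L i (Suc n)" "\<And>i. g i \<in> L i (Suc n)"
    using bounded_obtain2[OF assms] by blast
  have "eventually (\<lambda>i. c i d (f i) = c i d (g i)) U" for d
    using fun_cong[OF eq, of d] assms by (simp add: \<Psi>_def germ_eq bounded_carrier A.hcomp_G)
  then have "eventually (\<lambda>i. \<forall>d\<in>{..<Suc n}. c i d (f i) = c i d (g i)) U"
    by (intro eventually_ball_finite) auto
  then show "eventually (\<lambda>i. f i = g i) U"
  proof (rule eventually_mono)
    fix i assume "\<forall>d\<in>{..<Suc n}. c i d (f i) = c i d (g i)"
    then have "(\<Oplus>\<^bsub>R i\<^esub>d\<in>{..<Suc n}. c i d (f i)) = (\<Oplus>\<^bsub>R i\<^esub>d\<in>{..<Suc n}. c i d (g i))"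
      using assms by (intro A.finsum_cong') (auto simp: bounded_carrier A.hcomp_closed)
    then show "f i = g i" using A.deg_less_sum[OF n(1)] A.deg_less_sum[OF n(2)] by simp
  qed
next
  assume "eventually (\<lambda>i. f i = g i) U"
  then have "eventually (\<lambda>i. c i d (f i) = c i d (g i)) U" for d
    by (rule eventually_mono) simp
  then show "\<Psi> f = \<Psi> g"
    using assms by (auto simp: \<Psi>_def germ_eq bounded_carrier A.hcomp_G fun_eq_iff)
qed

lemma \<Psi>_carrier: 
  assumes "f \<in> bounded" shows "\<Psi> f \<in> carrier S"
proof -
  obtain n where n: "\<And>i. f i \<in> L i n" using assms unfolding bounded_def by blast
  have "\<Psi> f d = germ d (\<lambda>i. \<zero>\<^bsub>R i\<^esub>)" if "d \<ge> n" for d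
    using n that by (simp add: \<Psi>_def A.deg_less_def)
  then have "{d. \<Psi> f d \<noteq> germ d (\<lambda>i. \<zero>\<^bsub>R i\<^esub>)} \<subseteq> {..<n}" by (auto simp: not_less[symmetric])
  then have "finite {d. \<Psi> f d \<noteq> germ d (\<lambda>i. \<zero>\<^bsub>R i\<^esub>)}" by (rule finite_subset) simp
  then show ?thesis
    using assms by (auto simp: S_carrier \<Psi>_def intro!: germ_in A.hcomp_G bounded_carrier)
qed

lemma \<Psi>_hom: 
  assumes "\<And>i. f i \<in> G i d"
  shows "\<Psi> f = (\<lambda>e. if e = d then germ d f else germ e (\<lambda>i. \<zero>\<^bsub>R i\<^esub>))"
proof
  fix e
  have "c i e (f i) = (if e = d then f i else \<zero>\<^bsub>R i\<^esub>)" for i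
    using assms by (rule A.hcomp_hom)
  then show "\<Psi> f e = (if e = d then germ d f else germ e (\<lambda>i. \<zero>\<^bsub>R i\<^esub>))"
    by (simp add: \<Psi>_def)
qed

lemma \<Psi>_zero: "\<Psi> (\<lambda>i. \<zero>\<^bsub>R i\<^esub>) = \<zero>\<^bsub>S\<^esub>"
  by (simp add: S_zero \<Psi>_def A.hcomp_zero)

lemma \<Psi>_one: "\<Psi> (\<lambda>i. \<one>\<^bsub>R i\<^esub>) = \<one>\<^bsub>S\<^esub>"
  by (subst \<Psi>_hom[OF A.one_G]) (simp add: graded_ultraproduct_def germ_def fun_eq_iff)

lemma \<Psi>_add:
  assumes "f \<in> bounded" "g \<in> bounded"
  shows "\<Psi> f \<oplus>\<^bsub>S\<^esub> \<Psi> g = \<Psi> (\<lambda>i. f i \<oplus>\<^bsub>R i\<^esub> g i)"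
proof
  fix d
  let ?f = "\<lambda>i. c i d (f i)" and ?g = "\<lambda>i. c i d (g i)"
  have G: "\<And>i. ?f i \<in> G i d" "\<And>i. ?g i \<in> G i d" using assms by (auto simp: bounded_carrier A.hcomp_G)
  have "(\<Psi> f \<oplus>\<^bsub>S\<^esub> \<Psi> g) d = {h. (\<forall>i. h i \<in> G i d) \<and> (\<exists>a\<in>germ d ?f. \<exists>b\<in>germ d ?g. eventually (\<lambda>i. h i = a i \<oplus>\<^bsub>R i\<^esub> b i) U)}"
    by (simp add: graded_ultraproduct_def Pi_iff \<Psi>_def)
  also have "\<dots> = germ d (\<lambda>i. ?f i \<oplus>\<^bsub>R i\<^esub> ?g i)"
  proof (rule Set.set_eqI, rule iffI)
    fix h assume "h \<in> {h. (\<forall>i. h i \<in> G i d) \<and> (\<exists>a\<in>germ d ?f. \<exists>b\<in>germ d ?g. eventually (\<lambda>i. h i = a i \<oplus>\<^bsub>R i\<^esub> b i) U)}"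
    then obtain a b where h: "\<forall>i. h i \<in> G i d" "a \<in> germ d ?f" "b \<in> germ d ?g" "eventually (\<lambda>i. h i = a i \<oplus>\<^bsub>R i\<^esub> b i) U"
      by blast
    have "eventually (\<lambda>i. a i = ?f i) U" "eventually (\<lambda>i. b i = ?g i) U"
      using h(2,3) by (auto simp: mem_germ)
    then have "eventually (\<lambda>i. h i = ?f i \<oplus>\<^bsub>R i\<^esub> ?g i) U"
      using h(4) by eventually_elim simp
    then show "h \<in> germ d (\<lambda>i. ?f i \<oplus>\<^bsub>R i\<^esub> ?g i)"
      using h(1) G by (simp add: mem_germ A.G_add)
  next
    fix h assume "h \<in> germ d (\<lambda>i. ?f i \<oplus>\<^bsub>R i\<^esub> ?g i)"
    then have h: "\<forall>i. h i \<in> G i d" "eventually (\<lambda>i. h i = ?f i \<oplus>\<^bsub>R i\<^esub> ?g i) U"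
      by (rule germ_G, rule germ_ev)
    have fg: "?f \<in> germ d ?f" "?g \<in> germ d ?g" using G by (simp_all add: mem_germ)
    have "\<exists>b\<in>germ d ?g. eventually (\<lambda>i. h i = ?f i \<oplus>\<^bsub>R i\<^esub> b i) U"
      using h(2) fg(2) by (rule bexI)
    then have "\<exists>a\<in>germ d ?f. \<exists>b\<in>germ d ?g. eventually (\<lambda>i. h i = a i \<oplus>\<^bsub>R i\<^esub> b i) U"
      using fg(1) by (rule bexI)
    with h(1) show "h \<in> {h. (\<forall>i. h i \<in> G i d) \<and> (\<exists>a\<in>germ d ?f. \<exists>b\<in>germ d ?g. eventually (\<lambda>i. h i = a i \<oplus>\<^bsub>R i\<^esub> b i) U)}"
      by simp
  qed
  also have "\<dots> = \<Psi> (\<lambda>i. f i \<oplus>\<^bsub>R i\<^esub> g i) d"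
    using assms by (simp add: \<Psi>_def A.hcomp_add bounded_carrier)
  finally show "(\<Psi> f \<oplus>\<^bsub>S\<^esub> \<Psi> g) d = \<Psi> (\<lambda>i. f i \<oplus>\<^bsub>R i\<^esub> g i) d" .
qed

text \<open>
  The product of the ultraproduct is defined by the convolution formula for the components of a
  product, which is how the components of \<open>f i * g i\<close> are computed in each factor.
\<close>
lemma \<Psi>_mult:
  assumes "f \<in> bounded" "g \<in> bounded"
  shows "\<Psi> f \<otimes>\<^bsub>S\<^esub> \<Psi> g = \<Psi> (\<lambda>i. f i \<otimes>\<^bsub>R i\<^esub> g i)"
proof
  fix d
  let ?m = "\<lambda>(a :: nat \<Rightarrow> 'i \<Rightarrow> 'b) b i. \<Oplus>\<^bsub>R i\<^esub>j\<in>{..d}. a j i \<otimes>\<^bsub>R i\<^esub> b (d - j) i"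
  let ?f = "\<lambda>j i. c i j (f i)" and ?g = "\<lambda>j i. c i j (g i)"
  have G: "\<And>i j. ?f j i \<in> G i j" "\<And>i j. ?g j i \<in> G i j" using assms by (auto simp: bounded_carrier A.hcomp_G)
  have fR: "?f j i \<in> carrier (R i)" and gR: "?g j i \<in> carrier (R i)" for i j
    using A.G_carrier[OF G(1)] A.G_carrier[OF G(2)] by auto
  have m: "?m ?f ?g i = c i d (f i \<otimes>\<^bsub>R i\<^esub> g i)" for i
    using assms by (simp add: A.hcomp_mult bounded_carrier)
  have mG: "?m ?f ?g i \<in> G i d" for i
    unfolding m using assms by (simp add: A.hcomp_G bounded_carrier)
  have "(\<Psi> f \<otimes>\<^bsub>S\<^esub> \<Psi> g) d = {h. (\<forall>i. h i \<in> G i d) \<and>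
      (\<exists>a b. (\<forall>j\<le>d. a j \<in> germ j (?f j) \<and> b j \<in> germ j (?g j)) \<and> eventually (\<lambda>i. h i = ?m a b i) U)}"
    by (simp add: graded_ultraproduct_def Pi_iff \<Psi>_def)
  also have "\<dots> = germ d (?m ?f ?g)"
  proof (rule Set.set_eqI, rule iffI)
    fix h assume "h \<in> {h. (\<forall>i. h i \<in> G i d) \<and>
      (\<exists>a b. (\<forall>j\<le>d. a j \<in> germ j (?f j) \<and> b j \<in> germ j (?g j)) \<and> eventually (\<lambda>i. h i = ?m a b i) U)}"
    then obtain a b where h: "\<forall>i. h i \<in> G i d" "\<forall>j\<le>d. a j \<in> germ j (?f j) \<and> b j \<in> germ j (?g j)"
        "eventually (\<lambda>i. h i = ?m a b i) U"
      by blast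
    have "eventually (\<lambda>i. \<forall>j\<in>{..d}. a j i = ?f j i \<and> b j i = ?g j i) U"
      using h(2) by (intro eventually_ball_finite) (auto simp: mem_germ intro: eventually_conj)
    then have "eventually (\<lambda>i. h i = ?m ?f ?g i) U"
      using h(3)
    proof eventually_elim
      fix i assume eq: "\<forall>j\<in>{..d}. a j i = ?f j i \<and> b j i = ?g j i" and hi: "h i = ?m a b i"
      have "?m a b i = ?m ?f ?g i"
        using eq fR gR by (intro A.finsum_cong'[OF refl]) simp_all
      then show "h i = ?m ?f ?g i" using hi by simp
    qed
    then show "h \<in> germ d (?m ?f ?g)"
      using h(1) mG by (simp add: mem_germ)
  next
    fix h assume "h \<in> germ d (?m ?f ?g)"
    then have h: "\<forall>i. h i \<in> G i d" "eventually (\<lambda>i. h i = ?m ?f ?g i) U"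
      by (rule germ_G, rule germ_ev)
    have "\<forall>j\<le>d. ?f j \<in> germ j (?f j) \<and> ?g j \<in> germ j (?g j)" using G by (simp add: mem_germ)
    with h(2) have "(\<forall>j\<le>d. ?f j \<in> germ j (?f j) \<and> ?g j \<in> germ j (?g j)) \<and> eventually (\<lambda>i. h i = ?m ?f ?g i) U"
      by (intro conjI)
    then have "\<exists>a b. (\<forall>j\<le>d. a j \<in> germ j (?f j) \<and> b j \<in> germ j (?g j)) \<and> eventually (\<lambda>i. h i = ?m a b i) U"
      by (intro exI[of _ ?f] exI[of _ ?g])
    with h(1) show "h \<in> {h. (\<forall>i. h i \<in> G i d) \<and>
      (\<exists>a b. (\<forall>j\<le>d. a j \<in> germ j (?f j) \<and> b j \<in> germ j (?g j)) \<and> eventually (\<lambda>i. h i = ?m a b i) U)}"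
      by (intro CollectI conjI)
  qed
  also have "\<dots> = \<Psi> (\<lambda>i. f i \<otimes>\<^bsub>R i\<^esub> g i) d"
    by (simp add: \<Psi>_def m)
  finally show "(\<Psi> f \<otimes>\<^bsub>S\<^esub> \<Psi> g) d = \<Psi> (\<lambda>i. f i \<otimes>\<^bsub>R i\<^esub> g i) d" .
qed

text \<open>
  Choose representatives of the finitely many nonzero classes and add them up.
\<close>
lemma \<Psi>_surj:
  assumes "x \<in> carrier S"
  obtains f where "f \<in> bounded" "x = \<Psi> f"
proof -
  have "\<exists>f. (\<forall>i. f i \<in> G i d) \<and> x d = germ d f" for d
  proof -
    have "x d \<in> ultraproduct U (\<lambda>i. G i d)" using assms by (simp add: S_carrier)
    then show ?thesis unfolding ultraproduct_def germ_def by (auto elim!: quotientE)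
  qed
  then obtain r where r: "\<And>d i. r d i \<in> G i d" "\<And>d. x d = germ d (r d)" by metis
  obtain n where n: "\<And>d. x d \<noteq> germ d (\<lambda>i. \<zero>\<^bsub>R i\<^esub>) \<Longrightarrow> d < n"
    using assms finite_nat_set_iff_bounded[of "{d. x d \<noteq> germ d (\<lambda>i. \<zero>\<^bsub>R i\<^esub>)}"]
    by (auto simp: S_carrier)
  define f where "f i = (\<Oplus>\<^bsub>R i\<^esub>d\<in>{..<n}. if d < n then r d i else \<zero>\<^bsub>R i\<^esub>)" for i
  have cf: "c i d (f i) = (if d < n then r d i else \<zero>\<^bsub>R i\<^esub>)" for i d
    unfolding f_def using r(1) by (intro A.hcomp_uniqueI) (auto simp: A.zero_G)
  have fR: "f i \<in> carrier (R i)" for i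
    unfolding f_def using A.G_carrier[OF r(1)] by (intro A.finsum_closed) auto
  have "f \<in> bounded"
    by (rule boundedI[of _ n]) (use fR cf in \<open>auto simp: A.deg_less_def\<close>)
  moreover have "x d = \<Psi> f d" for d
  proof (cases "d < n")
    case True
    then show ?thesis by (simp add: \<Psi>_def cf r(2))
  next
    case False
    then show ?thesis using n[of d] by (auto simp: \<Psi>_def cf)
  qed
  ultimately show ?thesis using that[of f] by (auto simp: fun_eq_iff)
qed

lemma S_cring: "cring S"
proof (rule cringI)
  show "abelian_group S"
  proof (rule abelian_groupI)
    fix x y assume xy: "x \<in> carrier S" "y \<in> carrier S"
    obtain f g where fg: "f \<in> bounded" "x = \<Psi> f" "g \<in> bounded" "y = \<Psi> g" using xy \<Psi>_surj by metis
    show "x \<oplus>\<^bsub>S\<^esub> y \<in> carrier S" using fg by (simp add: \<Psi>_add \<Psi>_carrier bounded_add)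
    show "x \<oplus>\<^bsub>S\<^esub> y = y \<oplus>\<^bsub>S\<^esub> x" using fg by (simp add: \<Psi>_add A.a_comm bounded_carrier)
    fix z assume "z \<in> carrier S"
    then obtain h where "h \<in> bounded" "z = \<Psi> h" using \<Psi>_surj by metis
    then show "x \<oplus>\<^bsub>S\<^esub> y \<oplus>\<^bsub>S\<^esub> z = x \<oplus>\<^bsub>S\<^esub> (y \<oplus>\<^bsub>S\<^esub> z)"
      using fg by (simp add: \<Psi>_add bounded_add A.a_assoc bounded_carrier)
  next
    show "\<zero>\<^bsub>S\<^esub> \<in> carrier S" by (simp add: \<Psi>_zero[symmetric] \<Psi>_carrier bounded_zero)
    fix x assume x: "x \<in> carrier S"
    obtain f where f: "f \<in> bounded" "x = \<Psi> f" using x \<Psi>_surj by metis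
    show "\<zero>\<^bsub>S\<^esub> \<oplus>\<^bsub>S\<^esub> x = x" using f by (simp add: \<Psi>_zero[symmetric] \<Psi>_add bounded_zero bounded_carrier)
    have "\<Psi> (\<lambda>i. \<ominus>\<^bsub>R i\<^esub> f i) \<oplus>\<^bsub>S\<^esub> x = \<zero>\<^bsub>S\<^esub>"
      using f by (simp add: \<Psi>_zero[symmetric] \<Psi>_add bounded_neg bounded_carrier A.l_neg)
    then show "\<exists>y\<in>carrier S. y \<oplus>\<^bsub>S\<^esub> x = \<zero>\<^bsub>S\<^esub>" using f by (blast intro: \<Psi>_carrier bounded_neg)
  qed
  show "comm_monoid S"
  proof (rule comm_monoidI)
    fix x y assume xy: "x \<in> carrier S" "y \<in> carrier S"
    obtain f g where fg: "f \<in> bounded" "x = \<Psi> f" "g \<in> bounded" "y = \<Psi> g" using xy \<Psi>_surj by metis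
    show "x \<otimes>\<^bsub>S\<^esub> y \<in> carrier S" using fg by (simp add: \<Psi>_mult \<Psi>_carrier bounded_mult)
    show "x \<otimes>\<^bsub>S\<^esub> y = y \<otimes>\<^bsub>S\<^esub> x" using fg by (simp add: \<Psi>_mult A.m_comm bounded_carrier)
    fix z assume "z \<in> carrier S"
    then obtain h where "h \<in> bounded" "z = \<Psi> h" using \<Psi>_surj by metis
    then show "x \<otimes>\<^bsub>S\<^esub> y \<otimes>\<^bsub>S\<^esub> z = x \<otimes>\<^bsub>S\<^esub> (y \<otimes>\<^bsub>S\<^esub> z)"
      using fg by (simp add: \<Psi>_mult bounded_mult A.m_assoc bounded_carrier)
  next
    show "\<one>\<^bsub>S\<^esub> \<in> carrier S" by (simp add: \<Psi>_one[symmetric] \<Psi>_carrier bounded_one)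
    fix x assume x: "x \<in> carrier S"
    obtain f where f: "f \<in> bounded" "x = \<Psi> f" using x \<Psi>_surj by metis
    show "\<one>\<^bsub>S\<^esub> \<otimes>\<^bsub>S\<^esub> x = x" using f by (simp add: \<Psi>_one[symmetric] \<Psi>_mult bounded_one bounded_carrier)
  qed
  fix x y z assume xyz: "x \<in> carrier S" "y \<in> carrier S" "z \<in> carrier S"
  obtain f g h where fg: "f \<in> bounded" "x = \<Psi> f" "g \<in> bounded" "y = \<Psi> g" "h \<in> bounded" "z = \<Psi> h"
    using xyz \<Psi>_surj by metis
  show "(x \<oplus>\<^bsub>S\<^esub> y) \<otimes>\<^bsub>S\<^esub> z = x \<otimes>\<^bsub>S\<^esub> z \<oplus>\<^bsub>S\<^esub> y \<otimes>\<^bsub>S\<^esub> z"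
    using fg by (simp add: \<Psi>_add \<Psi>_mult bounded_add bounded_mult A.l_distr bounded_carrier)
qed

sublocale S: cring S by (rule S_cring)

lemma \<Psi>_neg: "f \<in> bounded \<Longrightarrow> \<ominus>\<^bsub>S\<^esub> \<Psi> f = \<Psi> (\<lambda>i. \<ominus>\<^bsub>R i\<^esub> f i)"
  by (rule S.minus_equality)
    (simp_all add: \<Psi>_add bounded_neg bounded_carrier A.l_neg \<Psi>_zero \<Psi>_carrier)

lemma \<Psi>_minus: "f \<in> bounded \<Longrightarrow> g \<in> bounded \<Longrightarrow> \<Psi> f \<ominus>\<^bsub>S\<^esub> \<Psi> g = \<Psi> (\<lambda>i. f i \<ominus>\<^bsub>R i\<^esub> g i)"
  by (simp add: a_minus_def \<Psi>_neg \<Psi>_add bounded_neg)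

lemma mem_P: "x \<in> P d \<longleftrightarrow> (\<exists>f. (\<forall>i. f i \<in> G i d) \<and> x = \<Psi> f)"
proof
  assume x: "x \<in> P d"
  then have xS: "x \<in> carrier S" and xe: "\<And>e. e \<noteq> d \<Longrightarrow> x e = \<zero>\<^bsub>S\<^esub> e"
    by (auto simp: graded_ultraproduct_piece_def)
  obtain f where f: "f \<in> bounded" "x = \<Psi> f" using xS by (rule \<Psi>_surj)
  let ?g = "\<lambda>i. c i d (f i)"
  have g: "?g i \<in> G i d" for i using f(1) by (simp add: A.hcomp_G bounded_carrier)
  have "x = \<Psi> ?g"
  proof
    fix e show "x e = \<Psi> ?g e"
      unfolding \<Psi>_hom[OF g] using xe[of e] f(2) by (auto simp: \<Psi>_def S_zero)
  qed
  then show "\<exists>f. (\<forall>i. f i \<in> G i d) \<and> x = \<Psi> f" using g by (intro exI[of _ ?g]) simp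
next
  assume "\<exists>f. (\<forall>i. f i \<in> G i d) \<and> x = \<Psi> f"
  then obtain f where f: "\<And>i. f i \<in> G i d" "x = \<Psi> f" by blast
  have "\<Psi> f e = \<zero>\<^bsub>S\<^esub> e" if "e \<noteq> d" for e
    using that by (simp add: \<Psi>_hom[OF f(1)] S_zero)
  then show "x \<in> P d"
    using f(2) \<Psi>_carrier[OF bounded_hom[OF f(1)]] by (simp add: graded_ultraproduct_piece_def)
qed

lemma P_E:
  assumes "x \<in> P d" obtains f where "\<forall>i. f i \<in> G i d" "x = \<Psi> f"
  using assms unfolding mem_P by (elim exE conjE)

lemma P_I: "(\<And>i. f i \<in> G i d) \<Longrightarrow> \<Psi> f \<in> P d"
  unfolding mem_P by (intro exI[of _ f]) simp

definition pr :: "nat \<Rightarrow> (nat \<Rightarrow> ('i \<Rightarrow> 'b) set) \<Rightarrow> nat \<Rightarrow> ('i \<Rightarrow> 'b) set" where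
  "pr d x = (\<lambda>e. if e = d then x d else \<zero>\<^bsub>S\<^esub> e)"

lemma pr_\<Psi>:
  assumes "f \<in> bounded" shows "pr d (\<Psi> f) = \<Psi> (\<lambda>i. c i d (f i))"
proof
  fix e
  have "\<Psi> (\<lambda>i. c i d (f i)) = (\<lambda>e. if e = d then germ d (\<lambda>i. c i d (f i)) else germ e (\<lambda>i. \<zero>\<^bsub>R i\<^esub>))"
    by (rule \<Psi>_hom) (rule A.hcomp_G[OF bounded_carrier[OF assms]])
  then show "pr d (\<Psi> f) e = \<Psi> (\<lambda>i. c i d (f i)) e"
    by (simp add: pr_def S_zero) (simp add: \<Psi>_def)
qed

lemma \<Psi>_finsum:
  assumes "finite I" "\<And>a. a \<in> I \<Longrightarrow> f a \<in> bounded"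
  shows "(\<lambda>i. \<Oplus>\<^bsub>R i\<^esub>a\<in>I. f a i) \<in> bounded \<and> (\<Oplus>\<^bsub>S\<^esub>a\<in>I. \<Psi> (f a)) = \<Psi> (\<lambda>i. \<Oplus>\<^bsub>R i\<^esub>a\<in>I. f a i)"
  using assms
proof (induction I)
  case empty
  then show ?case by (simp add: bounded_zero \<Psi>_zero)
next
  case (insert a I)
  have "(\<Oplus>\<^bsub>R i\<^esub>a\<in>insert a I. f a i) = f a i \<oplus>\<^bsub>R i\<^esub> (\<Oplus>\<^bsub>R i\<^esub>a\<in>I. f a i)" for i
    using insert bounded_carrier by (intro A.finsum_insert) auto
  moreover have "(\<Oplus>\<^bsub>S\<^esub>a\<in>insert a I. \<Psi> (f a)) = \<Psi> (f a) \<oplus>\<^bsub>S\<^esub> (\<Oplus>\<^bsub>S\<^esub>a\<in>I. \<Psi> (f a))"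
    using insert \<Psi>_carrier by (intro S.finsum_insert) auto
  ultimately show ?case using insert by (simp add: bounded_add \<Psi>_add)
qed

lemma graded_S: "graded_ring S P"
proof (rule graded_ringI[OF S_cring, of P pr])
  show "additive_subgroup (P d) S" for d
  proof (rule additive_subgroup.intro, rule S.add.subgroupI)
    show "P d \<subseteq> carrier S" by (auto simp: graded_ultraproduct_piece_def)
    have "\<zero>\<^bsub>S\<^esub> \<in> P d"
      using P_I[OF A.zero_G] by (simp add: \<Psi>_zero)
    then show "P d \<noteq> {}" by blast
    fix x assume "x \<in> P d"
    then obtain f where f_all: "\<forall>i. f i \<in> G i d" "x = \<Psi> f" by (rule P_E)
    note f = spec[OF f_all(1)] f_all(2)
    show "\<ominus>\<^bsub>S\<^esub> x \<in> P d"
      using P_I[OF A.G_neg[OF f(1)]] f \<Psi>_neg[OF bounded_hom[OF f(1)]] by simp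
    fix y assume "y \<in> P d"
    then obtain g where g_all: "\<forall>i. g i \<in> G i d" "y = \<Psi> g" by (rule P_E)
    note g = spec[OF g_all(1)] g_all(2)
    show "x \<oplus>\<^bsub>S\<^esub> y \<in> P d"
      using P_I[OF A.G_add[OF f(1) g(1)]] f g \<Psi>_add[OF bounded_hom[OF f(1)] bounded_hom[OF g(1)]] by simp
  qed
  show "\<one>\<^bsub>S\<^esub> \<in> P 0"
    using P_I[OF A.one_G] by (simp add: \<Psi>_one)
  show "x \<otimes>\<^bsub>S\<^esub> y \<in> P (d + e)" if xy: "x \<in> P d" "y \<in> P e" for d e x y
  proof -
    obtain f where f_all: "\<forall>i. f i \<in> G i d" "x = \<Psi> f" using xy(1) by (rule P_E)
    note f = spec[OF f_all(1)] f_all(2)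
    obtain g where g_all: "\<forall>i. g i \<in> G i e" "y = \<Psi> g" using xy(2) by (rule P_E)
    note g = spec[OF g_all(1)] g_all(2)
    show ?thesis
      using P_I[OF A.G_mult[OF f(1) g(1)]] f g \<Psi>_mult[OF bounded_hom[OF f(1)] bounded_hom[OF g(1)]] by simp
  qed
  show "pr d (x \<oplus>\<^bsub>S\<^esub> y) = pr d x \<oplus>\<^bsub>S\<^esub> pr d y" if xy: "x \<in> carrier S" "y \<in> carrier S" for d x y
  proof -
    obtain f where f: "f \<in> bounded" "x = \<Psi> f" using xy(1) by (rule \<Psi>_surj)
    obtain g where g: "g \<in> bounded" "y = \<Psi> g" using xy(2) by (rule \<Psi>_surj)
    show ?thesis using f g by (simp add: \<Psi>_add pr_\<Psi> bounded_add bounded_hcomp A.hcomp_add bounded_carrier)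
  qed
  show "pr d x \<in> P d" if x: "x \<in> carrier S" for d x
  proof -
    obtain f where f: "f \<in> bounded" "x = \<Psi> f" using x by (rule \<Psi>_surj)
    show ?thesis
      using P_I[OF A.hcomp_G[OF bounded_carrier[OF f(1)]]] by (simp add: f(2) pr_\<Psi>[OF f(1)])
  qed
  show "pr e x = (if e = d then x else \<zero>\<^bsub>S\<^esub>)" if "x \<in> P d" for d e x
    using that by (auto simp: pr_def graded_ultraproduct_piece_def fun_eq_iff)
  show "\<exists>n. (\<forall>d\<ge>n. pr d x = \<zero>\<^bsub>S\<^esub>) \<and> x = (\<Oplus>\<^bsub>S\<^esub>d\<in>{..<n}. pr d x)" if x: "x \<in> carrier S" for x
  proof -
    obtain f where f: "f \<in> bounded" "x = \<Psi> f" using x by (rule \<Psi>_surj)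
    obtain n where "\<forall>i. f i \<in> L i n" using f(1) by (rule boundedE)
  note n = spec[OF this]
    have "pr d x = \<zero>\<^bsub>S\<^esub>" if "d \<ge> n" for d
      using n that f by (simp add: pr_\<Psi> A.deg_less_def \<Psi>_zero)
    moreover have "x = (\<Oplus>\<^bsub>S\<^esub>d\<in>{..<n}. pr d x)"
    proof -
      have "(\<Oplus>\<^bsub>S\<^esub>d\<in>{..<n}. pr d x) = \<Psi> (\<lambda>i. \<Oplus>\<^bsub>R i\<^esub>d\<in>{..<n}. c i d (f i))"
        using \<Psi>_finsum[of "{..<n}" "\<lambda>d i. c i d (f i)"] f by (simp add: pr_\<Psi> bounded_hcomp)
      also have "(\<lambda>i. \<Oplus>\<^bsub>R i\<^esub>d\<in>{..<n}. c i d (f i)) = f"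
        using A.deg_less_sum[OF n] by (simp add: fun_eq_iff)
      finally show ?thesis using f(2) by simp
    qed
    ultimately show ?thesis by blast
  qed
qed

sublocale S: graded S P
  by unfold_locales (rule graded_S)

lemma hcomp_\<Psi>: "f \<in> bounded \<Longrightarrow> S.hcomp d (\<Psi> f) = \<Psi> (\<lambda>i. c i d (f i))"
proof -
  assume f: "f \<in> bounded"
  then obtain n where "\<forall>i. f i \<in> L i n" by (rule boundedE)
  note n = spec[OF this]
  have "\<Psi> f = (\<Oplus>\<^bsub>S\<^esub>d\<in>{..<n}. \<Psi> (\<lambda>i. c i d (f i)))"
    using \<Psi>_finsum[of "{..<n}" "\<lambda>d i. c i d (f i)"] f A.deg_less_sum[OF n, symmetric]
    by (simp add: bounded_hcomp)
  moreover have "S.hcomp d (\<Oplus>\<^bsub>S\<^esub>d\<in>{..<n}. \<Psi> (\<lambda>i. c i d (f i))) = \<Psi> (\<lambda>i. c i d (f i))"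
  proof (rule S.hcomp_uniqueI)
    show "\<Psi> (\<lambda>i. c i d (f i)) \<in> P d" for d
      by (rule P_I) (rule A.hcomp_G[OF bounded_carrier[OF f]])
    show "\<Psi> (\<lambda>i. c i d (f i)) = \<zero>\<^bsub>S\<^esub>" if "d \<notin> {..<n}" for d
      using n that by (simp add: A.deg_less_def \<Psi>_zero)
  qed simp
  ultimately show ?thesis by simp
qed

lemma \<Psi>_deg_less: "(\<And>i. f i \<in> L i n) \<Longrightarrow> \<Psi> f \<in> S.deg_less n"
proof -
  assume f: "\<And>i. f i \<in> L i n"
  then have "f \<in> bounded" by (rule boundedI)
  then show ?thesis using f by (simp add: S.deg_less_def \<Psi>_carrier hcomp_\<Psi> A.deg_less_def \<Psi>_zero)
qed

text \<open>
  A nonzero class of degree \<open>0\<close> has representatives that are nonzero on a set of the ultrafilter;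
  invert them there.
\<close>
lemma subfield_S:
  assumes "\<And>i. subfield (G i 0) (R i)"
  shows "subfield (P 0) S"
proof (rule S.subfieldI_inverse)
  show "subring (P 0) S"
  proof (rule S.subringI)
    show "P 0 \<subseteq> carrier S" by (auto simp: graded_ultraproduct_piece_def)
  qed (use S.G_mult[of _ 0 _ 0] in \<open>auto simp: S.one_G S.G_neg S.G_add\<close>)
  show "\<one>\<^bsub>S\<^esub> \<noteq> \<zero>\<^bsub>S\<^esub>"
  proof
    assume "\<one>\<^bsub>S\<^esub> = \<zero>\<^bsub>S\<^esub>"
    then have "eventually (\<lambda>i. \<one>\<^bsub>R i\<^esub> = \<zero>\<^bsub>R i\<^esub>) U"
      using \<Psi>_eq_iff[OF bounded_one bounded_zero] by (simp add: \<Psi>_one \<Psi>_zero)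
    then have "eventually (\<lambda>i. False) U"
      by (rule eventually_mono) (use subfieldE(6)[OF assms] in blast)
    then show False using U_bot by (simp add: eventually_False)
  qed
  show "\<exists>y\<in>P 0. x \<otimes>\<^bsub>S\<^esub> y = \<one>\<^bsub>S\<^esub>" if x: "x \<in> P 0" "x \<noteq> \<zero>\<^bsub>S\<^esub>" for x
  proof -
    obtain f where f_all: "\<forall>i. f i \<in> G i 0" "x = \<Psi> f" using x(1) by (rule P_E)
    note f = spec[OF f_all(1)] f_all(2)
    define g where "g i = (if f i = \<zero>\<^bsub>R i\<^esub> then \<zero>\<^bsub>R i\<^esub> else inv\<^bsub>R i\<^esub> (f i))" for i
    have fg: "g i \<in> G i 0 \<and> (f i \<noteq> \<zero>\<^bsub>R i\<^esub> \<longrightarrow> f i \<otimes>\<^bsub>R i\<^esub> g i = \<one>\<^bsub>R i\<^esub>)" for i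
      using A.subfield_m_inv[OF assms, of "f i"] f(1) by (auto simp: g_def A.zero_G)
    have "\<not> eventually (\<lambda>i. f i = \<zero>\<^bsub>R i\<^esub>) U"
      using \<Psi>_eq_iff[OF bounded_hom[OF f(1)] bounded_zero] x(2) f(2) by (simp add: \<Psi>_zero)
    then have "eventually (\<lambda>i. f i \<noteq> \<zero>\<^bsub>R i\<^esub>) U" using ev_or by blast
    then have "eventually (\<lambda>i. f i \<otimes>\<^bsub>R i\<^esub> g i = \<one>\<^bsub>R i\<^esub>) U"
      by (rule eventually_mono) (use fg in blast)
    moreover have b: "f \<in> bounded" "g \<in> bounded" using f(1) fg by (auto intro: bounded_hom)
    ultimately have "\<Psi> f \<otimes>\<^bsub>S\<^esub> \<Psi> g = \<one>\<^bsub>S\<^esub>"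
      by (simp add: \<Psi>_mult \<Psi>_one[symmetric] \<Psi>_eq_iff bounded_mult bounded_one)
    moreover have "\<Psi> g \<in> P 0" using fg by (intro P_I) simp
    ultimately show ?thesis using f(2) by blast
  qed
qed

definition rep :: "(nat \<Rightarrow> ('i \<Rightarrow> 'b) set) \<Rightarrow> 'i \<Rightarrow> 'b" where
  "rep x = (SOME f. f \<in> bounded \<and> x = \<Psi> f)"

lemma rep:
  assumes "x \<in> carrier S" shows "rep x \<in> bounded \<and> x = \<Psi> (rep x)"
proof -
  obtain f where "f \<in> bounded" "x = \<Psi> f" using assms by (rule \<Psi>_surj)
  then have "\<exists>f. f \<in> bounded \<and> x = \<Psi> f" by (intro exI conjI)
  then show ?thesis unfolding rep_def by (rule someI_ex)
qed

text \<open>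
  Choose one map for each index, and let these choices act on representatives. This is compatible
  with the ultraproduct because the maps do not raise degrees, so that bounded families remain
  bounded. If \<open>f\<close> represents a nonzero class of positive degree, then for almost every index some
  map moves \<open>f i\<close>, and choosing these maps moves the class.
\<close>
lemma lowering_S:
  assumes \<Gamma>: "\<And>i. lowering (R i) (G i) (\<Gamma> i)" and ne: "\<And>i. \<Gamma> i \<noteq> {}"
  shows "lowering S P {\<lambda>x. \<Psi> (\<lambda>i. J i (rep x i)) |J. \<forall>i. J i \<in> \<Gamma> i}"
proof -
  let ?T = "\<lambda>J x. \<Psi> (\<lambda>i. J i (rep x i))"
  note low = lowering_hom[OF \<Gamma>] lowering_lower[OF \<Gamma>]
  have JG: "J x \<in> L i (Suc d)" if "J \<in> \<Gamma> i" "x \<in> G i d" for J i x d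
  proof -
    have x: "x \<in> carrier (R i)" "J x \<in> carrier (R i)"
      using A.G_carrier[OF that(2)] ring_hom_closed[OF low(1)[OF that(1)]] by auto
    have "(J x \<ominus>\<^bsub>R i\<^esub> x) \<oplus>\<^bsub>R i\<^esub> x \<in> L i (Suc d)"
      using A.deg_less_mono[OF low(2)[OF that], of "Suc d"] A.deg_less_hom[OF that(2), of "Suc d"] by (intro A.deg_less_add) simp_all
    then show ?thesis using x by (simp add: A.minus_eq A.a_assoc A.l_neg)
  qed
  have JF: "J x \<in> L i n" if J: "J \<in> \<Gamma> i" and x: "x \<in> L i n" for J i x n
  proof -
    interpret J: ring_hom_cring "R i" "R i" J
      using low(1)[OF J] A.is_cring by (simp add: ring_hom_cring_def ring_hom_cring_axioms_def)
    have xR: "x \<in> carrier (R i)" using x by (rule A.deg_less_carrier)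
    have "J x = J (\<Oplus>\<^bsub>R i\<^esub>d\<in>{..<n}. c i d x)" using A.deg_less_sum[OF x] by simp
    also have "\<dots> = (\<Oplus>\<^bsub>R i\<^esub>d\<in>{..<n}. J (c i d x))"
      using J.hom_finsum[of "\<lambda>d. c i d x" "{..<n}"] xR by (simp add: A.hcomp_closed o_def)
    also have "\<dots> \<in> L i n"
    proof (intro A.deg_less_finsum Pi_I)
      fix d assume "d \<in> {..<n}"
      then show "J (c i d x) \<in> L i n"
        using A.deg_less_mono[OF JG[OF J A.hcomp_G[OF xR]], of d n] by simp
    qed simp
    finally show ?thesis .
  qed
  have bddJ: "(\<lambda>i. J i (f i)) \<in> bounded" if "f \<in> bounded" "\<forall>i. J i \<in> \<Gamma> i" for J f
  proof -
    obtain n where "\<forall>i. f i \<in> L i n" using \<open>f \<in> bounded\<close> by (rule boundedE)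
  note n = spec[OF this]
    show ?thesis by (rule boundedI[of _ n]) (rule JF[OF spec[OF that(2)] n])
  qed
  have T: "?T J (\<Psi> f) = \<Psi> (\<lambda>i. J i (f i))" if "f \<in> bounded" "\<forall>i. J i \<in> \<Gamma> i" for J f
  proof -
    have r: "rep (\<Psi> f) \<in> bounded" "\<Psi> f = \<Psi> (rep (\<Psi> f))" using rep[OF \<Psi>_carrier[OF that(1)]] by auto
    then have "eventually (\<lambda>i. rep (\<Psi> f) i = f i) U"
      using \<Psi>_eq_iff[OF r(1) that(1)] by simp
    then have "eventually (\<lambda>i. J i (rep (\<Psi> f) i) = J i (f i)) U"
      by (rule eventually_mono) simp
    then show ?thesis
      using \<Psi>_eq_iff[OF bddJ[OF r(1) that(2)] bddJ[OF that]] by (rule iffD2[rotated])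
  qed
  have hom: "?T J \<in> ring_hom S S" if J: "\<forall>i. J i \<in> \<Gamma> i" for J
  proof (rule ring_hom_memI)
    have Ji: "J i \<in> ring_hom (R i) (R i)" for i using low(1)[OF spec[OF J]] .
    fix x assume x: "x \<in> carrier S"
    then obtain f where f: "f \<in> bounded" "x = \<Psi> f" by (rule \<Psi>_surj)
    show "?T J x \<in> carrier S" using T[OF f(1) J] f(2) \<Psi>_carrier[OF bddJ[OF f(1) J]] by simp
    fix y assume y: "y \<in> carrier S"
    then obtain g where g: "g \<in> bounded" "y = \<Psi> g" by (rule \<Psi>_surj)
    show "?T J (x \<otimes>\<^bsub>S\<^esub> y) = ?T J x \<otimes>\<^bsub>S\<^esub> ?T J y"
      unfolding f(2) g(2)
      by (simp add: \<Psi>_mult T J f(1) g(1) bddJ bounded_mult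
          ring_hom_mult[OF Ji bounded_carrier[OF f(1)] bounded_carrier[OF g(1)]])
    show "?T J (x \<oplus>\<^bsub>S\<^esub> y) = ?T J x \<oplus>\<^bsub>S\<^esub> ?T J y"
      unfolding f(2) g(2)
      by (simp add: \<Psi>_add T J f(1) g(1) bddJ bounded_add
          ring_hom_add[OF Ji bounded_carrier[OF f(1)] bounded_carrier[OF g(1)]])
  next
    have Ji: "J i \<in> ring_hom (R i) (R i)" for i using low(1)[OF spec[OF J]] .
    show "?T J \<one>\<^bsub>S\<^esub> = \<one>\<^bsub>S\<^esub>"
      using T[OF bounded_one J] ring_hom_one[OF Ji] by (simp add: \<Psi>_one)
  qed
  have lower: "?T J x \<ominus>\<^bsub>S\<^esub> x \<in> S.deg_less d" if J: "\<forall>i. J i \<in> \<Gamma> i" and x: "x \<in> P d" for J d x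
  proof -
    obtain f where f_all: "\<forall>i. f i \<in> G i d" "x = \<Psi> f" using x by (rule P_E)
    note f = spec[OF f_all(1)] f_all(2)
    then have b: "f \<in> bounded" by (auto intro: bounded_hom)
    have "?T J x \<ominus>\<^bsub>S\<^esub> x = \<Psi> (\<lambda>i. J i (f i) \<ominus>\<^bsub>R i\<^esub> f i)"
      unfolding f(2) T[OF b J] by (rule \<Psi>_minus[OF bddJ[OF b J] b])
    moreover have "\<Psi> (\<lambda>i. J i (f i) \<ominus>\<^bsub>R i\<^esub> f i) \<in> S.deg_less d"
      by (rule \<Psi>_deg_less) (rule low(2)[OF spec[OF J] f(1)])
    ultimately show ?thesis by simp
  qed
  have detect: "x = \<zero>\<^bsub>S\<^esub>" if d: "0 < d" "x \<in> P d" and fixed: "\<And>J. \<forall>i. J i \<in> \<Gamma> i \<Longrightarrow> ?T J x = x" for d x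
  proof (rule ccontr)
    assume nz: "x \<noteq> \<zero>\<^bsub>S\<^esub>"
    obtain f where f_all: "\<forall>i. f i \<in> G i d" "x = \<Psi> f" using d(2) by (rule P_E)
    note f = spec[OF f_all(1)] f_all(2)
    have b: "f \<in> bounded" using f(1) by (rule bounded_hom)
    have "\<not> eventually (\<lambda>i. f i = \<zero>\<^bsub>R i\<^esub>) U"
      using \<Psi>_eq_iff[OF b bounded_zero] nz f(2) by (simp add: \<Psi>_zero)
    then have ev: "eventually (\<lambda>i. f i \<noteq> \<zero>\<^bsub>R i\<^esub>) U" using ev_or by blast
    have "\<exists>\<tau>. \<tau> \<in> \<Gamma> i \<and> (f i \<noteq> \<zero>\<^bsub>R i\<^esub> \<longrightarrow> \<tau> (f i) \<noteq> f i)" for i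
    proof (cases "\<forall>\<tau>\<in>\<Gamma> i. \<tau> (f i) = f i")
      case True
      then have "f i = \<zero>\<^bsub>R i\<^esub>" by (intro lowering_detect[OF \<Gamma> f(1)[of i] d(1)]) simp
      then show ?thesis using ne[of i] by auto
    qed auto
    then have "\<exists>J. \<forall>i. J i \<in> \<Gamma> i \<and> (f i \<noteq> \<zero>\<^bsub>R i\<^esub> \<longrightarrow> J i (f i) \<noteq> f i)"
      by (intro choice allI)
    then obtain J where "\<forall>i. J i \<in> \<Gamma> i \<and> (f i \<noteq> \<zero>\<^bsub>R i\<^esub> \<longrightarrow> J i (f i) \<noteq> f i)" ..
    then have J: "\<forall>i. J i \<in> \<Gamma> i" "\<And>i. f i \<noteq> \<zero>\<^bsub>R i\<^esub> \<Longrightarrow> J i (f i) \<noteq> f i"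
      by simp_all
    have "\<Psi> (\<lambda>i. J i (f i)) = \<Psi> f"
      using fixed[OF J(1)] T[OF b J(1)] f(2) by simp
    then have "eventually (\<lambda>i. J i (f i) = f i) U"
      using \<Psi>_eq_iff[OF bddJ[OF b J(1)] b] by simp
    then have "eventually (\<lambda>i. False) U"
      using ev by eventually_elim (simp add: J(2))
    then show False using U_bot by (simp add: eventually_False)
  qed
  show ?thesis
    unfolding lowering_def
  proof (intro conjI ballI allI impI)
    fix \<tau> assume "\<tau> \<in> {\<lambda>x. \<Psi> (\<lambda>i. J i (rep x i)) |J. \<forall>i. J i \<in> \<Gamma> i}"
    then obtain J where J: "\<tau> = ?T J" "\<forall>i. J i \<in> \<Gamma> i" by (elim CollectE exE conjE)
    show "\<tau> \<in> ring_hom S S" unfolding J(1) by (rule hom[OF J(2)])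
    show "\<tau> x \<ominus>\<^bsub>S\<^esub> x \<in> S.deg_less d" if "x \<in> P d" for x d
      unfolding J(1) by (rule lower[OF J(2) that])
  next
    fix d :: nat and x
    assume x: "0 < d" "x \<in> P d" "\<forall>\<tau>\<in>{\<lambda>x. \<Psi> (\<lambda>i. J i (rep x i)) |J. \<forall>i. J i \<in> \<Gamma> i}. \<tau> x = x"
    show "x = \<zero>\<^bsub>S\<^esub>"
    proof (rule detect[OF x(1,2)])
      fix J assume "\<forall>i. J i \<in> \<Gamma> i"
      then have "?T J \<in> {\<lambda>x. \<Psi> (\<lambda>i. J i (rep x i)) |J. \<forall>i. J i \<in> \<Gamma> i}" by (intro CollectI exI[of _ J] conjI refl)
      from bspec[OF x(3) this] show "?T J x = x" .
    qed
  qed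
qed

end

section \<open>Polynomial rings and the substitution of a variable increased by one\<close>

lemma finite_submultisets: "finite {a. a \<subseteq># (m :: 'v multiset)}"
proof (induction m)
  case (add x m)
  have "{a. a \<subseteq># add_mset x m} \<subseteq> {a. a \<subseteq># m} \<union> add_mset x ` {a. a \<subseteq># m}"
  proof
    fix a assume a: "a \<in> {a. a \<subseteq># add_mset x m}"
    show "a \<in> {a. a \<subseteq># m} \<union> add_mset x ` {a. a \<subseteq># m}"
    proof (cases "x \<in># a")
      case True
      then have "a = add_mset x (a - {#x#})" by simp
      moreover have "a - {#x#} \<subseteq># m" using a by (simp add: subset_eq_diff_conv)
      ultimately show ?thesis by blast
    next
      case False
      then have "count a y \<le> count m y" for y
        using a by (cases "y = x") (auto simp: subseteq_mset_def not_in_iff dest!: spec[of _ y])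
      then have "a \<subseteq># m" by (rule mset_subset_eqI)
      then show ?thesis by blast
    qed
  qed
  then show ?case using add by (simp add: finite_subset)
qed simp

lemma diff_diff_submultiset: "a \<subseteq># m \<Longrightarrow> m - (m - a) = a"
  by (simp add: multiset_eq_iff subseteq_mset_def)

context cring
begin

abbreviation PP :: "(nat multiset \<Rightarrow> 'a) set" where
  "PP \<equiv> indexed_pset UNIV (carrier R)"

abbreviation PR :: "(nat multiset \<Rightarrow> 'a) ring" where
  "PR \<equiv> indexed_poly_ring R UNIV"

abbreviation pmul :: "(nat multiset \<Rightarrow> 'a) \<Rightarrow> (nat multiset \<Rightarrow> 'a) \<Rightarrow> (nat multiset \<Rightarrow> 'a)" where
  "pmul \<equiv> indexed_mult R"

lemma PR_simps:
  "carrier PR = PP" "monoid.mult PR = pmul" "one PR = indexed_const \<one>"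
  "ring.zero PR = indexed_const \<zero>" "ring.add PR = indexed_padd"
  by (simp_all add: indexed_poly_ring_def)

lemma PP_iff: "p \<in> PP \<longleftrightarrow> (\<forall>m. p m \<in> carrier R) \<and> finite {m. p m \<noteq> \<zero>}"
  using indexed_pset_iff[OF carrier_is_subring, of p UNIV] by simp

lemma PP_coeff: "p \<in> PP \<Longrightarrow> p m \<in> carrier R"
  by (simp add: PP_iff)

lemma PP_finite: "p \<in> PP \<Longrightarrow> finite {m. p m \<noteq> \<zero>}"
  by (simp add: PP_iff)

lemma pmul_closed:
  assumes "p \<in> PP" "q \<in> PP" shows "pmul p q \<in> PP"
proof -
  note coeffs = PP_coeff[OF assms(1)] PP_coeff[OF assms(2)]
  have "{m. pmul p q m \<noteq> \<zero>} \<subseteq> (\<lambda>(a, b). a + b) ` ({m. p m \<noteq> \<zero>} \<times> {m. q m \<noteq> \<zero>})"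
  proof
    fix m assume "m \<in> {m. pmul p q m \<noteq> \<zero>}"
    then have nz: "(\<Oplus>a\<in>{a. a \<subseteq># m}. p a \<otimes> q (m - a)) \<noteq> \<zero>" by (simp add: indexed_mult_def)
    have "\<exists>a. a \<subseteq># m \<and> p a \<otimes> q (m - a) \<noteq> \<zero>"
    proof (rule ccontr)
      assume "\<not> (\<exists>a. a \<subseteq># m \<and> p a \<otimes> q (m - a) \<noteq> \<zero>)"
      then have "(\<Oplus>a\<in>{a. a \<subseteq># m}. p a \<otimes> q (m - a)) = \<zero>"
        by (intro add.finprod_one_eqI) blast
      then show False using nz by simp
    qed
    then obtain a where a: "a \<subseteq># m" "p a \<otimes> q (m - a) \<noteq> \<zero>" by blast
    then have "p a \<noteq> \<zero>" "q (m - a) \<noteq> \<zero>" using coeffs by (intro notI; simp)+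
    moreover have "m = a + (m - a)" using a(1) by simp
    ultimately show "m \<in> (\<lambda>(a, b). a + b) ` ({m. p m \<noteq> \<zero>} \<times> {m. q m \<noteq> \<zero>})" by force
  qed
  moreover have "finite ({m. p m \<noteq> \<zero>} \<times> {m. q m \<noteq> \<zero>})"
    using assms by (intro finite_cartesian_product PP_finite)
  ultimately have "finite {m. pmul p q m \<noteq> \<zero>}" by (meson finite_imageI finite_subset)
  moreover have "pmul p q m \<in> carrier R" for m
    unfolding indexed_mult_def using coeffs by (intro finsum_closed) auto
  ultimately show ?thesis by (simp add: PP_iff)
qed

lemma pmul_comm:
  fixes p q :: "nat multiset \<Rightarrow> 'a"
  assumes "p \<in> PP" "q \<in> PP" shows "pmul p q = pmul q p"
proof
  fix m :: "nat multiset"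
  note coeffs = PP_coeff[OF assms(1)] PP_coeff[OF assms(2)]
  have "inj_on (\<lambda>a. m - a) {a. a \<subseteq># m}"
    by (rule inj_on_inverseI[of _ "\<lambda>a. m - a"]) (simp add: diff_diff_submultiset)
  moreover have "(\<lambda>a. m - a) ` {a. a \<subseteq># m} = {a. a \<subseteq># m}"
  proof
    show "{a. a \<subseteq># m} \<subseteq> (\<lambda>a. m - a) ` {a. a \<subseteq># m}"
    proof
      fix a assume "a \<in> {a. a \<subseteq># m}"
      then show "a \<in> (\<lambda>a. m - a) ` {a. a \<subseteq># m}"
        by (intro image_eqI[of _ _ "m - a"]) (simp_all add: diff_diff_submultiset)
    qed
  qed auto
  ultimately have "pmul q p m = (\<Oplus>a\<in>{a. a \<subseteq># m}. q (m - a) \<otimes> p (m - (m - a)))"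
    unfolding indexed_mult_def
    using finsum_reindex[of "\<lambda>a. q a \<otimes> p (m - a)" "\<lambda>a. m - a" "{a. a \<subseteq># m}"] coeffs by simp
  also have "\<dots> = (\<Oplus>a\<in>{a. a \<subseteq># m}. p a \<otimes> q (m - a))"
  proof (rule finsum_cong'[OF refl])
    fix a assume "a \<in> {a. a \<subseteq># m}"
    then have "m - (m - a) = a" by (simp add: diff_diff_submultiset)
    then show "q (m - a) \<otimes> p (m - (m - a)) = p a \<otimes> q (m - a)" using coeffs by (simp add: m_comm)
  qed (use coeffs in simp)
  finally show "pmul p q m = pmul q p m" by (simp add: indexed_mult_def)
qed

lemma padd_closed: "p \<in> PP \<Longrightarrow> q \<in> PP \<Longrightarrow> indexed_padd p q \<in> PP"
  by (rule indexed_pset.indexed_padd)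

lemma pmult_closed: "p \<in> PP \<Longrightarrow> indexed_pmult p i \<in> PP"
  by (rule indexed_pset.indexed_pmult) simp_all

lemma const_closed: "k \<in> carrier R \<Longrightarrow> indexed_const k \<in> PP"
  by (rule indexed_pset.indexed_const)

lemma pmul_padd:
  assumes "p \<in> PP" "q \<in> PP" "r \<in> PP"
  shows "pmul (indexed_padd p q) r = indexed_padd (pmul p r) (pmul q r)"
proof
  fix m
  note coeffs = PP_coeff[OF assms(1)] PP_coeff[OF assms(2)] PP_coeff[OF assms(3)]
  have "pmul (indexed_padd p q) r m = (\<Oplus>a\<in>{a. a \<subseteq># m}. p a \<otimes> r (m - a) \<oplus> q a \<otimes> r (m - a))"
    unfolding indexed_mult_def indexed_padd_def using coeffs by (simp add: l_distr)
  also have "\<dots> = indexed_padd (pmul p r) (pmul q r) m"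
    unfolding indexed_mult_def indexed_padd_def using coeffs by (intro finsum_addf) auto
  finally show "pmul (indexed_padd p q) r m = indexed_padd (pmul p r) (pmul q r) m" .
qed

lemma pmul_const:
  assumes "k \<in> carrier R" "p \<in> PP"
  shows "pmul (indexed_const k) p = (\<lambda>m. k \<otimes> p m)"
proof
  fix m
  note coeffs = PP_coeff[OF assms(2)]
  have "pmul (indexed_const k) p m = (\<Oplus>a\<in>{a. a \<subseteq># m}. if {#} = a then k \<otimes> p (m - a) else \<zero>)"
    unfolding indexed_mult_def using coeffs assms(1)
    by (intro finsum_cong'[OF refl]) (auto simp: indexed_const_def)
  also have "\<dots> = k \<otimes> p (m - {#})"
    using coeffs assms(1) by (intro finsum_singleton finite_submultisets) auto
  finally show "pmul (indexed_const k) p m = k \<otimes> p m" by simp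
qed

lemma pmul_pmult:
  assumes "p \<in> PP" "q \<in> PP"
  shows "pmul (indexed_pmult p i) q = indexed_pmult (pmul p q) i"
proof
  fix m
  note coeffs = PP_coeff[OF assms(1)] PP_coeff[OF assms(2)] PP_coeff[OF pmult_closed[OF assms(1), of i]]
  show "pmul (indexed_pmult p i) q m = indexed_pmult (pmul p q) i m"
  proof (cases "i \<in># m")
    case False
    then have "i \<notin># a" if "a \<subseteq># m" for a using mset_subset_eqD[OF that] by blast
    then have "(\<Oplus>a\<in>{a. a \<subseteq># m}. indexed_pmult p i a \<otimes> q (m - a)) = \<zero>"
      using coeffs by (intro add.finprod_one_eqI) (auto simp: indexed_pmult_def)
    then show ?thesis using False by (simp add: indexed_mult_def indexed_pmult_def)
  next
    case True
    then obtain n where n: "m = add_mset i n" by (metis mset_add)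
    have "(\<Oplus>a\<in>{a. a \<subseteq># m}. indexed_pmult p i a \<otimes> q (m - a)) =
        (\<Oplus>a\<in>add_mset i ` {a. a \<subseteq># n}. indexed_pmult p i a \<otimes> q (m - a))"
    proof (rule add.finprod_mono_neutral_cong_right[OF finite_submultisets])
      show "add_mset i ` {a. a \<subseteq># n} \<subseteq> {a. a \<subseteq># m}" by (auto simp: n)
      show "indexed_pmult p i a \<otimes> q (m - a) = \<zero>"
        if a: "a \<in> {a. a \<subseteq># m} - add_mset i ` {a. a \<subseteq># n}" for a
      proof -
        have "i \<notin># a"
        proof
          assume "i \<in># a"
          then obtain b where b: "a = add_mset i b" by (metis mset_add)
          then have "b \<subseteq># n" using a by (simp add: n)
          then show False using a b by blast
        qed
        then show ?thesis using coeffs by (simp add: indexed_pmult_def)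
      qed
    qed (use coeffs in simp_all)
    also have "\<dots> = (\<Oplus>a\<in>{a. a \<subseteq># n}. indexed_pmult p i (add_mset i a) \<otimes> q (m - add_mset i a))"
      using coeffs by (intro finsum_reindex) (auto simp: inj_on_def)
    also have "\<dots> = (\<Oplus>a\<in>{a. a \<subseteq># n}. p a \<otimes> q (n - a))"
      by (simp add: indexed_pmult_def n)
    finally show ?thesis by (simp add: indexed_mult_def indexed_pmult_def n)
  qed
qed

text \<open>
  Polynomials are generated from constants by addition and multiplication by a variable. Identities
  that are linear in one factor can be proved by induction on it, which avoids triple convolution
  sums.
\<close>
lemma pmul_assoc:
  assumes "p \<in> PP" "q \<in> PP" "r \<in> PP"
  shows "pmul (pmul p q) r = pmul p (pmul q r)"
  using assms
proof (induction p rule: indexed_pset.induct)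
  case (indexed_const k)
  note coeffs = PP_coeff[OF indexed_const(2)] PP_coeff[OF indexed_const(3)]
  have kq: "(\<lambda>m. k \<otimes> q m) \<in> PP"
    using pmul_closed[OF const_closed[OF indexed_const(1)] indexed_const(2)] indexed_const
    by (simp add: pmul_const)
  have "pmul (\<lambda>m. k \<otimes> q m) r m = k \<otimes> pmul q r m" for m
    unfolding indexed_mult_def using coeffs indexed_const(1)
    by (simp add: finsum_rdistr[OF finite_submultisets] m_assoc)
  then show ?case
    using indexed_const pmul_closed[OF indexed_const(2,3)] by (simp add: pmul_const fun_eq_iff)
next
  case (indexed_padd P Q)
  then show ?case by (simp add: pmul_padd pmul_closed)
next
  case (indexed_pmult P i)
  then show ?case by (simp add: pmul_pmult pmul_closed)
qed

lemma PR_cring: "cring PR"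
proof (rule cringI)
  show "abelian_group PR"
  proof (rule abelian_groupI; unfold PR_simps)
    show "indexed_const \<zero> \<in> PP" by (rule const_closed) simp
    fix x y assume x: "x \<in> PP" and y: "y \<in> PP"
    show "indexed_padd x y \<in> PP" using x y by (rule padd_closed)
    show "indexed_padd x y = indexed_padd y x"
      using PP_coeff[OF x] PP_coeff[OF y] by (simp add: indexed_padd_def a_comm)
    fix z assume z: "z \<in> PP"
    show "indexed_padd (indexed_padd x y) z = indexed_padd x (indexed_padd y z)"
      using PP_coeff[OF x] PP_coeff[OF y] PP_coeff[OF z] by (simp add: indexed_padd_def a_assoc)
  next
    fix x assume x: "x \<in> PP"
    show "indexed_padd (indexed_const \<zero>) x = x"
      using PP_coeff[OF x] by (simp add: indexed_padd_def indexed_const_def)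
    have "{m. \<ominus> x m \<noteq> \<zero>} \<subseteq> {m. x m \<noteq> \<zero>}" by auto
    then have "(\<lambda>m. \<ominus> x m) \<in> PP"
      using x by (auto simp: PP_iff intro: finite_subset)
    moreover have "indexed_padd (\<lambda>m. \<ominus> x m) x = indexed_const \<zero>"
      using PP_coeff[OF x] by (simp add: indexed_padd_def indexed_const_def l_neg)
    ultimately show "\<exists>y\<in>PP. indexed_padd y x = indexed_const \<zero>" by blast
  qed
  show "comm_monoid PR"
  proof (rule comm_monoidI; unfold PR_simps)
    show "indexed_const \<one> \<in> PP" by (rule const_closed) simp
    show "pmul (indexed_const \<one>) x = x" if "x \<in> PP" for x
      using PP_coeff[OF that] by (simp add: pmul_const that)
    fix x y assume x: "x \<in> PP" and y: "y \<in> PP"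
    show "pmul x y \<in> PP" by (rule pmul_closed[OF x y])
    show "pmul x y = pmul y x" by (rule pmul_comm[OF x y])
    show "pmul (pmul x y) z = pmul x (pmul y z)" if "z \<in> PP" for z
      by (rule pmul_assoc[OF x y that])
  qed
  show "(x \<oplus>\<^bsub>PR\<^esub> y) \<otimes>\<^bsub>PR\<^esub> z = x \<otimes>\<^bsub>PR\<^esub> z \<oplus>\<^bsub>PR\<^esub> y \<otimes>\<^bsub>PR\<^esub> z"
    if "x \<in> carrier PR" "y \<in> carrier PR" "z \<in> carrier PR" for x y z
    using that by (simp add: PR_simps pmul_padd)
qed

abbreviation PG :: "nat \<Rightarrow> (nat multiset \<Rightarrow> 'a) set" where
  "PG \<equiv> std_homogeneous R UNIV"

lemma PG_iff: "p \<in> PG d \<longleftrightarrow> p \<in> PP \<and> (\<forall>m. p m \<noteq> \<zero> \<longrightarrow> size m = d)"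
  by (simp add: std_homogeneous_def PR_simps)

definition part :: "nat \<Rightarrow> (nat multiset \<Rightarrow> 'a) \<Rightarrow> nat multiset \<Rightarrow> 'a" where
  "part d p = (\<lambda>m. if size m = d then p m else \<zero>)"

lemma part_closed: "p \<in> PP \<Longrightarrow> part d p \<in> PG d"
proof -
  assume p: "p \<in> PP"
  have "{m. part d p m \<noteq> \<zero>} \<subseteq> {m. p m \<noteq> \<zero>}" by (auto simp: part_def)
  then have "part d p \<in> PP" using p by (auto simp: PP_iff part_def intro: finite_subset)
  then show ?thesis by (simp add: PG_iff part_def)
qed

lemma PR_finsum:
  assumes "finite A" "\<And>a. a \<in> A \<Longrightarrow> f a \<in> PP"
  shows "(\<Oplus>\<^bsub>PR\<^esub>a\<in>A. f a) m = (\<Oplus>a\<in>A. f a m)"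
proof -
  interpret P: cring PR by (rule PR_cring)
  show ?thesis
    using assms
  proof (induction A)
    case empty
    then show ?case by (simp add: PR_simps indexed_const_def)
  next
    case (insert a A)
    have "(\<Oplus>\<^bsub>PR\<^esub>a\<in>insert a A. f a) = indexed_padd (f a) (\<Oplus>\<^bsub>PR\<^esub>a\<in>A. f a)"
      using insert by (subst P.finsum_insert) (auto simp: PR_simps)
    moreover have "(\<Oplus>a\<in>insert a A. f a m) = f a m \<oplus> (\<Oplus>a\<in>A. f a m)"
      using insert PP_coeff by (intro finsum_insert) auto
    ultimately show ?case using insert by (simp add: indexed_padd_def)
  qed
qed

lemma sum_part:
  assumes p: "p \<in> PP" and small: "\<And>m. p m \<noteq> \<zero> \<Longrightarrow> size m < n"
  shows "(\<Oplus>\<^bsub>PR\<^esub>d\<in>{..<n}. part d p) = p"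
proof
  fix m
  have PP: "part d p \<in> PP" for d using part_closed[OF p, of d] unfolding PG_iff by (rule conjunct1)
  have "(\<Oplus>\<^bsub>PR\<^esub>d\<in>{..<n}. part d p) m = (\<Oplus>d\<in>{..<n}. part d p m)"
    using PP by (intro PR_finsum) simp_all
  also have "\<dots> = (\<Oplus>d\<in>{..<n}. if size m = d then p m else \<zero>)"
    by (simp only: part_def)
  also have "\<dots> = p m"
  proof (cases "size m < n")
    case True
    have "(\<Oplus>d\<in>{..<n}. if size m = d then (\<lambda>_. p m) d else \<zero>) = p m"
      using True PP_coeff[OF p] by (intro finsum_singleton) auto
    then show ?thesis by simp
  next
    case False
    then have "(\<Oplus>d\<in>{..<n}. if size m = d then p m else \<zero>) = \<zero>"
      by (intro add.finprod_one_eqI) auto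
    moreover have "p m = \<zero>" using False small[of m] by (rule contrapos_np)
    ultimately show ?thesis by simp
  qed
  finally show "(\<Oplus>\<^bsub>PR\<^esub>d\<in>{..<n}. part d p) m = p m" .
qed

lemma PG_mult:
  assumes "p \<in> PG d" "q \<in> PG e" shows "pmul p q \<in> PG (d + e)"
proof -
  have pq: "p \<in> PP" "q \<in> PP" using assms by (simp_all add: PG_iff)
  note coeffs = PP_coeff[OF pq(1)] PP_coeff[OF pq(2)]
  have "size m = d + e" if nz: "pmul p q m \<noteq> \<zero>" for m
  proof (rule ccontr)
    assume m: "size m \<noteq> d + e"
    have "p a \<otimes> q (m - a) = \<zero>" if "a \<subseteq># m" for a
    proof -
      have "size a + size (m - a) = size m"
        using that by (metis size_union subset_mset.add_diff_inverse)
      then have "p a = \<zero> \<or> q (m - a) = \<zero>"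
        using assms m by (auto simp: PG_iff)
      then show ?thesis using coeffs by auto
    qed
    then have "pmul p q m = \<zero>" unfolding indexed_mult_def by (intro add.finprod_one_eqI) simp
    then show False using nz by simp
  qed
  then show ?thesis using pmul_closed[OF pq] by (simp add: PG_iff)
qed

lemma PR_graded: "graded_ring PR PG"
proof (rule graded_ringI[OF PR_cring, of PG part])
  interpret P: cring PR by (rule PR_cring)
  have zero: "\<zero>\<^bsub>PR\<^esub> \<in> PG d" for d
    using const_closed[of \<zero>] by (simp add: PG_iff PR_simps) (simp add: indexed_const_def)
  have neg: "(\<ominus>\<^bsub>PR\<^esub> p) m = \<ominus> p m" if p: "p \<in> PP" for p m
  proof -
    have "\<ominus>\<^bsub>PR\<^esub> p \<in> PP" using P.a_inv_closed[of p] p by (simp add: PR_simps)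
    moreover have "indexed_padd (\<ominus>\<^bsub>PR\<^esub> p) p = indexed_const \<zero>"
      using P.l_neg[of p] p by (simp add: PR_simps)
    then have "(\<ominus>\<^bsub>PR\<^esub> p) m \<oplus> p m = \<zero>"
      by (simp add: indexed_padd_def indexed_const_def fun_eq_iff split: if_splits)
    ultimately show ?thesis
      using minus_equality[of "(\<ominus>\<^bsub>PR\<^esub> p) m" "p m"] PP_coeff[OF p] PP_coeff[of "\<ominus>\<^bsub>PR\<^esub> p"] by simp
  qed
  show "additive_subgroup (PG d) PR" for d
  proof (rule additive_subgroup.intro, rule P.add.subgroupI)
    show "PG d \<subseteq> carrier PR" by (auto simp: PG_iff PR_simps)
    show "PG d \<noteq> {}" using zero by blast
    show "\<ominus>\<^bsub>PR\<^esub> p \<in> PG d" if "p \<in> PG d" for p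
    proof -
      have p: "p \<in> PP" using that by (simp add: PG_iff)
      have "\<ominus>\<^bsub>PR\<^esub> p \<in> PP" using P.a_inv_closed[of p] p by (simp add: PR_simps)
      moreover have "p m \<noteq> \<zero>" if "(\<ominus>\<^bsub>PR\<^esub> p) m \<noteq> \<zero>" for m
        using that by (intro notI) (simp add: neg[OF p])
      ultimately show ?thesis using \<open>p \<in> PG d\<close> by (simp add: PG_iff)
    qed
    show "p \<oplus>\<^bsub>PR\<^esub> q \<in> PG d" if "p \<in> PG d" "q \<in> PG d" for p q
    proof -
      have "size m = d" if nz: "indexed_padd p q m \<noteq> \<zero>" for m
      proof -
        have "p m \<noteq> \<zero> \<or> q m \<noteq> \<zero>" using nz by (auto simp: indexed_padd_def)
        then show ?thesis using \<open>p \<in> PG d\<close> \<open>q \<in> PG d\<close> unfolding PG_iff by blast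
      qed
      then show ?thesis using that padd_closed by (simp add: PG_iff PR_simps)
    qed
  qed
  show "\<one>\<^bsub>PR\<^esub> \<in> PG 0"
    using const_closed[of \<one>] by (simp add: PG_iff PR_simps) (simp add: indexed_const_def)
  show "p \<otimes>\<^bsub>PR\<^esub> q \<in> PG (d + e)" if "p \<in> PG d" "q \<in> PG e" for p q d e
    using PG_mult[OF that] by (simp add: PR_simps)
  show "part d (p \<oplus>\<^bsub>PR\<^esub> q) = part d p \<oplus>\<^bsub>PR\<^esub> part d q" for d p q
    by (auto simp: PR_simps part_def indexed_padd_def fun_eq_iff)
  show "part d p \<in> PG d" if "p \<in> carrier PR" for d p
    using that by (simp add: PR_simps part_closed)
  show "part e p = (if e = d then p else \<zero>\<^bsub>PR\<^esub>)" if p: "p \<in> PG d" for d e p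
  proof
    fix m
    have "p m = \<zero> \<or> size m = d" using p unfolding PG_iff by blast
    then show "part e p m = (if e = d then p else \<zero>\<^bsub>PR\<^esub>) m"
      by (auto simp: part_def PR_simps indexed_const_def)
  qed
  show "\<exists>n. (\<forall>d\<ge>n. part d p = \<zero>\<^bsub>PR\<^esub>) \<and> p = (\<Oplus>\<^bsub>PR\<^esub>d\<in>{..<n}. part d p)" if "p \<in> carrier PR" for p
  proof -
    have p: "p \<in> PP" using that by (simp add: PR_simps)
    obtain n where n: "\<forall>s\<in>size ` {m. p m \<noteq> \<zero>}. s < n"
      using PP_finite[OF p] finite_nat_set_iff_bounded by blast
    then have small: "size m < n" if "p m \<noteq> \<zero>" for m using that by blast
    have "part d p = \<zero>\<^bsub>PR\<^esub>" if "d \<ge> n" for d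
      using small that by (fastforce simp: part_def PR_simps indexed_const_def)
    then show ?thesis using sum_part[OF p small] by (intro exI[of _ n]) simp
  qed
qed

text \<open>
  The substitution of \<open>x\<^sub>j + 1\<close> for \<open>x\<^sub>j\<close>, in terms of coefficients: the monomial
  \<open>m * x\<^sub>j ^ r\<close> contributes to \<open>m\<close> with the binomial coefficient with which \<open>m\<close> occurs in its
  image.
\<close>
definition shift :: "nat \<Rightarrow> (nat multiset \<Rightarrow> 'a) \<Rightarrow> nat multiset \<Rightarrow> 'a" where
  "shift j p m = (\<Oplus>r\<in>{r. p (m + replicate_mset r j) \<noteq> \<zero>}.
     add_pow R (count m j + r choose r) (p (m + replicate_mset r j)))"

lemma shift_superset:
  assumes p: "p \<in> PP" and Q: "finite Q" "\<And>r. p (m + replicate_mset r j) \<noteq> \<zero> \<Longrightarrow> r \<in> Q"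
  shows "shift j p m = (\<Oplus>r\<in>Q. add_pow R (count m j + r choose r) (p (m + replicate_mset r j)))"
  unfolding shift_def
proof (rule add.finprod_mono_neutral_cong_left[OF Q(1)])
  show "{r. p (m + replicate_mset r j) \<noteq> \<zero>} \<subseteq> Q" using Q(2) by (intro subsetI) simp
qed (use PP_coeff[OF p] in simp_all)

lemma ex_bound:
  assumes "p \<in> PP"
  obtains N where "\<And>m j r. N \<le> r \<Longrightarrow> p (m + replicate_mset r j) = \<zero>"
proof -
  obtain N where N: "\<forall>s\<in>size ` {m. p m \<noteq> \<zero>}. s < N"
    using PP_finite[OF assms] finite_nat_set_iff_bounded by blast
  have "p (m + replicate_mset r j) = \<zero>" if r: "N \<le> r" for m j r
  proof (rule ccontr)
    assume "p (m + replicate_mset r j) \<noteq> \<zero>"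
    then have "size (m + replicate_mset r j) < N" using N by blast
    then show False using r by simp
  qed
  then show ?thesis by (rule that)
qed

lemma shift_upto:
  assumes "p \<in> PP" "\<And>r. N < r \<Longrightarrow> p (m + replicate_mset r j) = \<zero>"
  shows "shift j p m = (\<Oplus>r\<in>{..N}. add_pow R (count m j + r choose r) (p (m + replicate_mset r j)))"
  using assms(2) by (intro shift_superset[OF assms(1)]) (auto simp: not_less[symmetric])

lemma shift_coeff: "p \<in> PP \<Longrightarrow> shift j p m \<in> carrier R"
  unfolding shift_def by (intro finsum_closed) (simp add: PP_coeff)

lemma shift_closed:
  assumes p: "p \<in> PP" shows "shift j p \<in> PP"
proof -
  have "{m. shift j p m \<noteq> \<zero>} \<subseteq> (\<Union>n\<in>{n. p n \<noteq> \<zero>}. {m. m \<subseteq># n})"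
  proof
    fix m assume m: "m \<in> {m. shift j p m \<noteq> \<zero>}"
    have "\<exists>r. p (m + replicate_mset r j) \<noteq> \<zero>"
    proof (rule ccontr)
      assume "\<not> (\<exists>r. p (m + replicate_mset r j) \<noteq> \<zero>)"
      then have "shift j p m = \<zero>" by (simp add: shift_def)
      then show False using m by simp
    qed
    then obtain r where "p (m + replicate_mset r j) \<noteq> \<zero>" ..
    then show "m \<in> (\<Union>n\<in>{n. p n \<noteq> \<zero>}. {m. m \<subseteq># n})"
      by (intro UN_I[of "m + replicate_mset r j"]) simp_all
  qed
  moreover have "finite (\<Union>n\<in>{n. p n \<noteq> \<zero>}. {m. m \<subseteq># n})"
    using PP_finite[OF p] finite_submultisets by (intro finite_UN_I)
  ultimately have "finite {m. shift j p m \<noteq> \<zero>}" by (rule finite_subset)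
  then show ?thesis using shift_coeff[OF p] by (simp add: PP_iff)
qed

lemma shift_padd:
  assumes p: "p \<in> PP" and q: "q \<in> PP"
  shows "shift j (indexed_padd p q) = indexed_padd (shift j p) (shift j q)"
proof
  fix m
  obtain N where N: "\<And>m j r. N \<le> r \<Longrightarrow> p (m + replicate_mset r j) = \<zero>" using ex_bound[OF p] by metis
  obtain L where L: "\<And>m j r. L \<le> r \<Longrightarrow> q (m + replicate_mset r j) = \<zero>" using ex_bound[OF q] by metis
  note coeffs = PP_coeff[OF p] PP_coeff[OF q]
  have "shift j (indexed_padd p q) m = (\<Oplus>r\<in>{..N + L}. add_pow R (count m j + r choose r) (indexed_padd p q (m + replicate_mset r j)))"
    by (rule shift_upto[OF padd_closed[OF p q]]) (simp add: indexed_padd_def N L)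
  also have "\<dots> = (\<Oplus>r\<in>{..N + L}. add_pow R (count m j + r choose r) (p (m + replicate_mset r j)) \<oplus>
      add_pow R (count m j + r choose r) (q (m + replicate_mset r j)))"
    using coeffs by (simp add: indexed_padd_def add.nat_pow_distrib)
  also have "\<dots> = (\<Oplus>r\<in>{..N + L}. add_pow R (count m j + r choose r) (p (m + replicate_mset r j))) \<oplus>
      (\<Oplus>r\<in>{..N + L}. add_pow R (count m j + r choose r) (q (m + replicate_mset r j)))"
    using coeffs by (intro finsum_addf) auto
  also have "\<dots> = shift j p m \<oplus> shift j q m"
    by (subst (1 2) shift_upto[of _ "N + L"]) (simp_all add: p q N L)
  finally show "shift j (indexed_padd p q) m = indexed_padd (shift j p) (shift j q) m"
    by (simp add: indexed_padd_def)
qed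

lemma shift_const_mult:
  assumes p: "p \<in> PP" and k: "k \<in> carrier R"
  shows "shift j (pmul (indexed_const k) p) = pmul (indexed_const k) (shift j p)"
proof
  fix m
  obtain N where N: "\<And>m j r. N \<le> r \<Longrightarrow> p (m + replicate_mset r j) = \<zero>" using ex_bound[OF p] by metis
  note coeffs = PP_coeff[OF p]
  have kp: "pmul (indexed_const k) p = (\<lambda>m. k \<otimes> p m)" by (rule pmul_const[OF k p])
  have "shift j (pmul (indexed_const k) p) m =
      (\<Oplus>r\<in>{..N}. add_pow R (count m j + r choose r) (pmul (indexed_const k) p (m + replicate_mset r j)))"
    by (rule shift_upto[OF pmul_closed[OF const_closed[OF k] p]]) (simp add: kp N k)
  also have "\<dots> = (\<Oplus>r\<in>{..N}. k \<otimes> add_pow R (count m j + r choose r) (p (m + replicate_mset r j)))"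
    unfolding kp using coeffs k by (intro finsum_cong'[OF refl] add_pow_rdistr[symmetric]) auto
  also have "\<dots> = k \<otimes> (\<Oplus>r\<in>{..N}. add_pow R (count m j + r choose r) (p (m + replicate_mset r j)))"
    using coeffs k by (intro finsum_rdistr[symmetric]) auto
  also have "\<dots> = k \<otimes> shift j p m"
    by (subst shift_upto[of _ N]) (simp_all add: p N)
  finally show "shift j (pmul (indexed_const k) p) m = pmul (indexed_const k) (shift j p) m"
    by (simp add: pmul_const[OF k shift_closed[OF p]])
qed

lemma shift_const:
  assumes k: "k \<in> carrier R" shows "shift j (indexed_const k) = indexed_const k"
proof
  fix m
  have "shift j (indexed_const k) m = (\<Oplus>r\<in>{..0}. add_pow R (count m j + r choose r) (indexed_const k (m + replicate_mset r j)))"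
    by (rule shift_upto[OF const_closed[OF k]]) (auto simp: indexed_const_def)
  also have "\<dots> = indexed_const k m" using k by (simp add: indexed_const_def)
  finally show "shift j (indexed_const k) m = indexed_const k m" .
qed

lemma shift_pmult_other:
  assumes p: "p \<in> PP" and ij: "i \<noteq> j"
  shows "shift j (indexed_pmult p i) = indexed_pmult (shift j p) i"
proof
  fix m
  have mem: "i \<in># m + replicate_mset r j \<longleftrightarrow> i \<in># m" for r using ij by auto
  show "shift j (indexed_pmult p i) m = indexed_pmult (shift j p) i m"
  proof (cases "i \<in># m")
    case False
    then have "indexed_pmult p i (m + replicate_mset r j) = \<zero>" for r
      using mem by (simp add: indexed_pmult_def)
    then show ?thesis using False by (simp add: shift_def indexed_pmult_def)
  next
    case True
    then obtain n where n: "m = add_mset i n" by (metis mset_add)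
    have "indexed_pmult p i (m + replicate_mset r j) = p (n + replicate_mset r j)" for r
      by (simp add: indexed_pmult_def n)
    moreover have "count m j = count n j" using ij by (simp add: n)
    ultimately show ?thesis by (simp add: shift_def indexed_pmult_def n)
  qed
qed

text \<open>
  Pascal's rule is the identity \<open>\<tau> (x\<^sub>j * p) = x\<^sub>j * \<tau> p + \<tau> p\<close>, coefficient by coefficient.
\<close>
lemma shift_pmult_same:
  assumes p: "p \<in> PP"
  shows "shift j (indexed_pmult p j) = indexed_padd (indexed_pmult (shift j p) j) (shift j p)"
proof
  fix m
  obtain N where N: "\<And>m j r. N \<le> r \<Longrightarrow> p (m + replicate_mset r j) = \<zero>" using ex_bound[OF p] by metis
  note coeffs = PP_coeff[OF p]
  show "shift j (indexed_pmult p j) m = indexed_padd (indexed_pmult (shift j p) j) (shift j p) m"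
  proof (cases "j \<in># m")
    case False
    have zero: "indexed_pmult p j m = \<zero>" using False by (simp add: indexed_pmult_def)
    have suc: "indexed_pmult p j (m + replicate_mset (Suc r) j) = p (m + replicate_mset r j)" for r
      by (simp add: indexed_pmult_def)
    have c0: "count m j = 0" using False by (simp add: not_in_iff)
    have "shift j (indexed_pmult p j) m =
        (\<Oplus>r\<in>{..Suc N}. indexed_pmult p j (m + replicate_mset r j))"
    proof (subst shift_upto[OF pmult_closed[OF p], of "Suc N"])
      show "indexed_pmult p j (m + replicate_mset r j) = \<zero>" if "Suc N < r" for r
        using that suc[of "r - 1"] N[of "r - 1" m j] by simp
    qed (simp add: c0 PP_coeff[OF pmult_closed[OF p]])
    also have "\<dots> = (\<Oplus>r\<in>{..N}. p (m + replicate_mset r j))"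
      using coeffs PP_coeff[OF pmult_closed[OF p]]
      by (subst finsum_Suc2) (simp_all only: Pi_I suc replicate_mset_0 add_0_right zero r_zero finsum_closed)
    also have "\<dots> = shift j p m"
      using coeffs by (subst shift_upto[OF p, of N]) (simp_all add: N c0)
    finally show ?thesis
      using False shift_coeff[OF p] by (simp add: indexed_padd_def indexed_pmult_def)
  next
    case True
    then obtain n where n: "m = add_mset j n" by (metis mset_add)
    let ?P = "\<lambda>r. p (n + replicate_mset r j)" and ?c = "count n j"
    have P0: "?P r = \<zero>" if "N < r" for r using that N[of r] by simp
    have PR: "?P r \<in> carrier R" for r by (rule coeffs)
    have 1: "shift j (indexed_pmult p j) m = (\<Oplus>r\<in>{..Suc N}. add_pow R (Suc (?c + r) choose r) (?P r))"
    proof (subst shift_upto[OF pmult_closed[OF p], of "Suc N"])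
      show "indexed_pmult p j (m + replicate_mset r j) = \<zero>" if "Suc N < r" for r
        using that P0[of r] by (simp add: indexed_pmult_def n)
    qed (simp add: indexed_pmult_def n)
    have 2: "shift j p n = (\<Oplus>r\<in>{..Suc N}. add_pow R (?c + r choose r) (?P r))"
      using P0 by (subst shift_upto[OF p, of "Suc N"]) simp_all
    let ?h = "\<lambda>r. if r = 0 then \<zero> else add_pow R (?c + r choose (r - 1)) (?P r)"
    have shift_m: "p (m + replicate_mset r j) = ?P (Suc r)" for r
      by (simp add: n)
    have "shift j p m = (\<Oplus>r\<in>{..N}. ?h (Suc r))"
    proof (subst shift_upto[OF p, of N])
      show "p (m + replicate_mset r j) = \<zero>" if "N < r" for r
        using that N[of r] by simp
    qed (simp only: shift_m, simp add: n)
    also have "\<dots> = (\<Oplus>r\<in>{..Suc N}. ?h r)"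
    proof -
      have "(\<Oplus>r\<in>{..Suc N}. ?h r) = (\<Oplus>r\<in>{..N}. ?h (Suc r)) \<oplus> ?h 0"
        using PR by (intro finsum_Suc2) simp
      moreover have "(\<Oplus>r\<in>{..N}. ?h (Suc r)) \<in> carrier R"
        using PR[of "Suc _"] by (intro finsum_closed) simp
      ultimately show ?thesis by simp
    qed
    finally have 3: "shift j p m = (\<Oplus>r\<in>{..Suc N}. ?h r)" .
    have "shift j p n \<oplus> shift j p m = (\<Oplus>r\<in>{..Suc N}. add_pow R (?c + r choose r) (?P r) \<oplus> ?h r)"
      unfolding 2 3 using PR by (intro finsum_addf[symmetric]) auto
    also have "\<dots> = (\<Oplus>r\<in>{..Suc N}. add_pow R (Suc (?c + r) choose r) (?P r))"
    proof (rule finsum_cong'[OF refl])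
      fix r
      show "add_pow R (?c + r choose r) (?P r) \<oplus> ?h r = add_pow R (Suc (?c + r) choose r) (?P r)"
      proof (cases r)
        case 0
        then show ?thesis using PR[of 0] by simp
      next
        case (Suc s)
        then show ?thesis using PR[of r] by (simp add: add.nat_pow_mult add.commute)
      qed
    qed (use PR in simp)
    finally have "shift j (indexed_pmult p j) m = shift j p n \<oplus> shift j p m" using 1 by simp
    then show ?thesis by (simp add: indexed_padd_def indexed_pmult_def n)
  qed
qed

lemma shift_mult:
  assumes "p \<in> PP" "q \<in> PP"
  shows "shift j (pmul p q) = pmul (shift j p) (shift j q)"
  using assms
proof (induction p rule: indexed_pset.induct)
  case (indexed_const k)
  then show ?case by (simp only: shift_const_mult shift_const)
next
  case (indexed_padd P Q)
  then show ?case by (simp only: pmul_padd shift_padd pmul_closed shift_closed)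
next
  case (indexed_pmult P i)
  note P = indexed_pmult.hyps(1) and q = indexed_pmult.prems
  note IH = indexed_pmult.IH[OF q]
  have sP: "shift j P \<in> PP" and sq: "shift j q \<in> PP" using P q by (simp_all only: shift_closed)
  have "shift j (pmul (indexed_pmult P i) q) = shift j (indexed_pmult (pmul P q) i)"
    by (simp only: pmul_pmult[OF P q])
  also have "\<dots> = pmul (shift j (indexed_pmult P i)) (shift j q)"
  proof (cases "i = j")
    case True
    then show ?thesis
      by (simp only: shift_pmult_same[OF P] shift_pmult_same[OF pmul_closed[OF P q]] IH
          pmul_padd[OF pmult_closed[OF sP] sP sq] pmul_pmult[OF sP sq])
  next
    case False
    then show ?thesis
      by (simp only: shift_pmult_other[OF P False] shift_pmult_other[OF pmul_closed[OF P q] False] IH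
          pmul_pmult[OF sP sq])
  qed
  finally show ?case .
qed

lemma shift_hom: "shift j \<in> ring_hom PR PR"
  by (rule ring_hom_memI)
    (simp_all only: PR_simps shift_closed shift_mult shift_padd shift_const one_closed)

lemma shift_lowers:
  assumes p: "p \<in> PG d" and nz: "shift j p m \<noteq> p m" shows "size m < d"
proof (rule ccontr)
  assume m: "\<not> size m < d"
  have pP: "p \<in> PP" using p by (simp add: PG_iff)
  have "p (m + replicate_mset r j) = \<zero>" if r: "0 < r" for r
  proof (rule ccontr)
    assume "p (m + replicate_mset r j) \<noteq> \<zero>"
    then have "size (m + replicate_mset r j) = d" using p unfolding PG_iff by blast
    then show False using m r by simp
  qed
  then have "shift j p m = (\<Oplus>r\<in>{..0}. add_pow R (count m j + r choose r) (p (m + replicate_mset r j)))"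
    by (rule shift_upto[OF pP])
  then show False using nz PP_coeff[OF pP] by simp
qed

text \<open>
  Let \<open>x\<^sub>j\<close> occur with exactly the exponent \<open>r > 0\<close> in a monomial \<open>m\<close> of \<open>p\<close>. The only term of
  degree \<open>d\<close> that contributes to the coefficient of \<open>m / x\<^sub>j ^ r\<close> in the image of \<open>p\<close> is \<open>m\<close>
  itself, with binomial coefficient \<open>1\<close>, whatever the characteristic. As \<open>p\<close> has no term of that
  lower degree, it is moved.
\<close>
lemma shift_detects:
  assumes p: "p \<in> PG d" and d: "0 < d" and fixed: "\<And>j. shift j p = p"
  shows "p = indexed_const \<zero>"
proof (rule ccontr)
  assume "p \<noteq> indexed_const \<zero>"
  then obtain m where m: "p m \<noteq> \<zero>" by (auto simp: indexed_const_def fun_eq_iff split: if_splits)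
  have pP: "p \<in> PP" using p by (simp add: PG_iff)
  have size: "size l = d" if "p l \<noteq> \<zero>" for l using p that unfolding PG_iff by blast
  have "m \<noteq> {#}" using size[OF m] d by auto
  then obtain j where j: "j \<in># m" by blast
  define n where "n = m - replicate_mset (count m j) j"
  have mn: "m = n + replicate_mset (count m j) j" and n0: "count n j = 0"
    by (simp_all add: n_def multiset_eq_iff)
  have size_mn: "size m = size n + count m j" using arg_cong[OF mn, of size] by simp
  have "shift j p n = (\<Oplus>r\<in>{count m j}. add_pow R (count n j + r choose r) (p (n + replicate_mset r j)))"
  proof (rule shift_superset[OF pP])
    fix r assume "p (n + replicate_mset r j) \<noteq> \<zero>"
    then have "size n + r = d" using size by fastforce
    then show "r \<in> {count m j}" using size_mn size[OF m] by simp
  qed simp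
  also have "\<dots> = p m"
    using n0 mn PP_coeff[OF pP]
      finsum_insert[of "{}" "count m j" "\<lambda>r. add_pow R (count n j + r choose r) (p (n + replicate_mset r j))"]
    by simp
  finally have "p n \<noteq> \<zero>" using m fixed[of j] by simp
  then have "size n = size m" using size m by simp
  then show False using size_mn j by (simp add: count_eq_zero_iff)
qed

lemma lowering_shift: "lowering PR PG (range shift)"
proof -
  interpret P: cring PR by (rule PR_cring)
  interpret P: graded PR PG by unfold_locales (rule PR_graded)
  show ?thesis
    unfolding lowering_def
  proof (intro conjI ballI allI impI)
    fix \<tau> assume "\<tau> \<in> range shift"
    then obtain j where \<tau>: "\<tau> = shift j" by blast
    show "\<tau> \<in> ring_hom PR PR" unfolding \<tau> by (rule shift_hom)
    fix d p assume p: "p \<in> PG d"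
    have pP: "p \<in> PP" using p by (simp add: PG_iff)
    define q where "q = \<tau> p \<ominus>\<^bsub>PR\<^esub> p"
    have sP: "\<tau> p \<in> PP" unfolding \<tau> by (rule shift_closed[OF pP])
    have qP: "q \<in> PP" using P.minus_closed[of "\<tau> p" p] pP sP by (simp add: q_def PR_simps)
    have "\<tau> p \<in> carrier PR" "p \<in> carrier PR" using pP sP by (simp_all only: PR_simps)
    then have "\<tau> p = q \<oplus>\<^bsub>PR\<^esub> p"
      by (simp add: q_def P.minus_eq P.a_assoc P.l_neg)
    then have eq: "\<tau> p m = q m \<oplus> p m" for m by (simp add: PR_simps indexed_padd_def)
    have small: "size m < d" if "q m \<noteq> \<zero>" for m
    proof (rule shift_lowers[OF p])
      show "shift j p m \<noteq> p m"
      proof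
        assume "shift j p m = p m"
        then have "q m \<oplus> p m = p m" using eq[of m] by (simp add: \<tau>)
        then have "q m = \<zero>" using PP_coeff[OF qP, of m] PP_coeff[OF pP, of m] by simp
        then show False using that by simp
      qed
    qed
    have "(\<Oplus>\<^bsub>PR\<^esub>e\<in>{..<d}. part e q) \<in> P.deg_less d"
      using part_closed[OF qP] by (intro P.deg_less_finsum Pi_I P.deg_less_hom) auto
    then show "\<tau> p \<ominus>\<^bsub>PR\<^esub> p \<in> P.deg_less d" using sum_part[OF qP small] by (simp add: q_def)
  next
    fix d :: nat and p
    assume "0 < d" "p \<in> PG d" "\<forall>\<tau>\<in>range shift. \<tau> p = p"
    then show "p = \<zero>\<^bsub>PR\<^esub>" using shift_detects[of p d] by (simp add: PR_simps)
  qed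
qed

end

lemma (in field) subfield_PG0: "subfield (PG 0) PR"
proof -
  interpret P: cring PR by (rule PR_cring)
  interpret P: graded PR PG by unfold_locales (rule PR_graded)
  have const: "p = indexed_const (p {#})" if "p \<in> PG 0" for p
    using that by (fastforce simp: PG_iff indexed_const_def fun_eq_iff)
  have const_G: "indexed_const c \<in> PG 0" if "c \<in> carrier R" for c
    using const_closed[OF that] by (simp add: PG_iff) (simp add: indexed_const_def)
  show ?thesis
  proof (rule P.subfieldI_inverse)
    show "subring (PG 0) PR"
      using P.G_mult[of _ 0 _ 0] P.G_carrier
      by (intro P.subringI) (auto simp: P.one_G P.G_neg P.G_add)
    have "indexed_const \<one> {#} \<noteq> indexed_const \<zero> {#}" by (simp add: indexed_const_def)
    then show "\<one>\<^bsub>PR\<^esub> \<noteq> \<zero>\<^bsub>PR\<^esub>" unfolding PR_simps by metis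
    fix p assume p: "p \<in> PG 0" "p \<noteq> \<zero>\<^bsub>PR\<^esub>"
    have c: "p {#} \<in> carrier R" using p(1) by (simp add: PG_iff PP_coeff)
    have "p {#} \<noteq> \<zero>" using const[OF p(1)] p(2) by (auto simp: PR_simps)
    then have inv: "inv (p {#}) \<in> carrier R" "p {#} \<otimes> inv (p {#}) = \<one>"
      using c field_Units by (auto simp: Units_r_inv)
    have "pmul p (indexed_const (inv (p {#}))) = pmul (indexed_const (p {#})) (indexed_const (inv (p {#})))"
      using const[OF p(1)] by simp
    also have "\<dots> = indexed_const \<one>"
      using c inv by (simp add: pmul_const const_closed) (simp add: indexed_const_def fun_eq_iff)
    finally show "\<exists>y\<in>PG 0. p \<otimes>\<^bsub>PR\<^esub> y = \<one>\<^bsub>PR\<^esub>"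
      using const_G[OF inv(1)] by (auto simp: PR_simps)
  qed
qed

section \<open>The graded ultraproduct of polynomial rings\<close>

theorem theorem6p17:
  fixes U :: "'i filter"
    and k :: "'i \<Rightarrow> ('a, 'm) ring_scheme"
  assumes "nonprincipal_ultrafilter U"
    and "\<And>i. field (k i)"
  shows "graded_polynomial_ring
    (graded_ultraproduct U
      (\<lambda>i. indexed_poly_ring (k i) (UNIV :: nat set))
      (\<lambda>i. std_homogeneous (k i) (UNIV :: nat set)))
    (graded_ultraproduct_piece U
      (\<lambda>i. indexed_poly_ring (k i) (UNIV :: nat set))
      (\<lambda>i. std_homogeneous (k i) (UNIV :: nat set)))"
proof -
  have k: "cring (k i)" for i using assms(2)[of i] by (simp add: field_def domain_def)
  interpret graded_family U "\<lambda>i. indexed_poly_ring (k i) (UNIV :: nat set)"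
    "\<lambda>i. std_homogeneous (k i) (UNIV :: nat set)"
    using assms(1) cring.PR_graded[OF k]
    by unfold_locales (simp_all add: nonprincipal_ultrafilter_def)
  have "lowering S P {\<lambda>x. \<Psi> (\<lambda>i. J i (rep x i)) |J. \<forall>i. J i \<in> range (cring.shift (k i))}"
    by (rule lowering_S) (use cring.lowering_shift[OF k] in simp_all)
  then show ?thesis
    by (rule graded_polynomial_ring_if_lowering[OF graded_S subfield_S[OF field.subfield_PG0[OF assms(2)]]])
qed

end
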